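(* Assume that there is a function $\ell$ slowly varying at $\infty$ such that, for all $\lambda>0$, $$\lim_{t\to\infty}\frac{\rho(\lambda t)-\rho(t)}{\ell(t)}=\log\lambda .$$ (i) If $\ell(t)\sim(\log t)^\beta\, l(\log t)$ as $t\to\infty$ for some $\beta>0$ and some $l$ slowly varying at $\infty$, then, for each $j\in\mathbb{N}$, $$\limsup_{t\to\infty}\frac{K^*_j(t)-\mathbb{E}K^*_j(t)}{(\mathrm{Var}\,K^*_j(t)\,\log \mathrm{Var}\,K^*_j(t))^{1/2}}=\Big(\frac{2}{\beta}\Big)^{1/2}\quad\text{a.s.}$$ and $$\liminf_{t\to\infty}\frac{K^*_j(t)-\mathbb{E}K^*_j(t)}{(\mathrm{Var}\,K^*_j(t)\,\log \mathrm{Var}\,K^*_j(t))^{1/2}}=-\Big(\frac{2}{\beta}\Big)^{1/2}\quad\text{a.s.}$$ (ii) If $\ell(t)\sim\exp(\sigma(\log t)^\lambda)$ as $t\to\infty$ for some $\sigma>0$ and $\lambda\in(0,1)$, then, for each $j\in\mathbb{N}$, $$\limsup_{t\to\infty}\frac{K^*_j(t)-\mathbb{E}K^*_j(t)}{(\mathrm{Var}\,K^*_j(t)\,\log\log \mathrm{Var}\,K^*_j(t))^{1/2}}=\Big(\frac{2}{\lambda}\Big)^{1/2}\quad\text{a.s.}$$ and $$\liminf_{t\to\infty}\frac{K^*_j(t)-\mathbb{E}K^*_j(t)}{(\mathrm{Var}\,K^*_j(t)\,\log\log \mathrm{Var}\,K^*_j(t))^{1/2}}=-\Big(\frac{2}{\lambda}\Big)^{1/2}\quad\text{a.s.}$$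 In both cases (i) and (ii), for each $j\in\mathbb{N}$, as $t\to\infty$, $$\mathbb{E}K^*_j(t)\sim\frac{\ell(t)}{j}\quad\text{and}\quad \mathrm{Var}\,K^*_j(t)\sim\Big(\frac1j-\frac{(2j-1)!}{(j!)^2\,2^{2j}}\Big)\ell(t).$$
   Context: Let $(p_k)_{k\in\mathbb{N}}$ be a discrete probability distribution with $p_k>0$ for infinitely many $k$, and put $\rho(t):=\#\{k\in\mathbb{N}:1/p_k\le t\}$ for $t>0$. Poissonized Karlin occupancy scheme: balls are thrown at the arrival times $S_1<S_2<\dots$ of a unit-intensity Poisson process on $[0,\infty)$, and, independently of the arrival times, each ball falls independently into box $k$ with probability $p_k$, $k\in\mathbb{N}$. Equivalently, letting $\pi_k(t)$ be the number of balls in box $k$ at time $t$, the processes $(\pi_k(t))_{t\ge0}$, $k\in\mathbb{N}$, are independent Poisson processes with intensities $p_k$. For $j\in\mathbb{N}$ and $t\ge0$, $K^*_j(t):=\sum_{k\ge1}\mathbf{1}_{\{\pi_k(t)=j\}}$ is the number of boxes containing exactly $j$ balls at time $t$. The notation $f(t)\sim g(t)$ means $f(t)/g(t)\to1$. *)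

theory Defs
  imports "HOL-Probability.Probability" "HOL-Library.Landau_Symbols"
begin

text \<open>
  A Poisson process on \<open>[0,\<infinity>)\<close> with intensity \<open>c\<close>. The increments are differences of natural
  numbers; they are genuine differences almost surely because the paths are nondecreasing.
\<close>

locale poisson_process = prob_space M for M :: "'a measure" +
  fixes c :: real and N :: "real \<Rightarrow> 'a \<Rightarrow> nat"
  assumes c_pos: "c > 0"
    and N_measurable: "\<And>t. t \<ge> 0 \<Longrightarrow> random_variable (count_space UNIV) (N t)"
    and N_paths: "AE \<omega> in M. N 0 \<omega> = 0 \<and> mono_on {0..} (\<lambda>t. N t \<omega>) \<and>
                    (\<forall>t\<ge>0. continuous (at_right t) (\<lambda>u. N u \<omega>))"
    and N_increment: "\<And>s t. 0 \<le> s \<Longrightarrow> s < t \<Longrightarrow>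
          distr M (count_space UNIV) (\<lambda>\<omega>. N t \<omega> - N s \<omega>) = measure_pmf (poisson_pmf (c * (t - s)))"
    and N_indep: "\<And>(u :: nat \<Rightarrow> real) n. 0 \<le> u 0 \<Longrightarrow> strict_mono u \<Longrightarrow>
          indep_vars (\<lambda>_. count_space UNIV) (\<lambda>i \<omega>. N (u (Suc i)) \<omega> - N (u i) \<omega>) {..<n}"

text \<open>
  The boxes and the balls are numbered by \<open>0, 1, 2, \<dots>\<close>: ball \<open>n\<close> arrives at time \<open>S n\<close> and falls
  into box \<open>X n\<close>. Local finiteness of the arrivals ensures that the cardinalities below are those
  of finite sets almost surely (\<open>card\<close> of an infinite set is \<open>0\<close>).
\<close>

locale poissonized_karlin_scheme = prob_space M for M :: "'a measure" +
  fixes p :: "nat \<Rightarrow> real" and S :: "nat \<Rightarrow> 'a \<Rightarrow> real" and X :: "nat \<Rightarrow> 'a \<Rightarrow> nat"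
  assumes p_nonneg: "\<And>k. p k \<ge> 0"
    and p_sums: "p sums 1"
    and S_arrivals: "AE \<omega> in M. strict_mono (\<lambda>n. S n \<omega>) \<and> (\<forall>t. finite {n. S n \<omega> \<le> t})"
    and S_poisson: "poisson_process M 1 (\<lambda>t \<omega>. card {n. S n \<omega> \<le> t})"
    and X_indep: "indep_vars (\<lambda>_. count_space UNIV) X UNIV"
    and X_law: "\<And>n k. prob {\<omega> \<in> space M. X n \<omega> = k} = p k"
    and S_X_indep: "indep_var (\<Pi>\<^sub>M n\<in>UNIV. borel) (\<lambda>\<omega> n. S n \<omega>)
                              (\<Pi>\<^sub>M n\<in>UNIV. count_space UNIV) (\<lambda>\<omega> n. X n \<omega>)"

definition box_count ::
    "(nat \<Rightarrow> 'a \<Rightarrow> real) \<Rightarrow> (nat \<Rightarrow> 'a \<Rightarrow> nat) \<Rightarrow> nat \<Rightarrow> real \<Rightarrow> 'a \<Rightarrow> nat" where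
  "box_count S X k t \<omega> = card {n. S n \<omega> \<le> t \<and> X n \<omega> = k}"

text \<open>The number of boxes with exactly \<open>j\<close> balls at time \<open>t\<close>; meaningful only for \<open>j \<ge> 1\<close>, as
  infinitely many boxes are empty.\<close>

definition Kstar ::
    "(nat \<Rightarrow> 'a \<Rightarrow> real) \<Rightarrow> (nat \<Rightarrow> 'a \<Rightarrow> nat) \<Rightarrow> nat \<Rightarrow> real \<Rightarrow> 'a \<Rightarrow> real" where
  "Kstar S X j t \<omega> = real (card {k. box_count S X k t \<omega> = j})"

text \<open>The condition \<open>0 < p k\<close> implements the convention \<open>1 / 0 = \<infinity>\<close>.\<close>

definition rho :: "(nat \<Rightarrow> real) \<Rightarrow> real \<Rightarrow> real" where
  "rho p t = real (card {k. 0 < p k \<and> 1 / p k \<le> t})"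

text \<open>Slow variation at \<open>\<infinity>\<close> of a function that is positive and measurable near \<open>\<infinity>\<close>.\<close>

definition slowly_varying :: "(real \<Rightarrow> real) \<Rightarrow> bool" where
  "slowly_varying f \<longleftrightarrow>
     (\<exists>a. f \<in> borel_measurable (restrict_space borel {a..}) \<and> (\<forall>t\<ge>a. f t > 0)) \<and>
     (\<forall>c>0. ((\<lambda>t. f (c * t) / f t) \<longlongrightarrow> 1) at_top)"

end

theory Submission
  imports Defs "HOL-Real_Asymp.Real_Asymp"
begin

text \<open>
  Both cases are the statement that \<open>limsup (K*(t) - E K*(t)) / sqrt (2 v(t) log log t) = 1\<close> with
  \<open>v(t) = Var K*(t)\<close>; they only differ in how \<open>log log t\<close> is expressed through \<open>v(t)\<close>.

  By Poisson splitting the box counts are independent over the boxes, so everything is about sums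
  of independent indicators. On the skeleton \<open>exp (\<delta> n)\<close> the Chernoff bound with the exact variance and
  Borel-Cantelli give the upper bound. Between skeleton points \<open>K*_j\<close> is a difference of two monotone
  counts, whose increments are again sums of independent indicators and are controlled by chaining.
  For the lower bound one takes the times \<open>A^(2n)\<close>: the boxes with \<open>p_k t\<close> between \<open>1/A\<close> and \<open>A\<close> carry
  almost all the variance and form disjoint, hence independent, blocks, to which a lower
  exponential bound of Kolmogorov type and the second Borel-Cantelli lemma apply.

  The asymptotics of the mean come from \<open>E K*_j(t) = \<integral> f_j'(x) (\<rho>(t/x) - \<rho>(t)) dx\<close> with
  \<open>f_j(x) = exp (-x) x^j / j!\<close> and dominated convergence, the variance from
  \<open>f_j(x)^2 = const * f_{2j}(2x)\<close>.
\<close>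

section \<open>Sums of independent indicators\<close>

text \<open>On the skeleton \<open>exp (\<delta> * real n)\<close> the iterated logarithm of time is
  \<open>ln (real n)\<close> up to an additive constant, so tail probabilities become powers of
  \<open>n\<close> and the constant 2 under the root is the Borel-Cantelli threshold between
  summable and divergent powers. Both growth hypotheses enter the limit theorem only through
  \<open>L t \<ge> ln t powr \<kappa>\<close> for some positive \<kappa>. This makes
  \<open>ln (real n)\<close> negligible against \<open>sqrt (L t)\<close> on the skeleton, hence all
  tilting parameters small, and only then do exponential bounds for indicators reach the Gaussian
  exponent. The obstacle is the time between skeleton points. Over one cell the mean of a monotone
  count can move by an amount of order \<open>L t\<close>, far beyond the admissible error of order
  \<open>sqrt (L t * ln (real n))\<close>. Monotonicity alone is therefore too weak, and the cell
  has to be refined until the mean moves less than the error. Slow variation is used through the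
  uniform convergence theorem: once to see that \<open>l (ln t)\<close> is invisible on the scale
  \<open>ln (ln t)\<close>, once to compare variances within a cell.\<close>

lemma exp_quadratic_bounds:
  fixes x u :: real
  assumes "\<bar>x\<bar> \<le> 1" "\<bar>u\<bar> \<le> 1"
  shows exp_upper_quadratic: "exp (u * x) \<le> 1 + u * x + u\<^sup>2 * x\<^sup>2 / 2 * (1 + \<bar>u\<bar>)"
    and exp_lower_quadratic: "exp (u * x) \<ge> 1 + u * x + u\<^sup>2 * x\<^sup>2 / 2 * (1 - \<bar>u\<bar>)"
proof -
  let ?y = "u * x"
  have y: "\<bar>?y\<bar> \<le> 1" using assms by (simp add: abs_mult mult_le_one)
  obtain t where t: "\<bar>t\<bar> \<le> \<bar>?y\<bar>" "exp ?y = (\<Sum>m<3. ?y ^ m / fact m) + exp t / fact 3 * ?y ^ 3"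
    using Maclaurin_exp_le[of ?y 3] by auto
  \<comment> \<open>The bound 3 turns the cubic Taylor coefficient \<open>exp t / 6\<close> into at
    most 1/2, the quadratic coefficient; the spare factor \<open>\<bar>u\<bar>\<close> becomes the
    relative error in both bounds.\<close>
  have "exp t \<le> exp 1" using t(1) y by simp
  also have "\<dots> \<le> 3" using exp_le by simp
  finally have et: "exp t \<le> 3" .
  have "\<bar>exp t / 6 * ?y ^ 3\<bar> = exp t / 6 * \<bar>?y\<bar> ^ 3" by (simp add: abs_mult power_abs)
  also have "\<dots> \<le> 3 / 6 * \<bar>?y\<bar> ^ 3" using et by (intro mult_right_mono) auto
  also have "\<bar>?y\<bar> ^ 3 = \<bar>u\<bar> * \<bar>x\<bar> * (u\<^sup>2 * x\<^sup>2)"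
    by (simp add: abs_mult power3_eq_cube power2_eq_square mult_ac abs_mult_self_eq)
  also have "\<dots> \<le> \<bar>u\<bar> * 1 * (u\<^sup>2 * x\<^sup>2)" using assms by (intro mult_mono) auto
  finally have rem: "\<bar>exp t / 6 * ?y ^ 3\<bar> \<le> \<bar>u\<bar> * (u\<^sup>2 * x\<^sup>2) / 2" by simp
  have eq: "exp ?y = 1 + ?y + u\<^sup>2 * x\<^sup>2 / 2 + exp t / 6 * ?y ^ 3"
    unfolding t(2) by (simp add: eval_nat_numeral fact_numeral)
  have split: "u\<^sup>2 * x\<^sup>2 / 2 * (1 + \<bar>u\<bar>) = u\<^sup>2 * x\<^sup>2 / 2 + \<bar>u\<bar> * (u\<^sup>2 * x\<^sup>2) / 2"
    "u\<^sup>2 * x\<^sup>2 / 2 * (1 - \<bar>u\<bar>) = u\<^sup>2 * x\<^sup>2 / 2 - \<bar>u\<bar> * (u\<^sup>2 * x\<^sup>2) / 2"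
    by (simp_all add: field_simps)
  show "exp ?y \<le> 1 + ?y + u\<^sup>2 * x\<^sup>2 / 2 * (1 + \<bar>u\<bar>)" "exp ?y \<ge> 1 + ?y + u\<^sup>2 * x\<^sup>2 / 2 * (1 - \<bar>u\<bar>)"
    unfolding eq split using rem by linarith+
qed

text \<open>Turns a linear lower bound for a single factor back into an exponential, so that the
  product over independent indicators becomes an exponential of a sum. For \<open>w > 1\<close> the
  exponent is negative and the claim trivial.\<close>

lemma one_plus_ge_exp:
  fixes w :: real
  assumes "w \<ge> 0"
  shows "exp (w - w\<^sup>2) \<le> 1 + w"
proof -
  have "w - w\<^sup>2 \<le> ln (1 + w)"
  proof (cases "w \<le> 1")
    case True then show ?thesis using ln_one_plus_pos_lower_bound[of w] assms by simp
  next
    case False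
    then have "w - w\<^sup>2 \<le> 0" by (simp add: power2_eq_square)
    also have "0 \<le> ln (1 + w)" using assms by simp
    finally show ?thesis .
  qed
  then have "exp (w - w\<^sup>2) \<le> exp (ln (1 + w))" by (simp only: exp_le_cancel_iff)
  then show ?thesis using assms by simp
qed

text \<open>The linear terms cancel by centring and the second moments combine to the variance
  \<open>q * (1 - q)\<close>, so after multiplying over independent indicators only the total
  variance remains. In the lower bound one factor \<open>\<bar>u\<bar>\<close> comes from the Taylor
  remainder and a second from \<open>w\<^sup>2 \<le> w * \<bar>u\<bar>\<close> in
  \<open>one_plus_ge_exp\<close>, whence \<open>2 * \<bar>u\<bar>\<close>.\<close>

lemma bernoulli_mgf_bounds:
  fixes q u :: real
  assumes q: "0 \<le> q" "q \<le> 1" and u: "\<bar>u\<bar> \<le> 1"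
  defines "m \<equiv> q * exp (u * (1 - q)) + (1 - q) * exp (u * (0 - q))"
  shows "m \<le> exp (q * (1 - q) * (u\<^sup>2 / 2 * (1 + \<bar>u\<bar>)))"
    and "exp (q * (1 - q) * (u\<^sup>2 / 2 * (1 - 2 * \<bar>u\<bar>))) \<le> m"
proof -
  have "m \<le> q * (1 + u * (1-q) + u\<^sup>2 * (1-q)\<^sup>2 / 2 * (1 + \<bar>u\<bar>))
         + (1-q) * (1 + u * (0-q) + u\<^sup>2 * (0-q)\<^sup>2 / 2 * (1 + \<bar>u\<bar>))"
    unfolding m_def using assms by (intro add_mono mult_left_mono exp_upper_quadratic) auto
  also have "\<dots> = 1 + q * (1 - q) * (u\<^sup>2 / 2 * (1 + \<bar>u\<bar>))"
    by (simp add: field_simps power2_eq_square)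
  also have "\<dots> \<le> exp (q * (1 - q) * (u\<^sup>2 / 2 * (1 + \<bar>u\<bar>)))" by simp
  finally show "m \<le> exp (q * (1 - q) * (u\<^sup>2 / 2 * (1 + \<bar>u\<bar>)))" .
  define w where "w = q * (1 - q) * (u\<^sup>2 / 2 * (1 - \<bar>u\<bar>))"
  have w0: "w \<ge> 0" unfolding w_def using assms by (intro mult_nonneg_nonneg) auto
  have "q * (1 - q) \<le> 1" using q by (intro mult_le_one) auto
  then have "w \<le> 1 * (u\<^sup>2 / 2 * (1 - \<bar>u\<bar>))" unfolding w_def using u by (intro mult_right_mono) auto
  also have "\<dots> \<le> u\<^sup>2 / 2 * 1" using u by (subst mult_1, intro mult_left_mono) auto
  finally have "w \<le> u\<^sup>2 / 2" by simp
  also have "\<dots> \<le> \<bar>u\<bar> / 2"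
    using mult_left_le_one_le[of "\<bar>u\<bar>" "\<bar>u\<bar>"] u by (simp add: power2_eq_square)
  finally have w1: "w \<le> \<bar>u\<bar>" using u by simp
  have "q * (1 - q) * (u\<^sup>2 / 2 * (1 - 2 * \<bar>u\<bar>)) \<le> w - w\<^sup>2"
  proof -
    have "w\<^sup>2 \<le> w * \<bar>u\<bar>" using w0 w1 by (simp add: power2_eq_square mult_left_mono)
    also have "\<dots> = q * (1 - q) * (u\<^sup>2 / 2) * ((1 - \<bar>u\<bar>) * \<bar>u\<bar>)" by (simp add: w_def)
    also have "\<dots> \<le> q * (1 - q) * (u\<^sup>2 / 2) * \<bar>u\<bar>"
      using assms by (intro mult_left_mono) (auto intro!: mult_nonneg_nonneg mult_left_le_one_le)
    finally have "w\<^sup>2 \<le> q * (1 - q) * (u\<^sup>2 / 2) * \<bar>u\<bar>" .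
    moreover have "q * (1 - q) * (u\<^sup>2 / 2 * (1 - 2 * \<bar>u\<bar>)) = w - q * (1 - q) * (u\<^sup>2 / 2) * \<bar>u\<bar>"
      unfolding w_def by (simp add: field_simps)
    ultimately show ?thesis by linarith
  qed
  then have "exp (q * (1 - q) * (u\<^sup>2 / 2 * (1 - 2 * \<bar>u\<bar>))) \<le> exp (w - w\<^sup>2)" by (simp only: exp_le_cancel_iff)
  also have "\<dots> \<le> 1 + w" by (rule one_plus_ge_exp[OF w0])
  also have "\<dots> = q * (1 + u * (1-q) + u\<^sup>2 * (1-q)\<^sup>2 / 2 * (1 - \<bar>u\<bar>))
         + (1-q) * (1 + u * (0-q) + u\<^sup>2 * (0-q)\<^sup>2 / 2 * (1 - \<bar>u\<bar>))"
    unfolding w_def by (simp add: field_simps power2_eq_square)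
  also have "\<dots> \<le> m"
    unfolding m_def using assms by (intro add_mono mult_left_mono exp_lower_quadratic) auto
  finally show "exp (q * (1 - q) * (u\<^sup>2 / 2 * (1 - 2 * \<bar>u\<bar>))) \<le> m" .
qed

text \<open>Instantiated with two kinds of events for the boxes: holding exactly \<open>j\<close>
  balls at one time, possibly restricted to a set of boxes, and crossing the level \<open>i\<close>
  between two times. Summability leaves almost surely only finitely many events, so that
  \<open>card\<close> is a genuine count.\<close>

locale bernoulli_family = prob_space M for M :: "'a measure" +
  fixes B :: "nat \<Rightarrow> 'a \<Rightarrow> bool"
  assumes indep: "indep_vars (\<lambda>_. count_space UNIV) B UNIV"
    and summable: "summable (\<lambda>k. prob {\<omega> \<in> space M. B k \<omega>})"
begin

definition bprob :: "nat \<Rightarrow> real" where "bprob k = prob {\<omega> \<in> space M. B k \<omega>}"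
definition btotal :: "'a \<Rightarrow> real" where "btotal \<omega> = real (card {k. B k \<omega>})"
definition bmean :: real where "bmean = (\<Sum>k. bprob k)"
definition bvar :: real where "bvar = (\<Sum>k. bprob k * (1 - bprob k))"

lemma B_measurable [measurable]: "B k \<in> measurable M (count_space UNIV)"
  using indep by (auto simp: indep_vars_def)

lemma bprob_nonneg: "bprob k \<ge> 0" and bprob_le_1: "bprob k \<le> 1"
  by (auto simp: bprob_def)

lemma summable_bprob: "summable bprob"
  using summable unfolding bprob_def[abs_def] .

lemma summable_bvar: "summable (\<lambda>k. bprob k * (1 - bprob k))"
  by (rule summable_comparison_test'[OF summable_bprob, of 0])
     (auto simp: bprob_nonneg bprob_le_1 abs_mult intro!: mult_left_le)

lemma bvar_nonneg: "bvar \<ge> 0"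
  unfolding bvar_def by (intro suminf_nonneg summable_bvar mult_nonneg_nonneg) (auto simp: bprob_nonneg bprob_le_1)

lemma bvar_le_bmean: "bvar \<le> bmean"
  unfolding bvar_def bmean_def
  by (intro suminf_le summable_bvar summable_bprob) (auto simp: bprob_nonneg bprob_le_1 intro!: mult_left_le)

lemma btotal_measurable [measurable]: "btotal \<in> borel_measurable M"
  unfolding btotal_def[abs_def] by measurable

lemma AE_finite: "AE \<omega> in M. finite {k. B k \<omega>}"
proof -
  have "AE \<omega> in M. eventually (\<lambda>n. \<omega> \<in> space M - {\<omega> \<in> space M. B n \<omega>}) sequentially"
    using summable by (intro borel_cantelli_AE1) (auto simp: emeasure_eq_measure)
  then show ?thesis
  proof (eventually_elim)
    case (elim \<omega>)
    then obtain N where "\<And>n. n \<ge> N \<Longrightarrow> \<not> B n \<omega>" by (auto simp: eventually_sequentially)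
    then have "{k. B k \<omega>} \<subseteq> {..<N}" by (auto simp: not_less[symmetric])
    then show ?case by (rule finite_subset) auto
  qed
qed

lemma partial_sum_eq: "finite {k. B k \<omega>} \<Longrightarrow> \<exists>N. \<forall>n\<ge>N. (\<Sum>k<n. of_bool (B k \<omega>)) = btotal \<omega>"
proof -
  assume fin: "finite {k. B k \<omega>}"
  then obtain N where N: "{k. B k \<omega>} \<subseteq> {..<N}"
    by (metis bounded_nat_set_is_finite finite_nat_iff_bounded)
  show ?thesis
  proof (intro exI allI impI)
    fix n assume "n \<ge> N"
    then have "{k. k < n \<and> B k \<omega>} = {k. B k \<omega>}" using N by auto
    then show "(\<Sum>k<n. of_bool (B k \<omega>)) = btotal \<omega>"
      by (simp add: btotal_def sum.If_cases of_bool_def lessThan_def Collect_conj_eq[symmetric])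
  qed
qed

lemma AE_partial_sums: "AE \<omega> in M. (\<lambda>n. \<Sum>k<n. of_bool (B k \<omega>)) \<longlonglongrightarrow> btotal \<omega>"
  using AE_finite
proof eventually_elim
  case (elim \<omega>)
  from partial_sum_eq[OF this] obtain N where "\<forall>n\<ge>N. (\<Sum>k<n. of_bool (B k \<omega>)) = btotal \<omega>" ..
  then show ?case by (intro tendsto_eventually) (auto simp: eventually_sequentially)
qed

lemma expectation_of_bool: "expectation (\<lambda>\<omega>. of_bool (B k \<omega>)) = bprob k"
proof -
  have "expectation (\<lambda>\<omega>. of_bool (B k \<omega>) :: real) = expectation (indicator {\<omega> \<in> space M. B k \<omega>})"
    by (intro Bochner_Integration.integral_cong) (auto simp: indicator_def)
  also have "\<dots> = prob {\<omega> \<in> space M. B k \<omega>}" by simp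
  finally show ?thesis by (simp add: bprob_def)
qed

lemma prob_B_both:
  "prob {\<omega> \<in> space M. B k \<omega> \<and> B l \<omega>} = (if k = l then bprob k else bprob k * bprob l)"
proof (cases "k = l")
  case False
  have "prob (\<Inter>i\<in>{k,l}. B i -` {True} \<inter> space M) = (\<Prod>i\<in>{k,l}. prob (B i -` {True} \<inter> space M))"
    using indep by (intro indep_varsD[where I=UNIV]) auto
  then show ?thesis using False
    by (auto simp: bprob_def vimage_def Int_def conj_ac intro!: arg_cong[where f=prob]
         cong: conj_cong)
qed (simp add: bprob_def)

lemma
  shows integrable_btotal: "integrable M btotal"
    and expectation_btotal: "expectation btotal = bmean"
proof -
  have int: "integrable M (\<lambda>\<omega>. \<Sum>k<n. of_bool (B k \<omega>) :: real)" for n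
    by (intro Bochner_Integration.integrable_sum integrable_const_bound[where B=1]) auto
  have mono: "AE \<omega> in M. mono (\<lambda>n. \<Sum>k<n. of_bool (B k \<omega>) :: real)"
    by (intro AE_I2 monoI sum_mono2) auto
  have lim: "(\<lambda>n. \<integral>\<omega>. (\<Sum>k<n. of_bool (B k \<omega>)) \<partial>M) \<longlonglongrightarrow> bmean"
    unfolding bmean_def
    by (subst Bochner_Integration.integral_sum)
       (auto intro!: integrable_const_bound[where B=1] summable_LIMSEQ summable_bprob simp: expectation_of_bool)
  show "integrable M btotal" "expectation btotal = bmean"
    using integrable_monotone_convergence[OF int mono AE_partial_sums lim]
      integral_monotone_convergence[OF int mono AE_partial_sums lim] by auto
qed

lemma
  shows integrable_btotal_sq: "integrable M (\<lambda>\<omega>. (btotal \<omega>)\<^sup>2)"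
    and expectation_btotal_sq: "expectation (\<lambda>\<omega>. (btotal \<omega>)\<^sup>2) = bmean\<^sup>2 + bvar"
proof -
  have int: "integrable M (\<lambda>\<omega>. (\<Sum>k<n. of_bool (B k \<omega>) :: real)\<^sup>2)" for n
  proof (rule integrable_const_bound[where B="(real n)\<^sup>2"])
    have "(\<Sum>k<n. of_bool (B k \<omega>) :: real) \<le> (\<Sum>k<n. 1)" for \<omega> by (intro sum_mono) auto
    then show "AE \<omega> in M. norm ((\<Sum>k<n. of_bool (B k \<omega>) :: real)\<^sup>2) \<le> (real n)\<^sup>2"
      by (intro AE_I2) (auto intro!: power_mono sum_nonneg)
  qed measurable
  have mono: "AE \<omega> in M. mono (\<lambda>n. (\<Sum>k<n. of_bool (B k \<omega>) :: real)\<^sup>2)"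
    by (intro AE_I2 monoI power_mono sum_mono2 sum_nonneg) auto
  have lim0: "AE \<omega> in M. (\<lambda>n. (\<Sum>k<n. of_bool (B k \<omega>))\<^sup>2) \<longlonglongrightarrow> (btotal \<omega>)\<^sup>2"
    using AE_partial_sums by eventually_elim (auto intro!: tendsto_intros)
  have prodint: "(\<integral>\<omega>. of_bool (B k \<omega>) * of_bool (B l \<omega>) \<partial>M) = (if k = l then bprob k else bprob k * bprob l)" for k l
  proof -
    have "(\<integral>\<omega>. of_bool (B k \<omega>) * of_bool (B l \<omega>) \<partial>M :: real) = expectation (indicator {\<omega> \<in> space M. B k \<omega> \<and> B l \<omega>})"
      by (intro Bochner_Integration.integral_cong) (auto simp: indicator_def)
    then show ?thesis by (simp add: prob_B_both)
  qed
  have intp: "integrable M (\<lambda>\<omega>. of_bool (B k \<omega>) * of_bool (B l \<omega>) :: real)" for k l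
    by (intro integrable_const_bound[where B=1]) auto
  have eq: "(\<integral>\<omega>. (\<Sum>k<n. of_bool (B k \<omega>))\<^sup>2 \<partial>M) = (\<Sum>k<n. bprob k)\<^sup>2 + (\<Sum>k<n. bprob k * (1 - bprob k))" for n
  proof -
    have "(\<integral>\<omega>. (\<Sum>k<n. of_bool (B k \<omega>))\<^sup>2 \<partial>M) = (\<integral>\<omega>. (\<Sum>k<n. \<Sum>l<n. of_bool (B k \<omega>) * of_bool (B l \<omega>)) \<partial>M :: real)"
      by (simp only: power2_eq_square sum_product)
    also have "\<dots> = (\<Sum>k<n. \<Sum>l<n. \<integral>\<omega>. of_bool (B k \<omega>) * of_bool (B l \<omega>) \<partial>M)"
      by (simp only: Bochner_Integration.integral_sum intp Bochner_Integration.integrable_sum)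
    also have "\<dots> = (\<Sum>k<n. \<Sum>l<n. bprob k * bprob l + (if k = l then bprob k * (1 - bprob k) else 0))"
      unfolding prodint by (intro sum.cong) (auto simp: algebra_simps)
    also have "\<dots> = (\<Sum>k<n. bprob k)\<^sup>2 + (\<Sum>k<n. bprob k * (1 - bprob k))"
      by (simp add: sum.distrib power2_eq_square sum_product)
    finally show ?thesis .
  qed
  have lim: "(\<lambda>n. \<integral>\<omega>. (\<Sum>k<n. of_bool (B k \<omega>))\<^sup>2 \<partial>M) \<longlonglongrightarrow> bmean\<^sup>2 + bvar"
    unfolding eq bmean_def bvar_def
    by (intro tendsto_intros summable_LIMSEQ summable_bprob summable_bvar)
  show "integrable M (\<lambda>\<omega>. (btotal \<omega>)\<^sup>2)" "expectation (\<lambda>\<omega>. (btotal \<omega>)\<^sup>2) = bmean\<^sup>2 + bvar"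
    using integrable_monotone_convergence[OF int mono lim0 lim]
      integral_monotone_convergence[OF int mono lim0 lim] by auto
qed

lemma variance_btotal: "variance btotal = bvar"
  by (subst variance_eq[OF integrable_btotal integrable_btotal_sq])
     (simp add: expectation_btotal expectation_btotal_sq)

lemma mgf_partial:
  fixes u :: real
  shows "integrable M (\<lambda>\<omega>. exp (u * (\<Sum>k<n. of_bool (B k \<omega>) - bprob k)))"
    and "expectation (\<lambda>\<omega>. exp (u * (\<Sum>k<n. of_bool (B k \<omega>) - bprob k))) =
      (\<Prod>k<n. bprob k * exp (u * (1 - bprob k)) + (1 - bprob k) * exp (u * (0 - bprob k)))"
proof -
  have iv: "indep_vars (\<lambda>_. borel) (\<lambda>k \<omega>. exp (u * (of_bool (B k \<omega>) - bprob k))) {..<n}"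
    by (rule indep_vars_compose2[where Y="\<lambda>k b. exp (u * (of_bool b - bprob k))", OF indep_vars_subset[OF indep]]) auto
  have eq: "exp (u * (\<Sum>k<n. of_bool (B k \<omega>) - bprob k)) = (\<Prod>k<n. exp (u * (of_bool (B k \<omega>) - bprob k)))" for \<omega>
    by (simp add: exp_sum sum_distrib_left)
  have one: "exp (u * (of_bool (B k \<omega>) - bprob k)) =
     of_bool (B k \<omega>) * exp (u * (1 - bprob k)) + (1 - of_bool (B k \<omega>)) * exp (u * (0 - bprob k))" for k \<omega>
    by auto
  have int0: "integrable M (\<lambda>\<omega>. of_bool (B k \<omega>) :: real)" for k
    by (intro integrable_const_bound[where B=1]) auto
  have int: "integrable M (\<lambda>\<omega>. exp (u * (of_bool (B k \<omega>) - bprob k)))" for k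
    unfolding one using int0 by (intro Bochner_Integration.integrable_add integrable_mult_left Bochner_Integration.integrable_diff integrable_const)
  have ex: "expectation (\<lambda>\<omega>. exp (u * (of_bool (B k \<omega>) - bprob k))) =
     bprob k * exp (u * (1 - bprob k)) + (1 - bprob k) * exp (u * (0 - bprob k))" for k
    unfolding one using int0[of k]
    by (subst Bochner_Integration.integral_add) (auto simp: expectation_of_bool prob_space)
  show "integrable M (\<lambda>\<omega>. exp (u * (\<Sum>k<n. of_bool (B k \<omega>) - bprob k)))"
    unfolding eq by (rule indep_vars_integrable[OF _ iv int]) auto
  show "expectation (\<lambda>\<omega>. exp (u * (\<Sum>k<n. of_bool (B k \<omega>) - bprob k))) =
      (\<Prod>k<n. bprob k * exp (u * (1 - bprob k)) + (1 - bprob k) * exp (u * (0 - bprob k)))"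
    unfolding eq by (subst indep_vars_lebesgue_integral[OF _ iv int]) (auto simp: ex)
qed

lemma mgf_partial_bounds:
  assumes "\<bar>u\<bar> \<le> 1"
  shows "expectation (\<lambda>\<omega>. exp (u * (\<Sum>k<n. of_bool (B k \<omega>) - bprob k))) \<le>
      exp ((\<Sum>k<n. bprob k * (1 - bprob k)) * (u\<^sup>2 / 2 * (1 + \<bar>u\<bar>)))"
    and "exp ((\<Sum>k<n. bprob k * (1 - bprob k)) * (u\<^sup>2 / 2 * (1 - 2 * \<bar>u\<bar>))) \<le>
      expectation (\<lambda>\<omega>. exp (u * (\<Sum>k<n. of_bool (B k \<omega>) - bprob k)))"
  unfolding mgf_partial(2) sum_distrib_right exp_sum[OF finite_lessThan]
  using bernoulli_mgf_bounds[OF bprob_nonneg bprob_le_1 assms]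
  by (auto intro!: prod_mono add_nonneg_nonneg mult_nonneg_nonneg simp: bprob_nonneg bprob_le_1)

text \<open>The centred partial sums are not monotone in \<open>n\<close>, so the passage to
  infinitely many indicators uses Fatou's lemma; this suffices since the bounds are uniform in
  \<open>n\<close>.\<close>

lemma mgf_upper:
  assumes u: "\<bar>u\<bar> \<le> 1"
  shows "integrable M (\<lambda>\<omega>. exp (u * (btotal \<omega> - bmean)))"
    and "expectation (\<lambda>\<omega>. exp (u * (btotal \<omega> - bmean))) \<le> exp (bvar * (u\<^sup>2 / 2 * (1 + \<bar>u\<bar>)))"
proof -
  let ?S = "\<lambda>n \<omega>. exp (u * (\<Sum>k<n. of_bool (B k \<omega>) - bprob k))"
  let ?b = "exp (bvar * (u\<^sup>2 / 2 * (1 + \<bar>u\<bar>)))"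
  have lim: "AE \<omega> in M. (\<lambda>n. ?S n \<omega>) \<longlonglongrightarrow> exp (u * (btotal \<omega> - bmean))"
    using AE_partial_sums
    by eventually_elim (auto simp: sum_subtractf bmean_def intro!: tendsto_intros summable_LIMSEQ summable_bprob)
  have "(\<integral>\<^sup>+\<omega>. ennreal (exp (u * (btotal \<omega> - bmean))) \<partial>M) = (\<integral>\<^sup>+\<omega>. liminf (\<lambda>n. ennreal (?S n \<omega>)) \<partial>M)"
  proof (rule nn_integral_cong_AE)
    show "AE \<omega> in M. ennreal (exp (u * (btotal \<omega> - bmean))) = liminf (\<lambda>n. ennreal (?S n \<omega>))"
      using lim by eventually_elim (intro lim_imp_Liminf[symmetric] tendsto_ennrealI, auto)
  qed
  also have "\<dots> \<le> liminf (\<lambda>n. \<integral>\<^sup>+\<omega>. ennreal (?S n \<omega>) \<partial>M)"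
    by (intro nn_integral_liminf) measurable
  also have "\<dots> \<le> liminf (\<lambda>n. ennreal ?b)"
  proof (intro Liminf_mono always_eventually allI)
    fix n
    have "(\<integral>\<^sup>+\<omega>. ennreal (?S n \<omega>) \<partial>M) = ennreal (expectation (?S n))"
      by (intro nn_integral_eq_integral mgf_partial) auto
    also have "expectation (?S n) \<le> exp ((\<Sum>k<n. bprob k * (1 - bprob k)) * (u\<^sup>2 / 2 * (1 + \<bar>u\<bar>)))"
      by (rule mgf_partial_bounds[OF u])
    also have "\<dots> \<le> ?b"
      unfolding bvar_def exp_le_cancel_iff
      by (intro mult_right_mono sum_le_suminf summable_bvar) (auto simp: bprob_nonneg bprob_le_1)
    finally show "(\<integral>\<^sup>+\<omega>. ennreal (?S n \<omega>) \<partial>M) \<le> ennreal ?b" by (simp add: ennreal_leI)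
  qed
  also have "\<dots> = ennreal ?b" by (simp add: Liminf_const)
  finally have *: "(\<integral>\<^sup>+\<omega>. ennreal (exp (u * (btotal \<omega> - bmean))) \<partial>M) \<le> ennreal ?b" .
  show int: "integrable M (\<lambda>\<omega>. exp (u * (btotal \<omega> - bmean)))"
    by (rule integrableI_bounded) (use * in \<open>auto simp: le_less_trans\<close>)
  have "ennreal (expectation (\<lambda>\<omega>. exp (u * (btotal \<omega> - bmean)))) \<le> ennreal ?b"
    using * by (subst nn_integral_eq_integral[OF int, symmetric]) auto
  then show "expectation (\<lambda>\<omega>. exp (u * (btotal \<omega> - bmean))) \<le> ?b"
    by (simp add: ennreal_le_iff)
qed

text \<open>Fatou's lemma goes the wrong way for a lower bound, hence the restriction to finitely
  many indicators. The bound is applied to finite blocks of boxes.\<close>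

lemma mgf_lower:
  assumes u: "\<bar>u\<bar> \<le> 1" and fin: "\<And>k \<omega>. k \<ge> n \<Longrightarrow> \<not> B k \<omega>"
  shows "exp (bvar * (u\<^sup>2 / 2 * (1 - 2 * \<bar>u\<bar>))) \<le> expectation (\<lambda>\<omega>. exp (u * (btotal \<omega> - bmean)))"
proof -
  have q0: "bprob k = 0" if "k \<ge> n" for k using fin[OF that] by (simp add: bprob_def)
  have m: "bmean = (\<Sum>k<n. bprob k)" unfolding bmean_def by (rule suminf_finite) (auto simp: q0)
  have v: "bvar = (\<Sum>k<n. bprob k * (1 - bprob k))" unfolding bvar_def by (rule suminf_finite) (auto simp: q0)
  have t: "btotal \<omega> = (\<Sum>k<n. of_bool (B k \<omega>))" for \<omega>
  proof -
    have "{k. k < n \<and> B k \<omega>} = {k. B k \<omega>}" using fin by (auto simp: not_le[symmetric])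
    then show ?thesis
      by (simp add: btotal_def sum.If_cases of_bool_def lessThan_def Collect_conj_eq[symmetric])
  qed
  show ?thesis using mgf_partial_bounds(2)[OF u, of n] by (simp add: m v t sum_subtractf)
qed

lemma chernoff:
  assumes u: "0 < u" "u \<le> 1" and V: "bvar \<le> V"
  shows "prob {\<omega> \<in> space M. \<bar>btotal \<omega> - bmean\<bar> \<ge> x} \<le> 2 * exp (- u * x + V * (u\<^sup>2 / 2 * (1 + u)))"
proof -
  let ?W = "\<lambda>\<omega>. btotal \<omega> - bmean"
  have *: "prob {\<omega> \<in> space M. s * ?W \<omega> \<ge> x} \<le> exp (- u * x + V * (u\<^sup>2 / 2 * (1 + u)))" if s: "s = 1 \<or> s = -1" for s :: real
  proof -
    have us: "\<bar>s * u\<bar> \<le> 1" using s u by auto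
    have "prob {\<omega> \<in> space M. exp (s * u * ?W \<omega>) \<ge> exp (u * x)} \<le> expectation (\<lambda>\<omega>. exp (s * u * ?W \<omega>)) / exp (u * x)"
      using mgf_upper(1)[OF us] by (intro integral_Markov_inequality_measure[where A="{}"]) auto
    also have "{\<omega> \<in> space M. exp (s * u * ?W \<omega>) \<ge> exp (u * x)} = {\<omega> \<in> space M. s * ?W \<omega> \<ge> x}"
    proof -
      have "(exp (s * u * ?W \<omega>) \<ge> exp (u * x)) = (s * ?W \<omega> \<ge> x)" for \<omega>
      proof -
        have "(exp (s * u * ?W \<omega>) \<ge> exp (u * x)) = (u * (s * ?W \<omega>) \<ge> u * x)" by (simp add: mult_ac)
        also have "\<dots> = (s * ?W \<omega> \<ge> x)" using u by (simp add: mult_le_cancel_left_pos)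
        finally show ?thesis .
      qed
      then show ?thesis by simp
    qed
    also have "expectation (\<lambda>\<omega>. exp (s * u * ?W \<omega>)) / exp (u * x) \<le> exp (bvar * ((s*u)\<^sup>2 / 2 * (1 + \<bar>s * u\<bar>))) / exp (u * x)"
      using mgf_upper(2)[OF us] by (intro divide_right_mono) auto
    also have "\<dots> \<le> exp (V * ((s*u)\<^sup>2 / 2 * (1 + \<bar>s * u\<bar>))) / exp (u * x)"
      using V by (intro divide_right_mono) (auto intro!: mult_right_mono)
    also have "\<dots> = exp (- u * x + V * (u\<^sup>2 / 2 * (1 + u)))"
      using s u by (auto simp: exp_diff[symmetric])
    finally show ?thesis .
  qed
  have "prob {\<omega> \<in> space M. \<bar>?W \<omega>\<bar> \<ge> x} \<le> prob ({\<omega> \<in> space M. 1 * ?W \<omega> \<ge> x} \<union> {\<omega> \<in> space M. (-1) * ?W \<omega> \<ge> x})"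
    by (intro finite_measure_mono) (auto, measurable)
  also have "\<dots> \<le> prob {\<omega> \<in> space M. 1 * ?W \<omega> \<ge> x} + prob {\<omega> \<in> space M. (-1) * ?W \<omega> \<ge> x}"
    by (intro measure_Un_le) measurable
  also have "\<dots> \<le> exp (- u * x + V * (u\<^sup>2 / 2 * (1 + u))) + exp (- u * x + V * (u\<^sup>2 / 2 * (1 + u)))"
    by (intro add_mono *) auto
  finally show ?thesis by simp
qed

end

section \<open>Lower exponential bounds and Borel-Cantelli lemmas\<close>

text \<open>A converse to the Chernoff bound, read off from the transform of \<open>W\<close> at the
  three tilts \<open>u = x / V\<close> and \<open>u \<plusminus> \<eta> * u\<close> without changing
  the measure. The tilts beside \<open>u\<close> gain only the fraction
  \<open>\<eta>\<^sup>2\<close> of the exponent \<open>x\<^sup>2 / (2 * V)\<close>, so the transform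
  must be Gaussian up to a smaller relative error, here \<open>\<eta>\<^sup>2 / 10\<close>.\<close>

lemma (in prob_space) mgf_tail_lower:
  fixes W :: "'a \<Rightarrow> real"
  assumes [measurable]: "W \<in> borel_measurable M"
    and V: "V > 0" and x: "x > 0" and \<eta>: "0 < \<eta>" "\<eta> < 1" and small: "(1 + \<eta>) * (x / V) \<le> u0"
    and int: "\<And>u. \<bar>u\<bar> \<le> u0 \<Longrightarrow> integrable M (\<lambda>\<omega>. exp (u * W \<omega>))"
    and up: "\<And>u. \<bar>u\<bar> \<le> u0 \<Longrightarrow> expectation (\<lambda>\<omega>. exp (u * W \<omega>)) \<le> exp (V * (u\<^sup>2 / 2 * (1 + \<eta>\<^sup>2 / 10)))"
    and lo: "\<And>u. \<bar>u\<bar> \<le> u0 \<Longrightarrow> exp (V * (u\<^sup>2 / 2 * (1 - \<eta>\<^sup>2 / 10))) \<le> expectation (\<lambda>\<omega>. exp (u * W \<omega>))"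
    and large: "x\<^sup>2 / V \<ge> 4 * ln 4 / \<eta>\<^sup>2"
  shows "prob {\<omega> \<in> space M. W \<omega> \<ge> (1 - \<eta>) * x} \<ge> 1 / 2 * exp (- (x\<^sup>2 / V) * (1 / 2 + 2 * \<eta>))"
proof -
  define u where "u = x / V"
  define R where "R = x\<^sup>2 / V"
  define h where "h = \<eta> * u"
  define \<gamma> where "\<gamma> = \<eta>\<^sup>2 / 10"
  define x1 where "x1 = (1 - \<eta>) * x"
  define x2 where "x2 = (1 + \<eta>) * x"
  define P where "P = prob {\<omega> \<in> space M. W \<omega> \<ge> x1}"
  have u: "u > 0" using V x by (simp add: u_def)
  have h: "h > 0" using u \<eta> by (simp add: h_def)
  have u0: "u + h \<le> u0" using small unfolding h_def u_def by (simp only: distrib_right mult_1)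
  have VR: "V * u\<^sup>2 = R" "u * x = R" using V by (simp_all add: u_def R_def power2_eq_square)
  have "h \<le> u" using u \<eta> by (simp add: h_def mult_left_le_one_le)
  then have us: "\<bar>u\<bar> \<le> u0" "\<bar>u + h\<bar> \<le> u0" "\<bar>u - h\<bar> \<le> u0" using u h u0 by linarith+
  have iu: "integrable M (\<lambda>\<omega>. exp (u * W \<omega>))"
    and iup: "integrable M (\<lambda>\<omega>. exp ((u + h) * W \<omega>))"
    and ium: "integrable M (\<lambda>\<omega>. exp ((u - h) * W \<omega>))"
    by (intro int us)+
  \<comment> \<open>Exponential weights at \<open>u \<plusminus> h\<close> dominate the weight at \<open>u\<close> outside \<open>[x1, x2]\<close>; since the weight
    at \<open>u\<close> concentrates near \<open>x = V u\<close>, the outside contributes less than half of the total.\<close>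
  have pt: "exp (u * W \<omega>) \<le> exp (u * x2) * indicator {\<omega> \<in> space M. W \<omega> \<ge> x1} \<omega>
      + exp (- h * x2) * exp ((u + h) * W \<omega>) + exp (h * x1) * exp ((u - h) * W \<omega>)" if "\<omega> \<in> space M" for \<omega>
  proof -
    have nn: "0 \<le> exp (u * x2) * (indicator {\<omega> \<in> space M. W \<omega> \<ge> x1} \<omega> :: real)"
      "0 \<le> exp (- h * x2) * exp ((u + h) * W \<omega>)" "0 \<le> exp (h * x1) * exp ((u - h) * W \<omega>)" by auto
    consider "W \<omega> > x2" | "W \<omega> < x1" | "x1 \<le> W \<omega>" "W \<omega> \<le> x2" by linarith
    then show ?thesis
    proof cases
      case 1
      then have "h * x2 \<le> h * W \<omega>" using h by (intro mult_left_mono) auto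
      then have "exp (u * W \<omega>) \<le> exp (- h * x2 + (u + h) * W \<omega>)" by (simp add: algebra_simps)
      then show ?thesis using nn by (simp only: exp_add)
    next
      case 2
      then have "h * W \<omega> \<le> h * x1" using h by (intro mult_left_mono) auto
      then have "exp (u * W \<omega>) \<le> exp (h * x1 + (u - h) * W \<omega>)" by (simp add: algebra_simps)
      then show ?thesis using nn by (simp only: exp_add)
    next
      case 3
      then have "exp (u * W \<omega>) \<le> exp (u * x2)" using u by (simp add: mult_left_mono)
      then show ?thesis using 3 that by (simp add: add_increasing2)
    qed
  qed
  have iind: "integrable M (\<lambda>\<omega>. exp (u * x2) * indicator {\<omega> \<in> space M. W \<omega> \<ge> x1} \<omega> :: real)"
    by (intro integrable_mult_right integrable_const_bound[where B=1]) (auto simp: indicator_def)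
  have "exp (R / 2 * (1 - \<gamma>)) = exp (V * (u\<^sup>2 / 2 * (1 - \<eta>\<^sup>2 / 10)))"
    by (simp add: VR(1)[symmetric] \<gamma>_def)
  also have "\<dots> \<le> expectation (\<lambda>\<omega>. exp (u * W \<omega>))" using u h u0 by (intro lo) auto
  also have "\<dots> \<le> expectation (\<lambda>\<omega>. exp (u * x2) * indicator {\<omega> \<in> space M. W \<omega> \<ge> x1} \<omega>
      + exp (- h * x2) * exp ((u + h) * W \<omega>) + exp (h * x1) * exp ((u - h) * W \<omega>))"
    using iu iind iup ium pt by (intro integral_mono Bochner_Integration.integrable_add integrable_mult_right) auto
  also have "\<dots> = exp (u * x2) * P + exp (- h * x2) * expectation (\<lambda>\<omega>. exp ((u + h) * W \<omega>))
      + exp (h * x1) * expectation (\<lambda>\<omega>. exp ((u - h) * W \<omega>))"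
    unfolding P_def using iind iup ium
    by (subst Bochner_Integration.integral_add, (auto)[2], subst Bochner_Integration.integral_add) auto
  also have "\<dots> \<le> exp (u * x2) * P + exp (- h * x2) * exp (V * ((u + h)\<^sup>2 / 2 * (1 + \<eta>\<^sup>2 / 10)))
      + exp (h * x1) * exp (V * ((u - h)\<^sup>2 / 2 * (1 + \<eta>\<^sup>2 / 10)))"
    by (intro add_mono mult_left_mono up order_refl us) auto
  also have "exp (- h * x2) * exp (V * ((u + h)\<^sup>2 / 2 * (1 + \<eta>\<^sup>2 / 10))) = exp (R / 2 * ((1 + \<eta>)\<^sup>2 * (1 + \<gamma>) - 2 * \<eta> * (1 + \<eta>)))"
  proof -
    have "- h * x2 + V * ((u + h)\<^sup>2 / 2 * (1 + \<eta>\<^sup>2 / 10)) = - \<eta> * (1 + \<eta>) * (u * x) + (V * u\<^sup>2) * ((1 + \<eta>)\<^sup>2 / 2 * (1 + \<gamma>))"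
      by (simp add: h_def x2_def \<gamma>_def power2_eq_square field_simps)
    also have "\<dots> = R / 2 * ((1 + \<eta>)\<^sup>2 * (1 + \<gamma>) - 2 * \<eta> * (1 + \<eta>))" unfolding VR by (simp add: field_simps)
    finally show ?thesis by (simp only: exp_add[symmetric])
  qed
  also have "exp (h * x1) * exp (V * ((u - h)\<^sup>2 / 2 * (1 + \<eta>\<^sup>2 / 10))) = exp (R / 2 * ((1 - \<eta>)\<^sup>2 * (1 + \<gamma>) + 2 * \<eta> * (1 - \<eta>)))"
  proof -
    have "h * x1 + V * ((u - h)\<^sup>2 / 2 * (1 + \<eta>\<^sup>2 / 10)) = \<eta> * (1 - \<eta>) * (u * x) + (V * u\<^sup>2) * ((1 - \<eta>)\<^sup>2 / 2 * (1 + \<gamma>))"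
      by (simp add: h_def x1_def \<gamma>_def power2_eq_square field_simps)
    also have "\<dots> = R / 2 * ((1 - \<eta>)\<^sup>2 * (1 + \<gamma>) + 2 * \<eta> * (1 - \<eta>))" unfolding VR by (simp add: field_simps)
    finally show ?thesis by (simp only: exp_add[symmetric])
  qed
  finally have main: "exp (R / 2 * (1 - \<gamma>)) \<le> exp (u * x2) * P + exp (R / 2 * ((1 + \<eta>)\<^sup>2 * (1 + \<gamma>) - 2 * \<eta> * (1 + \<eta>)))
      + exp (R / 2 * ((1 - \<eta>)\<^sup>2 * (1 + \<gamma>) + 2 * \<eta> * (1 - \<eta>)))" .
  have R0: "R > 0" using x V by (simp add: R_def)
  have g0: "\<gamma> \<ge> 0" by (simp add: \<gamma>_def)
  have e2: "\<eta>\<^sup>2 \<le> 1" using \<eta> by (simp add: power_le_one)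
  \<comment> \<open>\<open>large\<close> says \<open>R * \<eta>\<^sup>2 \<ge> 4 * ln 4\<close>. A
    deficit of \<open>\<eta>\<^sup>2 / 2\<close> then costs a factor 4, so the two outer pieces
    together take at most half of the total.\<close>
  have quarter: "exp (R / 2 * E) \<le> exp (R / 2 * (1 - \<gamma>)) / 4" if "E \<le> 1 - \<gamma> - \<eta>\<^sup>2 / 2" for E
  proof -
    have "R * \<eta>\<^sup>2 \<ge> 4 * ln 4" using large \<eta> by (simp add: R_def field_simps)
    have "R / 2 * E \<le> R / 2 * (1 - \<gamma> - \<eta>\<^sup>2 / 2)" using that R0 by (intro mult_left_mono) auto
    also have "\<dots> = R / 2 * (1 - \<gamma>) - R * \<eta>\<^sup>2 / 4" by (simp add: field_simps)
    also have "\<dots> \<le> R / 2 * (1 - \<gamma>) - ln 4" using \<open>R * \<eta>\<^sup>2 \<ge> 4 * ln 4\<close> by simp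
    finally have "exp (R / 2 * E) \<le> exp (R / 2 * (1 - \<gamma>) - ln 4)" by (simp only: exp_le_cancel_iff)
    also have "\<dots> = exp (R / 2 * (1 - \<gamma>)) / 4" by (simp add: exp_diff)
    finally show ?thesis .
  qed
  \<comment> \<open>At most five units of \<gamma> are lost through the error in the transform,
    since \<open>(1 + \<eta>)\<^sup>2 + 1 \<le> 5\<close>. This is half of the gain
    \<open>\<eta>\<^sup>2\<close> and leaves the deficit required by \<open>quarter\<close>.\<close>
  have g5: "\<gamma> * 5 = \<eta>\<^sup>2 / 2" by (simp add: \<gamma>_def)
  have "(1 + \<eta>)\<^sup>2 \<le> 2\<^sup>2" using \<eta> by (intro power_mono) auto
  then have "\<gamma> * ((1 + \<eta>)\<^sup>2 + 1) \<le> \<gamma> * 5" using g0 by (intro mult_left_mono) auto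
  then have "exp (R / 2 * ((1 + \<eta>)\<^sup>2 * (1 + \<gamma>) - 2 * \<eta> * (1 + \<eta>))) \<le> exp (R / 2 * (1 - \<gamma>)) / 4"
    using g5 by (intro quarter) (simp add: power2_eq_square algebra_simps)
  moreover have "(1 - \<eta>)\<^sup>2 \<le> 1\<^sup>2" using \<eta> by (intro power_mono) auto
  then have "\<gamma> * ((1 - \<eta>)\<^sup>2 + 1) \<le> \<gamma> * 5" using g0 by (intro mult_left_mono) auto
  then have "exp (R / 2 * ((1 - \<eta>)\<^sup>2 * (1 + \<gamma>) + 2 * \<eta> * (1 - \<eta>))) \<le> exp (R / 2 * (1 - \<gamma>)) / 4"
    using g5 by (intro quarter) (simp add: power2_eq_square algebra_simps)
  ultimately have "exp (R / 2 * (1 - \<gamma>)) / 2 \<le> exp (u * x2) * P" using main by linarith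
  then have "P \<ge> exp (R / 2 * (1 - \<gamma>)) / 2 / exp (u * x2)" by (simp add: field_simps)
  also have "exp (R / 2 * (1 - \<gamma>)) / 2 / exp (u * x2) = 1 / 2 * exp (R / 2 * (1 - \<gamma>) - (1 + \<eta>) * R)"
    by (simp add: exp_diff x2_def VR(2)[symmetric] mult_ac)
  finally have "P \<ge> 1 / 2 * exp (R / 2 * (1 - \<gamma>) - (1 + \<eta>) * R)" .
  moreover have "\<gamma> \<le> 2 * \<eta>"
  proof -
    have "\<eta>\<^sup>2 \<le> \<eta>" using \<eta> by (simp add: power2_eq_square mult_left_le)
    then show ?thesis using \<eta> by (simp add: \<gamma>_def)
  qed
  then have "R * \<gamma> \<le> R * (2 * \<eta>)" using R0 by (intro mult_left_mono) auto
  then have "- R * (1 / 2 + 2 * \<eta>) \<le> R / 2 * (1 - \<gamma>) - (1 + \<eta>) * R" by (simp add: algebra_simps)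
  then have "exp (- R * (1 / 2 + 2 * \<eta>)) \<le> exp (R / 2 * (1 - \<gamma>) - (1 + \<eta>) * R)" by (simp only: exp_le_cancel_iff)
  ultimately show ?thesis unfolding P_def R_def x1_def by linarith
qed

text \<open>Pairwise independence is assumed because the scheme is analysed through the joint law of
  the box counts at two times. The variance of the number of occurrences is at most its mean
  \<open>s K\<close>, so Chebyshev's inequality bounds the probability of no occurrence after
  \<open>N\<close> by \<open>1 / s K\<close>, which a divergent series makes arbitrarily
  small.\<close>

lemma (in prob_space) pairwise_borel_cantelli:
  assumes ev [measurable]: "\<And>n. A n \<in> events"
    and pair: "\<And>m n. m < n \<Longrightarrow> prob (A m \<inter> A n) = prob (A m) * prob (A n)"
    and div: "\<not> summable (\<lambda>n. prob (A n))"
  shows "AE \<omega> in M. frequently (\<lambda>n. \<omega> \<in> A n) sequentially"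
proof -
  have pair': "prob (A m \<inter> A n) = prob (A m) * prob (A n)" if "m \<noteq> n" for m n
    using that pair[of m n] pair[of n m] by (cases m n rule: linorder_cases) (auto simp: Int_commute mult.commute)
  have "AE \<omega> in M. \<exists>n\<ge>N. \<omega> \<in> A n" for N
  proof -
    define none where "none = {\<omega> \<in> space M. \<forall>n\<ge>N. \<omega> \<notin> A n}"
    have [measurable]: "none \<in> events" unfolding none_def by measurable
    have bound: "prob none * s K \<le> 1" if s: "s = (\<lambda>K. \<Sum>n\<in>{N..<K}. prob (A n))" "s K > 0" for s K
    proof -
      define Z where "Z \<omega> = (\<Sum>n\<in>{N..<K}. indicator (A n) \<omega> :: real)" for \<omega>
      have [measurable]: "Z \<in> borel_measurable M" unfolding Z_def[abs_def] by measurable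
      have int1: "integrable M Z" unfolding Z_def[abs_def]
        by (intro Bochner_Integration.integrable_sum integrable_const_bound[where B=1]) (auto simp: indicator_def)
      have EZ: "expectation Z = s K" unfolding Z_def[abs_def] s(1)
        by (subst Bochner_Integration.integral_sum) (auto intro!: integrable_const_bound[where B=1] simp: indicator_def)
      have ind: "(\<integral>\<omega>. indicator (A m) \<omega> * indicator (A n) \<omega> \<partial>M) = (if m = n then prob (A m) else prob (A m) * prob (A n))" for m n
        using pair'[of m n] by (auto simp: indicator_inter_arith[symmetric])
      have intp: "integrable M (\<lambda>\<omega>. indicator (A m) \<omega> * indicator (A n) \<omega> :: real)" for m n
        by (intro integrable_const_bound[where B=1]) (auto simp: indicator_def)
      have Z2: "Z \<omega> ^ 2 = (\<Sum>m\<in>{N..<K}. \<Sum>n\<in>{N..<K}. indicator (A m) \<omega> * indicator (A n) \<omega>)" for \<omega>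
        by (simp add: Z_def power2_eq_square sum_product)
      have int2: "integrable M (\<lambda>\<omega>. Z \<omega> ^ 2)"
        unfolding Z2 by (intro Bochner_Integration.integrable_sum intp)
      have EZ2: "expectation (\<lambda>\<omega>. Z \<omega> ^ 2) \<le> (s K)\<^sup>2 + s K"
      proof -
        have "expectation (\<lambda>\<omega>. Z \<omega> ^ 2) = (\<Sum>m\<in>{N..<K}. \<Sum>n\<in>{N..<K}. if m = n then prob (A m) else prob (A m) * prob (A n))"
          unfolding Z2 ind[symmetric] by (simp only: Bochner_Integration.integral_sum intp Bochner_Integration.integrable_sum)
        also have "\<dots> \<le> (\<Sum>m\<in>{N..<K}. \<Sum>n\<in>{N..<K}. prob (A m) * prob (A n) + (if m = n then prob (A m) else 0))"
          by (intro sum_mono) auto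
        also have "\<dots> = (s K)\<^sup>2 + s K" by (simp add: sum.distrib s(1) power2_eq_square sum_product)
        finally show ?thesis .
      qed
      have var: "variance Z \<le> s K" by (subst variance_eq[OF int1 int2]) (use EZ2 EZ in auto)
      have "prob none \<le> prob {\<omega> \<in> space M. \<bar>Z \<omega> - expectation Z\<bar> \<ge> s K}"
      proof (intro finite_measure_mono subsetI)
        fix \<omega> assume \<omega>: "\<omega> \<in> none"
        then have "Z \<omega> = 0" unfolding Z_def by (intro sum.neutral) (auto simp: none_def)
        then show "\<omega> \<in> {\<omega> \<in> space M. \<bar>Z \<omega> - expectation Z\<bar> \<ge> s K}" using \<omega> s(2) by (auto simp: EZ none_def)
      qed measurable
      also have "\<dots> \<le> variance Z / (s K)\<^sup>2" using s(2) by (intro Chebyshev_inequality int2) auto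
      also have "\<dots> \<le> s K / (s K)\<^sup>2" using var by (intro divide_right_mono) auto
      finally show ?thesis using s(2) by (simp add: power2_eq_square field_simps)
    qed
    have "prob none = 0"
    proof (rule ccontr)
      assume "prob none \<noteq> 0"
      then have pos: "prob none > 0" by (simp add: zero_less_measure_iff)
      define s where "s = (\<lambda>K. \<Sum>n\<in>{N..<K}. prob (A n))"
      have s_le: "s K \<le> 1 / prob none" for K
      proof (cases "s K > 0")
        case True then show ?thesis using bound[OF s_def] pos by (simp add: field_simps)
      next
        case False then show ?thesis using pos by (simp add: order_trans[of _ 0])
      qed
      have "(\<Sum>i<n. prob (A (i + N))) \<le> 1 / prob none" for n
        using s_le[of "n + N"] unfolding s_def by (simp add: sum.shift_bounds_nat_ivl[of _ 0 N n, simplified] lessThan_atLeast0)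
      then have "summable (\<lambda>i. prob (A (i + N)))"
        by (intro bounded_imp_summable[where B="1 / prob none"]) (simp_all only: lessThan_Suc_atMost[symmetric] measure_nonneg)
      then show False using div summable_iff_shift[of "\<lambda>n. prob (A n)" N] by simp
    qed
    then have "AE \<omega> in M. \<omega> \<notin> none" by (intro AE_I'[of none]) (auto simp: null_sets_def emeasure_eq_measure)
    then show ?thesis by (rule AE_mp) (auto simp: none_def)
  qed
  then have "AE \<omega> in M. \<forall>N. \<exists>n\<ge>N. \<omega> \<in> A n" by (simp add: AE_all_countable)
  then show ?thesis by eventually_elim (auto simp: frequently_sequentially)
qed

text \<open>Some of the predicates used below quantify over all times in an interval, so their
  failure sets need not be measurable; it is enough to cover them by events with summable
  probabilities.\<close>

lemma (in prob_space) borel_cantelli_choice: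
  fixes Q :: "nat \<Rightarrow> 'a \<Rightarrow> bool"
  assumes "eventually (\<lambda>n. \<exists>Bad\<in>events. prob Bad \<le> b n \<and> (\<forall>\<omega>\<in>space M - Bad. Q n \<omega>)) sequentially" and "summable b"
  shows "AE \<omega> in M. eventually (\<lambda>n. Q n \<omega>) sequentially"
proof -
  obtain N where "\<And>n. n \<ge> N \<Longrightarrow> \<exists>Bad\<in>events. prob Bad \<le> b n \<and> (\<forall>\<omega>\<in>space M - Bad. Q n \<omega>)"
    using assms(1) by (auto simp: eventually_sequentially)
  then obtain Bad where Bad: "\<And>n. n \<ge> N \<Longrightarrow> Bad n \<in> events" "\<And>n. n \<ge> N \<Longrightarrow> prob (Bad n) \<le> b n"
    "\<And>n \<omega>. n \<ge> N \<Longrightarrow> \<omega> \<in> space M - Bad n \<Longrightarrow> Q n \<omega>" by metis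
  define B where "B n = (if n \<ge> N then Bad n else {})" for n
  have [measurable]: "B n \<in> events" for n using Bad(1) by (simp add: B_def)
  have "summable (\<lambda>n. prob (B n))"
    by (rule summable_comparison_test'[OF assms(2), of N]) (auto simp: B_def Bad(2))
  then have "AE \<omega> in M. eventually (\<lambda>n. \<omega> \<in> space M - B n) sequentially"
    by (intro borel_cantelli_AE1) (auto simp: emeasure_eq_measure)
  then show ?thesis
  proof eventually_elim
    case (elim \<omega>)
    then show ?case using eventually_ge_at_top[of N]
      by eventually_elim (auto intro!: Bad(3) simp: B_def)
  qed
qed

section \<open>Poisson splitting\<close>

text \<open>Preimages of single values, together with the empty set, are closed under intersection,
  and for a countable type they generate the preimages of all sets. Independence therefore follows
  from the product formula for atoms.\<close>

lemma (in prob_space) indep_vars_discreteI: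
  fixes Z :: "'i \<Rightarrow> 'a \<Rightarrow> 'b :: countable"
  assumes rv [measurable]: "\<And>i. i \<in> I \<Longrightarrow> Z i \<in> measurable M (count_space UNIV)"
    and atoms: "\<And>J z. J \<subseteq> I \<Longrightarrow> finite J \<Longrightarrow> J \<noteq> {} \<Longrightarrow>
      prob {\<omega> \<in> space M. \<forall>i\<in>J. Z i \<omega> = z i} = (\<Prod>i\<in>J. prob {\<omega> \<in> space M. Z i \<omega> = z i})"
  shows "indep_vars (\<lambda>_. count_space UNIV) Z I"
proof -
  define F where "F i = insert {} (range (\<lambda>z. Z i -` {z} \<inter> space M))" for i
  have Fev: "F i \<subseteq> events" if "i \<in> I" for i
    using rv[OF that] by (auto simp: F_def)
  have indF: "indep_sets F I"
  proof (rule indep_setsI)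
    show "F i \<subseteq> events" if "i \<in> I" for i by (rule Fev[OF that])
    fix A J assume J: "J \<noteq> {}" "J \<subseteq> I" "finite J" and A: "\<forall>j\<in>J. A j \<in> F j"
    show "prob (\<Inter>j\<in>J. A j) = (\<Prod>j\<in>J. prob (A j))"
    proof (cases "\<exists>j\<in>J. A j = {}")
      case True
      then obtain j where j: "j \<in> J" "A j = {}" by auto
      then have "(\<Inter>j\<in>J. A j) = {}" by auto
      moreover have "(\<Prod>j\<in>J. prob (A j)) = 0" using j J by (intro prod_zero bexI[of _ j]) auto
      ultimately show ?thesis by simp
    next
      case False
      then have "\<forall>j\<in>J. \<exists>z. A j = Z j -` {z} \<inter> space M" using A by (fastforce simp: F_def)
      then obtain z where z: "\<And>j. j \<in> J \<Longrightarrow> A j = Z j -` {z j} \<inter> space M" by metis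
      have "(\<Inter>j\<in>J. A j) = {\<omega> \<in> space M. \<forall>i\<in>J. Z i \<omega> = z i}" using z J by auto
      moreover have "A j = {\<omega> \<in> space M. Z j \<omega> = z j}" if "j \<in> J" for j using z[OF that] by auto
      ultimately show ?thesis using atoms[OF J(2,3,1)] by simp
    qed
  qed
  have "indep_sets (\<lambda>i. sigma_sets (space M) (F i)) I"
    by (rule indep_sets_sigma[OF indF]) (auto simp: F_def Int_stable_def)
  then have "indep_sets (\<lambda>i. {Z i -` A \<inter> space M |A. A \<in> sets (count_space UNIV)}) I"
  proof (rule indep_sets_mono_sets)
    fix i assume "i \<in> I"
    show "{Z i -` A \<inter> space M |A. A \<in> sets (count_space UNIV)} \<subseteq> sigma_sets (space M) (F i)"
    proof safe
      fix A :: "'b set"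
      have sa: "sigma_algebra (space M) (sigma_sets (space M) (F i))"
        by (rule sigma_algebra_sigma_sets) (auto simp: F_def)
      have "(\<Union>z\<in>A. Z i -` {z} \<inter> space M) \<in> sigma_sets (space M) (F i)"
        by (rule sigma_algebra.countable_UN''[OF sa]) (auto simp: F_def)
      also have "(\<Union>z\<in>A. Z i -` {z} \<inter> space M) = Z i -` A \<inter> space M" by auto
      finally show "Z i -` A \<inter> space M \<in> sigma_sets (space M) (F i)" .
    qed
  qed
  then show ?thesis unfolding indep_vars_def2 using rv by auto
qed

lemma (in prob_space) prob_sums_discrete:
  fixes Z :: "'a \<Rightarrow> nat"
  assumes [measurable]: "Z \<in> measurable M (count_space UNIV)" "{\<omega> \<in> space M. P \<omega>} \<in> events"
  shows "(\<lambda>m. prob {\<omega> \<in> space M. P \<omega> \<and> Z \<omega> = m}) sums prob {\<omega> \<in> space M. P \<omega>}"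
proof -
  have "(\<lambda>m. prob {\<omega> \<in> space M. P \<omega> \<and> Z \<omega> = m}) sums prob (\<Union>m. {\<omega> \<in> space M. P \<omega> \<and> Z \<omega> = m})"
    by (intro finite_measure_UNION) (auto simp: disjoint_family_on_def)
  also have "(\<Union>m. {\<omega> \<in> space M. P \<omega> \<and> Z \<omega> = m}) = {\<omega> \<in> space M. P \<omega>}" by auto
  finally show ?thesis .
qed

text \<open>The probability that \<open>m\<close> balls put \<open>a k\<close> of them into each box
  \<open>k\<close> of \<open>F\<close>, with all other boxes merged into one of mass
  \<open>1 - sum p F\<close>.\<close>

definition multinomial_prob :: "'i set \<Rightarrow> ('i \<Rightarrow> real) \<Rightarrow> nat \<Rightarrow> ('i \<Rightarrow> nat) \<Rightarrow> real" where
  "multinomial_prob F p m a =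
    (if sum a F \<le> m then fact m / fact (m - sum a F) * (\<Prod>k\<in>F. p k ^ a k / fact (a k)) * (1 - sum p F) ^ (m - sum a F) else 0)"

text \<open>This is conditioning on the box of the last ball. Algebraically, with
  \<open>s = sum a F\<close>, all terms share one factor with weights \<open>Suc m - s\<close> and
  \<open>a k\<close>, which sum to \<open>Suc m\<close>.\<close>

lemma multinomial_prob_Suc:
  assumes F: "finite F"
  shows "multinomial_prob F p (Suc m) a = (1 - sum p F) * multinomial_prob F p m a +
    (\<Sum>k\<in>F. if a k = 0 then 0 else p k * multinomial_prob F p m (a(k := a k - 1)))"
proof -
  define s where "s = sum a F"
  define P where "P = (\<Prod>k\<in>F. p k ^ a k / fact (a k))"
  define q where "q = 1 - sum p F"
  have step: "(if a k = 0 then 0 else p k * multinomial_prob F p m (a(k := a k - 1))) =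
      (if s \<le> Suc m then real (a k) * (fact m / fact (Suc m - s) * P * q ^ (Suc m - s)) else 0)" if k: "k \<in> F" for k
  proof (cases "a k")
    case (Suc b)
    have su: "sum (a(k := b)) F = s - 1"
      using k F Suc by (simp add: s_def sum.remove[where x=k])
    have s1: "s \<ge> 1" using k F Suc by (simp add: s_def sum.remove[where x=k])
    have pr: "p k * (\<Prod>i\<in>F. p i ^ (a(k := b)) i / fact ((a(k := b)) i)) = real (a k) * P"
    proof -
      define Q where "Q = (\<Prod>i\<in>F - {k}. p i ^ a i / fact (a i))"
      have "(\<Prod>i\<in>F. p i ^ (a(k := b)) i / fact ((a(k := b)) i)) = p k ^ b / fact b * Q"
        unfolding Q_def using k F by (simp add: prod.remove[where x=k])
      moreover have "P = p k ^ Suc b / fact (Suc b) * Q"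
        unfolding Q_def using k F Suc by (simp add: P_def prod.remove[where x=k])
      ultimately show ?thesis using Suc by (simp only: fact_Suc) (simp add: field_simps del: of_nat_Suc fun_upd_apply)
    qed
    have "p k * multinomial_prob F p m (a(k := b)) = (if s \<le> Suc m then fact m / fact (m - (s - 1)) *
       (p k * (\<Prod>i\<in>F. p i ^ (a(k := b)) i / fact ((a(k := b)) i))) * q ^ (m - (s - 1)) else 0)"
      using s1 unfolding multinomial_prob_def su q_def by auto
    also have "m - (s - 1) = Suc m - s" using s1 by auto
    finally show ?thesis using Suc unfolding pr by (simp add: mult_ac fun_upd_def)
  qed simp
  have "(1 - sum p F) * multinomial_prob F p m a = (if s \<le> Suc m then real (Suc m - s) * (fact m / fact (Suc m - s) * P * q ^ (Suc m - s)) else 0)"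
  proof (cases "s \<le> m")
    case True
    then have "Suc m - s = Suc (m - s)" by auto
    then show ?thesis using True unfolding multinomial_prob_def s_def[symmetric] P_def[symmetric] q_def[symmetric]
      by (simp add: field_simps del: of_nat_Suc of_nat_diff)
  next
    case False
    then show ?thesis unfolding multinomial_prob_def s_def[symmetric] by auto
  qed
  moreover have "(\<Sum>k\<in>F. if a k = 0 then 0 else p k * multinomial_prob F p m (a(k := a k - 1))) =
     (if s \<le> Suc m then real s * (fact m / fact (Suc m - s) * P * q ^ (Suc m - s)) else 0)"
  proof -
    define Q where "Q = fact m / fact (Suc m - s) * P * q ^ (Suc m - s)"
    have "(\<Sum>k\<in>F. if a k = 0 then 0 else p k * multinomial_prob F p m (a(k := a k - 1))) =
        (\<Sum>k\<in>F. if s \<le> Suc m then real (a k) * Q else 0)"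
      unfolding Q_def by (rule sum.cong[OF refl step])
    also have "\<dots> = (if s \<le> Suc m then real s * Q else 0)"
      by (simp add: s_def sum_distrib_right)
    finally show ?thesis by (simp add: Q_def)
  qed
  moreover have "multinomial_prob F p (Suc m) a = (if s \<le> Suc m then real (Suc m) * (fact m / fact (Suc m - s) * P * q ^ (Suc m - s)) else 0)"
    unfolding multinomial_prob_def s_def[symmetric] P_def[symmetric] q_def[symmetric] by simp
  moreover have "real (Suc m) = real (Suc m - s) + real s" if "s \<le> Suc m" using that by simp
  ultimately show ?thesis by (simp only: distrib_right[symmetric] split: if_splits) auto
qed

text \<open>Mixing the multinomial law over a Poisson number of balls decouples the boxes. After a
  shift by \<open>s = sum a F\<close> the series is the exponential series of \<open>q * t\<close>,
  and \<open>exp (- t) * exp (q * t)\<close> is the product of the factors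
  \<open>exp (- (p k * t))\<close>.\<close>

lemma multinomial_poisson_sums:
  assumes F: "finite F"
  shows "(\<lambda>m. exp (-t) * t ^ m / fact m * multinomial_prob F p m a) sums
    (\<Prod>k\<in>F. exp (- (p k * t)) * (p k * t) ^ a k / fact (a k))"
proof -
  define s where "s = sum a F"
  define P where "P = (\<Prod>k\<in>F. p k ^ a k / fact (a k))"
  define q where "q = 1 - sum p F"
  have "(\<lambda>i. (exp (-t) * t ^ s * P) * ((q * t) ^ i /\<^sub>R fact i)) sums ((exp (-t) * t ^ s * P) * exp (q * t))"
    by (intro sums_mult exp_converges)
  also have "(\<lambda>i. (exp (-t) * t ^ s * P) * ((q * t) ^ i /\<^sub>R fact i)) =
     (\<lambda>i. exp (-t) * t ^ (i + s) / fact (i + s) * multinomial_prob F p (i + s) a)"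
    unfolding multinomial_prob_def s_def[symmetric] P_def[symmetric] q_def[symmetric]
    by (simp add: fun_eq_iff power_add power_mult_distrib field_simps)
  also have "(exp (-t) * t ^ s * P) * exp (q * t) = (\<Prod>k\<in>F. exp (- (p k * t)) * (p k * t) ^ a k / fact (a k))"
  proof -
    have "(\<Prod>k\<in>F. exp (- (p k * t)) * (p k * t) ^ a k / fact (a k)) =
       (\<Prod>k\<in>F. exp (- (p k * t))) * (\<Prod>k\<in>F. t ^ a k) * P"
      unfolding P_def prod.distrib[symmetric] by (intro prod.cong) (auto simp: power_mult_distrib)
    also have "(\<Prod>k\<in>F. exp (- (p k * t))) = exp (-t) * exp (q * t)"
      using F by (simp add: exp_sum[symmetric] exp_add[symmetric] q_def sum_negf sum_distrib_right sum_distrib_left algebra_simps)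
    also have "(\<Prod>k\<in>F. t ^ a k) = t ^ s" by (simp add: s_def power_sum)
    finally show ?thesis by (simp add: mult_ac)
  qed
  finally show ?thesis
    by (subst (asm) sums_iff_shift) (simp add: multinomial_prob_def s_def[symmetric])
qed

lemma poisson_sums: "(\<lambda>d. exp (- x) * x ^ d / fact d) sums (1::real)"
proof -
  have "(\<lambda>d. exp (-x) * (x ^ d /\<^sub>R fact d)) sums (exp (-x) * exp x)" by (intro sums_mult exp_converges)
  then show ?thesis by (simp add: exp_minus field_simps)
qed

section \<open>Joint law of the box counts at two times\<close>

context poissonized_karlin_scheme
begin

lemma S_measurable [measurable]: "S n \<in> borel_measurable M"
proof -
  have "(\<lambda>\<omega> n. S n \<omega>) \<in> measurable M (\<Pi>\<^sub>M n\<in>UNIV. borel)" using indep_var_rv1[OF S_X_indep] .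
  from measurable_compose[OF this measurable_component_singleton[of n]] show ?thesis by simp
qed

lemma X_measurable [measurable]: "X n \<in> measurable M (count_space UNIV)"
  using X_indep by (auto simp: indep_vars_def)

definition arrivals :: "real \<Rightarrow> 'a \<Rightarrow> nat" where
  "arrivals t \<omega> = card {n. S n \<omega> \<le> t}"

text \<open>Counts over a fixed set of balls involve only \<open>X\<close>; the box counts reduce to
  such counts once the numbers of arrivals are fixed.\<close>

definition cnt :: "nat set \<Rightarrow> nat \<Rightarrow> 'a \<Rightarrow> nat" where
  "cnt A k \<omega> = card {n \<in> A. X n \<omega> = k}"

lemma arrivals_measurable [measurable]: "arrivals t \<in> measurable M (count_space UNIV)"
  unfolding arrivals_def[abs_def] by measurable

lemma cnt_measurable [measurable]: "cnt A k \<in> measurable M (count_space UNIV)"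
  unfolding cnt_def[abs_def] by measurable

lemma box_count_measurable [measurable]: "box_count S X k t \<in> measurable M (count_space UNIV)"
  unfolding box_count_def[abs_def] by measurable

text \<open>Arrival times are strictly increasing, so the balls present at time \<open>t\<close>
  form an initial segment of the numbering.\<close>

lemma AE_box_count:
  "AE \<omega> in M. \<forall>t. finite {n. S n \<omega> \<le> t} \<and> {n. S n \<omega> \<le> t} = {..<arrivals t \<omega>}"
  using S_arrivals
proof eventually_elim
  case (elim \<omega>)
  show ?case
  proof
    fix t
    have fin: "finite {n. S n \<omega> \<le> t}" using elim by auto
    have down: "m \<in> {n. S n \<omega> \<le> t}" if "n \<in> {n. S n \<omega> \<le> t}" "m \<le> n" for m n
      using elim that by (auto dest: strict_mono_mono[THEN monoD] intro: order_trans)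
    have "\<exists>N. {n. S n \<omega> \<le> t} = {..<N}"
    proof (cases "{n. S n \<omega> \<le> t} = {}")
      case False
      have "{n. S n \<omega> \<le> t} = {..Max {n. S n \<omega> \<le> t}}"
      proof (intro equalityI subsetI)
        fix n assume "n \<in> {..Max {n. S n \<omega> \<le> t}}"
        then show "n \<in> {n. S n \<omega> \<le> t}" using down[OF Max_in[OF fin False]] by blast
      next
        fix n assume "n \<in> {n. S n \<omega> \<le> t}"
        then show "n \<in> {..Max {n. S n \<omega> \<le> t}}" using Max_ge[OF fin] by blast
      qed
      then show ?thesis by (intro exI[of _ "Suc (Max {n. S n \<omega> \<le> t})"]) (simp only: lessThan_Suc_atMost)
    qed auto
    then obtain N where N: "{n. S n \<omega> \<le> t} = {..<N}" ..
    then have "arrivals t \<omega> = N" by (simp add: arrivals_def)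
    then show "finite {n. S n \<omega> \<le> t} \<and> {n. S n \<omega> \<le> t} = {..<arrivals t \<omega>}"
      using N fin by simp
  qed
qed

lemma cnt_indep:
  assumes "A \<inter> B = {}"
  shows "prob {\<omega> \<in> space M. (\<forall>k\<in>F. cnt A k \<omega> = a k) \<and> (\<forall>k\<in>F. cnt B k \<omega> = b k)} =
    prob {\<omega> \<in> space M. \<forall>k\<in>F. cnt A k \<omega> = a k} * prob {\<omega> \<in> space M. \<forall>k\<in>F. cnt B k \<omega> = b k}"
proof -
  let ?C = "\<lambda>A a. {f \<in> space (PiM A (\<lambda>_. count_space UNIV)). \<forall>k\<in>F. card {n \<in> A. f n = k} = a k}"
  have m: "?C A a \<in> sets (PiM A (\<lambda>_. count_space UNIV :: nat measure))" for A :: "nat set" and a :: "nat \<Rightarrow> nat"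
  proof -
    have "{f \<in> space (PiM A (\<lambda>_. count_space UNIV :: nat measure)). i \<in> {n \<in> A. f n = k}} \<in> sets (PiM A (\<lambda>_. count_space UNIV))" for i k
      by (cases "i \<in> A") auto
    then have [measurable]: "(\<lambda>f. card {n \<in> A. f n = k}) \<in> measurable (PiM A (\<lambda>_. count_space UNIV :: nat measure)) (count_space UNIV)" for k
      by (intro measurable_card)
    show ?thesis by measurable
  qed
  have iv: "indep_var (PiM A (\<lambda>_. count_space UNIV)) (\<lambda>\<omega>. restrict (\<lambda>i. X i \<omega>) A) (PiM B (\<lambda>_. count_space UNIV)) (\<lambda>\<omega>. restrict (\<lambda>i. X i \<omega>) B)"
    by (rule indep_var_restrict[OF X_indep assms]) auto
  have r: "(\<lambda>\<omega>. restrict (\<lambda>i. X i \<omega>) A) -` ?C A a \<inter> space M = {\<omega> \<in> space M. \<forall>k\<in>F. cnt A k \<omega> = a k}" for A :: "nat set" and a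
    by (auto simp: cnt_def space_PiM cong: conj_cong)
  have "(\<lambda>\<omega>. (restrict (\<lambda>i. X i \<omega>) A, restrict (\<lambda>i. X i \<omega>) B)) -` (?C A a \<times> ?C B b) \<inter> space M =
      {\<omega> \<in> space M. (\<forall>k\<in>F. cnt A k \<omega> = a k) \<and> (\<forall>k\<in>F. cnt B k \<omega> = b k)}"
    using r[of A a] r[of B b] by blast
  then show ?thesis using indep_varD[OF iv m m, of a b] unfolding r by simp
qed

lemma prob_X_notin:
  assumes "finite F"
  shows "prob {\<omega> \<in> space M. X n \<omega> \<notin> F} = 1 - sum p F"
proof -
  have "prob {\<omega> \<in> space M. X n \<omega> \<in> F} = prob (\<Union>k\<in>F. {\<omega> \<in> space M. X n \<omega> = k})"
    by (intro arg_cong[where f=prob]) auto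
  also have "\<dots> = (\<Sum>k\<in>F. prob {\<omega> \<in> space M. X n \<omega> = k})"
    by (intro finite_measure_finite_Union assms) (auto simp: disjoint_family_on_def)
  finally have "prob {\<omega> \<in> space M. X n \<omega> \<in> F} = sum p F" by (simp add: X_law)
  then show ?thesis using prob_neg[of "\<lambda>\<omega>. X n \<omega> \<in> F"] by simp
qed

lemma cnt_singleton: "cnt {n} k \<omega> = (if X n \<omega> = k then 1 else 0)"
proof -
  have "{i \<in> {n}. X i \<omega> = k} = (if X n \<omega> = k then {n} else {})" by auto
  then show ?thesis by (simp add: cnt_def)
qed

lemma prob_cnt:
  assumes F: "finite F"
  shows "prob {\<omega> \<in> space M. \<forall>k\<in>F. cnt {m..<m + r} k \<omega> = a k} = multinomial_prob F p r a"
proof (induction r arbitrary: a)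
  case 0
  show ?case
  proof (cases "\<forall>k\<in>F. a k = 0")
    case True
    then show ?thesis using F by (simp add: cnt_def multinomial_prob_def prob_space)
  next
    case False
    then have "{\<omega> \<in> space M. \<forall>k\<in>F. cnt {m..<m + 0} k \<omega> = a k} = {}" by (auto simp: cnt_def)
    then have "prob {\<omega> \<in> space M. \<forall>k\<in>F. cnt {m..<m + 0} k \<omega> = a k} = 0" by (simp only: measure_empty)
    moreover have "sum a F > 0" using False F by (metis not_gr_zero sum_eq_0_iff)
    ultimately show ?thesis by (simp only:) (simp add: multinomial_prob_def)
  qed
next
  case (Suc r)
  let ?I = "{m..<m + r}" and ?x = "m + r"
  have split: "cnt {m..<m + Suc r} k \<omega> = cnt ?I k \<omega> + cnt {?x} k \<omega>" for k \<omega>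
  proof -
    have "{n \<in> {m..<m + Suc r}. X n \<omega> = k} = {n \<in> ?I. X n \<omega> = k} \<union> {n \<in> {?x}. X n \<omega> = k}" by auto
    then show ?thesis unfolding cnt_def by (simp only:) (rule card_Un_disjoint, auto)
  qed
  \<comment> \<open>\<open>e c\<close> is the occupancy produced by the last ball when it falls into
    \<open>c\<close>. The event \<open>E1 c\<close> is empty for \<open>a c = 0\<close>, in
    agreement with the vanishing term of \<open>multinomial_prob_Suc\<close>; truncated subtraction
    would give a wrong count there.\<close>
  define e where "e c k = (if k = c then 1 else 0 :: nat)" for c k :: nat
  define E0 where "E0 = {\<omega> \<in> space M. (\<forall>k\<in>F. cnt ?I k \<omega> = a k) \<and> (\<forall>k\<in>F. cnt {?x} k \<omega> = 0)}"
  define E1 where "E1 c = (if a c = 0 then {} else {\<omega> \<in> space M. (\<forall>k\<in>F. cnt ?I k \<omega> = (a(c := a c - 1)) k) \<and> (\<forall>k\<in>F. cnt {?x} k \<omega> = e c k)})" for c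
  have "{\<omega> \<in> space M. (\<forall>k\<in>F. cnt ?I k \<omega> = f k) \<and> (\<forall>k\<in>F. cnt {?x} k \<omega> = g k)} \<in> events" for f g
    using F by measurable
  then have [measurable]: "E0 \<in> events" "E1 c \<in> events" for c by (simp_all only: E0_def E1_def sets.empty_sets split: if_splits) auto
  have "{\<omega> \<in> space M. \<forall>k\<in>F. cnt {m..<m + Suc r} k \<omega> = a k} = E0 \<union> (\<Union>c\<in>F. E1 c)"
  proof (intro set_eqI)
    fix \<omega>
    have "(\<forall>k\<in>F. cnt {m..<m + Suc r} k \<omega> = a k) \<longleftrightarrow> (\<forall>k\<in>F. cnt ?I k \<omega> = a k) \<and> (\<forall>k\<in>F. cnt {?x} k \<omega> = 0)" if "X ?x \<omega> \<notin> F"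
      unfolding split using that by (auto simp: cnt_singleton)
    moreover have "(\<forall>k\<in>F. cnt {m..<m + Suc r} k \<omega> = a k) \<longleftrightarrow> a (X ?x \<omega>) \<noteq> 0 \<and> (\<forall>k\<in>F. cnt ?I k \<omega> = (a(X ?x \<omega> := a (X ?x \<omega>) - 1)) k)" if "X ?x \<omega> \<in> F"
      unfolding split using that by (auto simp: cnt_singleton)
    moreover have "(\<forall>k\<in>F. cnt {?x} k \<omega> = 0) \<longleftrightarrow> X ?x \<omega> \<notin> F" by (auto simp: cnt_singleton)
    moreover have "(\<forall>k\<in>F. cnt {?x} k \<omega> = e c k) \<longleftrightarrow> X ?x \<omega> = c" if "c \<in> F" for c using that by (auto simp: cnt_singleton e_def)
    ultimately show "\<omega> \<in> {\<omega> \<in> space M. \<forall>k\<in>F. cnt {m..<m + Suc r} k \<omega> = a k} \<longleftrightarrow> \<omega> \<in> E0 \<union> (\<Union>c\<in>F. E1 c)"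
      unfolding E0_def E1_def by (cases "X ?x \<omega> \<in> F") auto
  qed
  also have "prob (E0 \<union> (\<Union>c\<in>F. E1 c)) = prob E0 + prob (\<Union>c\<in>F. E1 c)"
    using F by (intro finite_measure_Union) (auto simp: E0_def E1_def e_def split: if_splits)
  also have "prob (\<Union>c\<in>F. E1 c) = (\<Sum>c\<in>F. prob (E1 c))"
  proof (intro finite_measure_finite_Union F)
    have "X ?x \<omega> = c" if "\<omega> \<in> E1 c" "c \<in> F" for c \<omega>
    proof -
      have "cnt {?x} c \<omega> = e c c" using that unfolding E1_def by (metis (mono_tags, lifting) empty_iff mem_Collect_eq)
      then show ?thesis by (simp add: cnt_singleton e_def split: if_splits)
    qed
    then show "disjoint_family_on E1 F" unfolding disjoint_family_on_def by blast
  qed auto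
  also have "prob E0 = (1 - sum p F) * multinomial_prob F p r a"
  proof -
    have "{\<omega> \<in> space M. \<forall>k\<in>F. cnt {?x} k \<omega> = 0} = {\<omega> \<in> space M. X ?x \<omega> \<notin> F}" by (auto simp: cnt_singleton)
    then show ?thesis unfolding E0_def using cnt_indep[of ?I "{?x}" F a "\<lambda>_. 0"] Suc.IH[of a] prob_X_notin[OF F, of ?x] by simp
  qed
  also have "(\<Sum>c\<in>F. prob (E1 c)) = (\<Sum>k\<in>F. if a k = 0 then 0 else p k * multinomial_prob F p r (a(k := a k - 1)))"
  proof (intro sum.cong refl)
    fix c assume c: "c \<in> F"
    then have "{\<omega> \<in> space M. \<forall>k\<in>F. cnt {?x} k \<omega> = e c k} = {\<omega> \<in> space M. X ?x \<omega> = c}" by (auto simp: cnt_singleton e_def split: if_splits)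
    then show "prob (E1 c) = (if a c = 0 then 0 else p c * multinomial_prob F p r (a(c := a c - 1)))"
      unfolding E1_def using cnt_indep[of ?I "{?x}" F "a(c := a c - 1)" "e c"] Suc.IH[of "a(c := a c - 1)"] X_law[of ?x c] by (simp del: fun_upd_apply)
  qed
  finally show ?case unfolding multinomial_prob_Suc[OF F] .
qed

lemma AE_box_count_eq_cnt:
  "AE \<omega> in M. \<forall>s t k. s \<le> t \<longrightarrow> arrivals s \<omega> \<le> arrivals t \<omega> \<and>
     box_count S X k s \<omega> = cnt {0..<arrivals s \<omega>} k \<omega> \<and>
     box_count S X k t \<omega> = cnt {0..<arrivals s \<omega>} k \<omega> + cnt {arrivals s \<omega>..<arrivals t \<omega>} k \<omega>"
  using AE_box_count
proof eventually_elim
  case (elim \<omega>)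
  have eq: "{n. S n \<omega> \<le> t} = {..<arrivals t \<omega>}" for t using elim by auto
  have bc: "box_count S X k t \<omega> = cnt {0..<arrivals t \<omega>} k \<omega>" for k t
  proof -
    have "{n. S n \<omega> \<le> t \<and> X n \<omega> = k} = {n \<in> {0..<arrivals t \<omega>}. X n \<omega> = k}"
      using eq[of t] by auto
    then show ?thesis by (simp add: box_count_def cnt_def)
  qed
  show ?case
  proof (intro allI impI conjI)
    fix s t :: real and k assume st: "s \<le> t"
    have "{n. S n \<omega> \<le> s} \<subseteq> {n. S n \<omega> \<le> t}" using st by auto
    then show le: "arrivals s \<omega> \<le> arrivals t \<omega>" unfolding eq by simp
    show "box_count S X k s \<omega> = cnt {0..<arrivals s \<omega>} k \<omega>" by (rule bc)
    define A where "A = {n \<in> {0..<arrivals s \<omega>}. X n \<omega> = k}"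
    define B where "B = {n \<in> {arrivals s \<omega>..<arrivals t \<omega>}. X n \<omega> = k}"
    have "{n \<in> {0..<arrivals t \<omega>}. X n \<omega> = k} = A \<union> B" using le by (auto simp: A_def B_def)
    moreover have "A \<inter> B = {}" by (auto simp: A_def B_def)
    moreover have "finite A" "finite B" by (auto simp: A_def B_def)
    ultimately show "box_count S X k t \<omega> = cnt {0..<arrivals s \<omega>} k \<omega> + cnt {arrivals s \<omega>..<arrivals t \<omega>} k \<omega>"
      unfolding bc cnt_def A_def[symmetric] B_def[symmetric] by (simp only: card_Un_disjoint)
  qed
qed

lemma AE_box_count_mono:
  "AE \<omega> in M. \<forall>s t k. s \<le> t \<longrightarrow> box_count S X k s \<omega> \<le> box_count S X k t \<omega>"
  using AE_box_count_eq_cnt by eventually_elim fastforce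

lemma prob_arrivals:
  assumes st: "0 < s" "s < t"
  shows "prob {\<omega> \<in> space M. arrivals s \<omega> = m \<and> arrivals t \<omega> - arrivals s \<omega> = r} =
    (exp (- s) * s ^ m / fact m) * (exp (- (t - s)) * (t - s) ^ r / fact r)"
proof -
  have pp: "poisson_process M 1 arrivals" using S_poisson unfolding arrivals_def[abs_def] .
  \<comment> \<open>Independence of increments is stated along an infinite strictly increasing
    sequence of times. Only 0, \<open>s\<close> and \<open>t\<close> matter: index 2 gives
    \<open>t\<close>, and the later entries just continue the sequence.\<close>
  define u :: "nat \<Rightarrow> real" where "u i = (if i = 0 then 0 else if i = 1 then s else t + real i - 2)" for i
  have u: "u 0 = 0" "u (Suc 0) = s" "u (Suc (Suc 0)) = t" "u 1 = s" "u 2 = t" by (simp_all add: u_def)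
  have "strict_mono u" unfolding strict_mono_Suc_iff using st by (auto simp: u_def)
  then have iv: "indep_vars (\<lambda>_. count_space UNIV) (\<lambda>i \<omega>. arrivals (u (Suc i)) \<omega> - arrivals (u i) \<omega>) {..<2}"
    by (intro poisson_process.N_indep[OF pp]) (simp add: u)
  define Y where "Y i \<omega> = arrivals (u (Suc i)) \<omega> - arrivals (u i) \<omega>" for i \<omega>
  define z where "z i = (if i = 0 then m else r)" for i :: nat
  have law: "prob (Y i -` {k} \<inter> space M) = pmf (poisson_pmf (u (Suc i) - u i)) k" if "i < 2" for i k
  proof -
    have "u i < u (Suc i)" "u i \<ge> 0" using st that by (auto simp: u_def)
    then have d: "distr M (count_space UNIV) (Y i) = measure_pmf (poisson_pmf (1 * (u (Suc i) - u i)))"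
      using poisson_process.N_increment[OF pp, of "u i" "u (Suc i)"] unfolding Y_def[abs_def] by simp
    have "prob (Y i -` {k} \<inter> space M) = measure (distr M (count_space UNIV) (Y i)) {k}"
      unfolding Y_def[abs_def] by (subst measure_distr) auto
    then show ?thesis unfolding d by (simp add: measure_pmf_single)
  qed
  have "prob (\<Inter>i\<in>{..<2}. Y i -` {z i} \<inter> space M) = (\<Prod>i\<in>{..<2}. prob (Y i -` {z i} \<inter> space M))"
    using iv unfolding Y_def[abs_def] by (intro indep_varsD) (auto simp: lessThan_empty_iff)
  also have "\<dots> = pmf (poisson_pmf (u 1 - u 0)) m * pmf (poisson_pmf (u 2 - u 1)) r"
    using law[of 0 m] law[of 1 r] by (simp add: numeral_2_eq_2 z_def)
  also have "(\<Inter>i\<in>{..<2}. Y i -` {z i} \<inter> space M) = {\<omega> \<in> space M. arrivals s \<omega> - arrivals 0 \<omega> = m \<and> arrivals t \<omega> - arrivals s \<omega> = r}"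
    by (auto simp: Y_def z_def u numeral_2_eq_2 lessThan_Suc)
  also have "prob \<dots> = prob {\<omega> \<in> space M. arrivals s \<omega> = m \<and> arrivals t \<omega> - arrivals s \<omega> = r}"
    using poisson_process.N_paths[OF pp] by (intro finite_measure_eq_AE) (auto elim!: eventually_mono)
  finally show ?thesis using st by (simp add: u field_simps)
qed

lemma prob_arrivals_cnt:
  "prob {\<omega> \<in> space M. (arrivals s \<omega> = m \<and> arrivals t \<omega> - arrivals s \<omega> = r) \<and>
      ((\<forall>k\<in>F. cnt A k \<omega> = a k) \<and> (\<forall>k\<in>F. cnt B k \<omega> = b k))} =
   prob {\<omega> \<in> space M. arrivals s \<omega> = m \<and> arrivals t \<omega> - arrivals s \<omega> = r} *
   prob {\<omega> \<in> space M. (\<forall>k\<in>F. cnt A k \<omega> = a k) \<and> (\<forall>k\<in>F. cnt B k \<omega> = b k)}"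
proof -
  let ?PS = "\<Pi>\<^sub>M n\<in>(UNIV :: nat set). borel :: real measure" and ?PX = "\<Pi>\<^sub>M n\<in>(UNIV :: nat set). count_space UNIV :: real measure"
  \<comment> \<open>\<open>indep_var\<close> needs both variables in one type, so \<open>S_X_indep\<close> speaks about \<open>real (X n \<omega>)\<close>.\<close>
  let ?C = "{x \<in> space ?PX. (\<forall>k\<in>F. card {n \<in> A. x n = real k} = a k) \<and> (\<forall>k\<in>F. card {n \<in> B. x n = real k} = b k)}"
  let ?D = "{x \<in> space ?PS. card {n. x n \<le> s} = m \<and> card {n. x n \<le> t} - card {n. x n \<le> s} = r}"
  have C: "?C \<in> sets ?PX"
  proof -
    have [measurable]: "(\<lambda>x. card {n \<in> A. x n = real k}) \<in> measurable ?PX (count_space UNIV)" for k A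
      by (rule measurable_card) auto
    show ?thesis by measurable
  qed
  have D: "?D \<in> sets ?PS"
  proof -
    have [measurable]: "(\<lambda>x. card {n. x n \<le> t}) \<in> measurable ?PS (count_space UNIV)" for t
      by (rule measurable_card) auto
    show ?thesis by measurable
  qed
  have 1: "(\<lambda>\<omega> n. S n \<omega>) -` ?D \<inter> space M = {\<omega> \<in> space M. arrivals s \<omega> = m \<and> arrivals t \<omega> - arrivals s \<omega> = r}"
    by (auto simp: arrivals_def space_PiM)
  have 2: "(\<lambda>\<omega> n. real (X n \<omega>)) -` ?C \<inter> space M = {\<omega> \<in> space M. (\<forall>k\<in>F. cnt A k \<omega> = a k) \<and> (\<forall>k\<in>F. cnt B k \<omega> = b k)}"
    by (auto simp: cnt_def space_PiM)
  have "(\<lambda>\<omega>. ((\<lambda>n. S n \<omega>), (\<lambda>n. real (X n \<omega>)))) -` (?D \<times> ?C) \<inter> space M =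
     {\<omega> \<in> space M. (arrivals s \<omega> = m \<and> arrivals t \<omega> - arrivals s \<omega> = r) \<and>
      ((\<forall>k\<in>F. cnt A k \<omega> = a k) \<and> (\<forall>k\<in>F. cnt B k \<omega> = b k))}"
    using 1 2 by blast
  then show ?thesis using indep_varD[OF S_X_indep D C] unfolding 1 2 by simp
qed

text \<open>Given the numbers \<open>m\<close> and \<open>r\<close> of arrivals up to
  \<open>s\<close> and from \<open>s\<close> to \<open>t\<close>, the occupancies of the two groups
  of balls are independent multinomials. Hence each atom factorises into
  \<open>\<alpha> m * \<beta> r\<close>, and both series are summed by
  \<open>multinomial_poisson_sums\<close>.\<close>

lemma joint_law:
  assumes st: "0 < s" "s < t" and F: "finite F"
  shows "prob {\<omega> \<in> space M. \<forall>k\<in>F. box_count S X k s \<omega> = a k \<and> box_count S X k t \<omega> = a k + d k} =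
    (\<Prod>k\<in>F. (exp (- (p k * s)) * (p k * s) ^ a k / fact (a k)) * (exp (- (p k * (t - s))) * (p k * (t - s)) ^ d k / fact (d k)))"
proof -
  define P where "P \<omega> \<longleftrightarrow> (\<forall>k\<in>F. box_count S X k s \<omega> = a k \<and> box_count S X k t \<omega> = a k + d k)" for \<omega>
  have [measurable]: "Measurable.pred M P" unfolding P_def[abs_def] using F by measurable
  define \<alpha> where "\<alpha> m = exp (- s) * s ^ m / fact m * multinomial_prob F p m a" for m
  define \<beta> where "\<beta> r = exp (- (t - s)) * (t - s) ^ r / fact r * multinomial_prob F p r d" for r
  define A where "A = (\<Prod>k\<in>F. exp (- (p k * s)) * (p k * s) ^ a k / fact (a k))"
  define B where "B = (\<Prod>k\<in>F. exp (- (p k * (t - s))) * (p k * (t - s)) ^ d k / fact (d k))"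
  have atom: "prob {\<omega> \<in> space M. (P \<omega> \<and> arrivals s \<omega> = m) \<and> arrivals t \<omega> - arrivals s \<omega> = r} = \<alpha> m * \<beta> r" for m r
  proof -
    have "prob {\<omega> \<in> space M. (P \<omega> \<and> arrivals s \<omega> = m) \<and> arrivals t \<omega> - arrivals s \<omega> = r} =
      prob {\<omega> \<in> space M. (arrivals s \<omega> = m \<and> arrivals t \<omega> - arrivals s \<omega> = r) \<and>
      ((\<forall>k\<in>F. cnt {0..<0 + m} k \<omega> = a k) \<and> (\<forall>k\<in>F. cnt {m..<m + r} k \<omega> = d k))}"
    proof (rule finite_measure_eq_AE)
      show "AE x in M. (x \<in> {\<omega> \<in> space M. (P \<omega> \<and> arrivals s \<omega> = m) \<and> arrivals t \<omega> - arrivals s \<omega> = r}) =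
         (x \<in> {\<omega> \<in> space M. (arrivals s \<omega> = m \<and> arrivals t \<omega> - arrivals s \<omega> = r) \<and>
      ((\<forall>k\<in>F. cnt {0..<0 + m} k \<omega> = a k) \<and> (\<forall>k\<in>F. cnt {m..<m + r} k \<omega> = d k))})"
        using AE_box_count_eq_cnt
      proof eventually_elim
        case (elim \<omega>)
        then have le: "arrivals s \<omega> \<le> arrivals t \<omega>"
          and b: "\<And>k. box_count S X k s \<omega> = cnt {0..<arrivals s \<omega>} k \<omega>"
            "\<And>k. box_count S X k t \<omega> = cnt {0..<arrivals s \<omega>} k \<omega> + cnt {arrivals s \<omega>..<arrivals t \<omega>} k \<omega>"
          using st by (meson less_imp_le)+
        have "arrivals t \<omega> = m + r" if "arrivals s \<omega> = m" "arrivals t \<omega> - arrivals s \<omega> = r" using that le by auto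
        then show ?case by (auto simp: P_def b)
      qed
    qed (use F in measurable)
    also have "\<dots> = (exp (- s) * s ^ m / fact m) * (exp (- (t - s)) * (t - s) ^ r / fact r) * (multinomial_prob F p m a * multinomial_prob F p r d)"
      unfolding prob_arrivals_cnt prob_arrivals[OF st] by (subst cnt_indep) (auto simp only: prob_cnt[OF F], auto)
    finally show ?thesis by (simp add: \<alpha>_def \<beta>_def mult_ac)
  qed
  have "\<beta> sums B" unfolding \<beta>_def[abs_def] B_def by (rule multinomial_poisson_sums[OF F])
  then have sB: "(\<lambda>r. \<alpha> m * \<beta> r) sums (\<alpha> m * B)" for m by (rule sums_mult)
  have "\<alpha> sums A" unfolding \<alpha>_def[abs_def] A_def by (rule multinomial_poisson_sums[OF F])
  then have sA: "(\<lambda>m. \<alpha> m * B) sums (A * B)" by (rule sums_mult2)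
  have in1: "prob {\<omega> \<in> space M. P \<omega> \<and> arrivals s \<omega> = m} = \<alpha> m * B" for m
    using prob_sums_discrete[of "\<lambda>\<omega>. arrivals t \<omega> - arrivals s \<omega>" "\<lambda>\<omega>. P \<omega> \<and> arrivals s \<omega> = m"] sB[of m]
    unfolding atom by (auto intro: sums_unique2)
  have "prob {\<omega> \<in> space M. P \<omega>} = A * B"
    using prob_sums_discrete[of "arrivals s" P] sA unfolding in1 by (auto intro: sums_unique2)
  then show ?thesis unfolding P_def A_def B_def prod.distrib .
qed

text \<open>The marginal comes from the joint law with the auxiliary later time
  \<open>t + 1\<close>, by summing over the increment.\<close>

lemma box_count_law:
  assumes t: "0 < t"
  shows "prob {\<omega> \<in> space M. box_count S X k t \<omega> = b} = exp (- (p k * t)) * (p k * t) ^ b / fact b"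
proof -
  let ?x = "exp (- (p k * t)) * (p k * t) ^ b / fact b"
  let ?D = "\<lambda>\<omega>. box_count S X k (t + 1) \<omega> - box_count S X k t \<omega>"
  have "prob {\<omega> \<in> space M. box_count S X k t \<omega> = b \<and> ?D \<omega> = d} = ?x * (exp (- (p k)) * (p k) ^ d / fact d)" for d
  proof -
    have "prob {\<omega> \<in> space M. box_count S X k t \<omega> = b \<and> ?D \<omega> = d} =
       prob {\<omega> \<in> space M. \<forall>k\<in>{k}. box_count S X k t \<omega> = b \<and> box_count S X k (t + 1) \<omega> = b + d}"
    proof (rule finite_measure_eq_AE)
      show "AE \<omega> in M. (\<omega> \<in> {\<omega> \<in> space M. box_count S X k t \<omega> = b \<and> ?D \<omega> = d}) =
        (\<omega> \<in> {\<omega> \<in> space M. \<forall>k\<in>{k}. box_count S X k t \<omega> = b \<and> box_count S X k (t + 1) \<omega> = b + d})"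
        using AE_box_count_mono
      proof eventually_elim
        case (elim \<omega>)
        have "box_count S X k t \<omega> \<le> box_count S X k (t + 1) \<omega>" using elim[rule_format, of t "t + 1"] by simp
        then show ?case by auto
      qed
    qed measurable
    also have "\<dots> = ?x * (exp (- (p k)) * (p k) ^ d / fact d)"
      using joint_law[of t "t + 1" "{k}" "\<lambda>_. b" "\<lambda>_. d"] t by simp
    finally show ?thesis .
  qed
  then have "(\<lambda>d. ?x * (exp (- (p k)) * (p k) ^ d / fact d)) sums prob {\<omega> \<in> space M. box_count S X k t \<omega> = b}"
    using prob_sums_discrete[of ?D "\<lambda>\<omega>. box_count S X k t \<omega> = b"] by simp
  moreover have "(\<lambda>d. ?x * (exp (- (p k)) * (p k) ^ d / fact d)) sums (?x * 1)"
    by (intro sums_mult poisson_sums)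
  ultimately show ?thesis by (auto intro: sums_unique2)
qed

lemma box_counts_indep:
  assumes st: "0 < s" "s < t"
  shows "indep_vars (\<lambda>_. count_space UNIV) (\<lambda>k \<omega>. (box_count S X k s \<omega>, box_count S X k t \<omega>)) UNIV"
proof (rule indep_vars_discreteI)
  show "(\<lambda>\<omega>. (box_count S X k s \<omega>, box_count S X k t \<omega>)) \<in> measurable M (count_space UNIV)" for k
    by (subst pair_measure_countable[of "UNIV :: nat set" "UNIV :: nat set", simplified, symmetric]) measurable
  fix J :: "nat set" and z :: "nat \<Rightarrow> nat \<times> nat"
  assume J: "finite J" "J \<noteq> {}"
  let ?Z = "\<lambda>k \<omega>. (box_count S X k s \<omega>, box_count S X k t \<omega>)"
  show "prob {\<omega> \<in> space M. \<forall>i\<in>J. ?Z i \<omega> = z i} = (\<Prod>i\<in>J. prob {\<omega> \<in> space M. ?Z i \<omega> = z i})"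
  \<comment> \<open>\<open>joint_law\<close> covers only nondecreasing pairs. A decreasing pair has
    probability 0 because the counts are monotone, so both sides vanish.\<close>
  proof (cases "\<exists>k\<in>J. snd (z k) < fst (z k)")
    case True
    then obtain k where k: "k \<in> J" "snd (z k) < fst (z k)" by auto
    have "AE \<omega> in M. ?Z k \<omega> \<noteq> z k"
      using AE_box_count_mono
    proof eventually_elim
      case (elim \<omega>)
      have "box_count S X k s \<omega> \<le> box_count S X k t \<omega>" using elim[rule_format, of s t] st by simp
      then show ?case using k by (auto simp: prod_eq_iff)
    qed
    then have "prob {\<omega> \<in> space M. ?Z k \<omega> = z k} = 0"
      by (intro measure_eq_0_null_sets AE_iff_null_sets[THEN iffD2]) (auto elim!: eventually_mono simp: prod_eq_iff)
    moreover have "prob {\<omega> \<in> space M. \<forall>i\<in>J. ?Z i \<omega> = z i} \<le> prob {\<omega> \<in> space M. ?Z k \<omega> = z k}"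
      using k by (intro finite_measure_mono) (auto simp: prod_eq_iff)
    ultimately have "prob {\<omega> \<in> space M. \<forall>i\<in>J. ?Z i \<omega> = z i} = 0"
      using measure_nonneg[of M "{\<omega> \<in> space M. \<forall>i\<in>J. ?Z i \<omega> = z i}"] by linarith
    moreover have "(\<Prod>i\<in>J. prob {\<omega> \<in> space M. ?Z i \<omega> = z i}) = 0"
      using J k \<open>prob {\<omega> \<in> space M. ?Z k \<omega> = z k} = 0\<close> by (intro prod_zero bexI[of _ k])
    ultimately show ?thesis by simp
  next
    case False
    define a where "a k = fst (z k)" for k
    define d where "d k = snd (z k) - fst (z k)" for k
    have eq: "?Z k \<omega> = z k \<longleftrightarrow> box_count S X k s \<omega> = a k \<and> box_count S X k t \<omega> = a k + d k" if "k \<in> J" for k \<omega>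
    proof -
      have "a k + d k = snd (z k)" using False that by (auto simp: a_def d_def not_less)
      then show ?thesis by (auto simp: prod_eq_iff a_def)
    qed
    have "prob {\<omega> \<in> space M. \<forall>i\<in>J. ?Z i \<omega> = z i} = prob {\<omega> \<in> space M. \<forall>k\<in>J. box_count S X k s \<omega> = a k \<and> box_count S X k t \<omega> = a k + d k}"
      using eq by (intro arg_cong[where f=prob]) auto
    moreover {have "prob {\<omega> \<in> space M. ?Z k \<omega> = z k} = prob {\<omega> \<in> space M. \<forall>i\<in>{k}. box_count S X i s \<omega> = a i \<and> box_count S X i t \<omega> = a i + d i}" if "k \<in> J" for k
      using eq[OF that] by (intro arg_cong[where f=prob]) auto
    then have "prob {\<omega> \<in> space M. ?Z k \<omega> = z k} = (exp (- (p k * s)) * (p k * s) ^ a k / fact (a k)) *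
        (exp (- (p k * (t - s))) * (p k * (t - s)) ^ d k / fact (d k))" if "k \<in> J" for k
      using joint_law[OF st, of "{k}" a d] that by simp}
    ultimately show ?thesis using J by (simp only: joint_law[OF st]) (auto intro!: prod.cong)
  qed
qed

end

section \<open>Slow variation\<close>

text \<open>The additive form of Karamata's uniform convergence theorem. Along a hypothetical bad
  sequence the shifts with small change fill almost all of \<open>{0..2}\<close> in measure, both
  from \<open>x n\<close> and from \<open>x n + u n\<close>. Two such sets must share a target
  point, and this links the two base points.\<close>

lemma uniform_convergence_slow_variation:
  fixes h :: "real \<Rightarrow> real"
  assumes h [measurable]: "h \<in> borel_measurable borel"
    and lim: "\<And>u. ((\<lambda>x. h (x + u) - h x) \<longlongrightarrow> 0) at_top"
    and \<epsilon>: "\<epsilon> > 0"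
  shows "eventually (\<lambda>x. \<forall>u\<in>{0..1}. \<bar>h (x + u) - h x\<bar> \<le> \<epsilon>) at_top"
proof (rule ccontr)
  assume "\<not> ?thesis"
  then have "\<forall>n. \<exists>x u. x \<ge> real n \<and> u \<in> {0..1} \<and> \<bar>h (x + u) - h x\<bar> > \<epsilon>"
    unfolding eventually_at_top_linorder by (meson not_le)
  then obtain x u where x: "\<And>n. x n \<ge> real n" and u: "\<And>n. u n \<in> {0..1}"
    and big: "\<And>n. \<bar>h (x n + u n) - h (x n)\<bar> > \<epsilon>" by metis
  have xlim: "filterlim x at_top sequentially"
    by (rule filterlim_at_top_mono[OF filterlim_real_sequentially]) (use x in auto)
  have xulim: "filterlim (\<lambda>n. x n + u n) at_top sequentially"
    by (rule filterlim_at_top_mono[OF xlim]) (use u in auto)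
  define near where "near y n = {v \<in> {0..2::real}. \<forall>m\<ge>n. \<bar>h (y m + v) - h (y m)\<bar> < \<epsilon> / 2}" for y :: "nat \<Rightarrow> real" and n
  have near_meas [measurable]: "near y n \<in> sets borel" for y n unfolding near_def by measurable
  have near_lim: "(\<lambda>n. measure lborel (near y n)) \<longlonglongrightarrow> 2" if y: "filterlim y at_top sequentially" for y
  proof -
    have "(\<lambda>n. measure lborel (near y n)) \<longlonglongrightarrow> measure lborel (\<Union>n. near y n)"
    proof (rule Lim_measure_incseq)
      show "range (near y) \<subseteq> sets lborel" by auto
      show "incseq (near y)" by (auto simp: incseq_def near_def)
      have "(\<Union>n. near y n) \<subseteq> {0..2}" by (auto simp: near_def)
      then have "emeasure lborel (\<Union>n. near y n) \<le> emeasure lborel {0..2::real}" by (intro emeasure_mono) auto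
      also have "\<dots> < \<infinity>" by (simp add: emeasure_lborel_Icc_eq)
      finally show "emeasure lborel (\<Union>n. near y n) \<noteq> \<infinity>" by simp
    qed
    also have "(\<Union>n. near y n) = {0..2}"
    proof (intro equalityI subsetI)
      fix v :: real assume v: "v \<in> {0..2}"
      have "(\<lambda>m. h (y m + v) - h (y m)) \<longlonglongrightarrow> 0" using lim[of v] y by (rule filterlim_compose)
      then have "eventually (\<lambda>m. dist (h (y m + v) - h (y m)) 0 < \<epsilon> / 2) sequentially" using \<epsilon> by (intro tendstoD) auto
      then show "v \<in> (\<Union>n. near y n)" using v by (auto simp: near_def eventually_sequentially dist_real_def)
    qed (auto simp: near_def)
    also have "measure lborel {0..2::real} = 2" by simp
    finally show ?thesis .
  qed
  have "eventually (\<lambda>n. measure lborel (near x n) > 3 / 2) sequentially"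
    "eventually (\<lambda>n. measure lborel (near (\<lambda>n. x n + u n) n) > 3 / 2) sequentially"
    using order_tendstoD(1)[OF near_lim[OF xlim], of "3 / 2"] order_tendstoD(1)[OF near_lim[OF xulim], of "3 / 2"] by simp_all
  then have "eventually (\<lambda>n. measure lborel (near x n) > 3 / 2 \<and> measure lborel (near (\<lambda>n. x n + u n) n) > 3 / 2) sequentially"
    by eventually_elim auto
  then obtain n where n: "measure lborel (near x n) > 3 / 2" "measure lborel (near (\<lambda>n. x n + u n) n) > 3 / 2"
    using eventually_happens'[OF sequentially_bot] by blast
  \<comment> \<open>Translation by \<open>u n\<close> rewrites shifts from \<open>x n + u n\<close>
    as shifts from \<open>x n\<close>. Both sets lie in \<open>{0..3}\<close> and have measure above
    3/2, so they meet.\<close>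
  define V where "V = near (\<lambda>n. x n + u n) n"
  define W where "W = (\<lambda>v. v - u n) -` V"
  have [measurable]: "V \<in> sets borel" "W \<in> sets borel"
  proof -
    show V: "V \<in> sets borel" unfolding V_def by measurable
    have "(\<lambda>v. v - u n) -` V \<inter> space borel \<in> sets borel" using V by (rule measurable_sets[rotated]) measurable
    then show "W \<in> sets borel" by (simp add: W_def)
  qed
  have "measure lborel W = measure (distr lborel borel ((+) (u n))) W" by (simp add: lborel_distr_plus)
  also have "\<dots> = measure lborel ((+) (u n) -` W \<inter> space lborel)" by (intro measure_distr) auto
  also have "(+) (u n) -` W \<inter> space lborel = V" by (auto simp: W_def)
  finally have mW: "measure lborel W > 3 / 2" using n(2) by (simp add: V_def)
  have sub: "near x n \<subseteq> {0..3}" "W \<subseteq> {0..3}" using u[of n] by (auto simp: near_def W_def V_def)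
  have fin: "emeasure lborel A \<noteq> \<infinity>" if "A \<subseteq> {0..3}" for A :: "real set"
  proof -
    have "emeasure lborel A \<le> emeasure lborel {0..3::real}" using that by (intro emeasure_mono) auto
    also have "\<dots> < \<infinity>" by (simp add: emeasure_lborel_Icc_eq)
    finally show ?thesis by simp
  qed
  have "near x n \<inter> W \<noteq> {}"
  proof
    assume "near x n \<inter> W = {}"
    then have "measure lborel (near x n \<union> W) = measure lborel (near x n) + measure lborel W"
      using fin[OF sub(1)] fin[OF sub(2)] by (intro measure_Union) auto
    moreover have "measure lborel (near x n \<union> W) \<le> measure lborel {0..3::real}"
      using sub fin[of "{0..3}"] by (intro measure_mono_fmeasurable fmeasurableI) (auto simp: emeasure_lborel_Icc_eq)
    ultimately show False using n(1) mW by simp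
  qed
  then obtain v where v: "v \<in> near x n" "v - u n \<in> near (\<lambda>n. x n + u n) n" by (auto simp: W_def V_def)
  then have "\<bar>h (x n + v) - h (x n)\<bar> < \<epsilon> / 2" "\<bar>h (x n + u n + (v - u n)) - h (x n + u n)\<bar> < \<epsilon> / 2"
    by (auto simp: near_def)
  moreover have "x n + u n + (v - u n) = x n + v" by simp
  ultimately have "\<bar>h (x n + u n) - h (x n)\<bar> < \<epsilon>" by (smt (verit) field_sum_of_halves)
  then show False using big[of n] by simp
qed

text \<open>Uniform smallness over unit steps telescopes to a growth of at most \<epsilon> per unit
  of length.\<close>

lemma slow_variation_additive_sublinear:
  fixes h :: "real \<Rightarrow> real"
  assumes h: "h \<in> borel_measurable borel"
    and lim: "\<And>u. ((\<lambda>x. h (x + u) - h x) \<longlongrightarrow> 0) at_top"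
  shows "((\<lambda>x. h x / x) \<longlongrightarrow> 0) at_top"
proof (rule tendstoI)
  fix e :: real assume e: "e > 0"
  define \<epsilon> where "\<epsilon> = e / 4"
  have \<epsilon>: "\<epsilon> > 0" using e by (simp add: \<epsilon>_def)
  obtain X where X: "\<And>x u. x \<ge> X \<Longrightarrow> u \<in> {0..1} \<Longrightarrow> \<bar>h (x + u) - h x\<bar> \<le> \<epsilon>"
    using uniform_convergence_slow_variation[OF h lim \<epsilon>] unfolding eventually_at_top_linorder by blast
  have ind: "\<bar>h (X + real n) - h X\<bar> \<le> \<epsilon> * real n" for n
  proof (induction n)
    case (Suc n)
    have "\<bar>h (X + real n + 1) - h (X + real n)\<bar> \<le> \<epsilon>" by (rule X) auto
    then show ?case using Suc by (simp add: algebra_simps)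
  qed simp
  have bd: "\<bar>h x\<bar> \<le> \<bar>h X\<bar> + \<epsilon> * (x - X + 1)" if "x \<ge> X" for x
  proof -
    define n where "n = nat \<lfloor>x - X\<rfloor>"
    have n: "real n \<le> x - X" "x - X < real n + 1" using that by (auto simp: n_def)
    have "\<bar>h (X + real n + (x - X - real n)) - h (X + real n)\<bar> \<le> \<epsilon>" using n by (intro X) auto
    then have "\<bar>h x - h (X + real n)\<bar> \<le> \<epsilon>" by simp
    moreover have "\<epsilon> * real n \<le> \<epsilon> * (x - X)" using n \<epsilon> by (intro mult_left_mono) auto
    ultimately show ?thesis using ind[of n] by (simp add: algebra_simps)
  qed
  have "((\<lambda>x. (\<bar>h X\<bar> + \<epsilon> * (x - X + 1)) / x) \<longlongrightarrow> \<epsilon>) at_top" by real_asymp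
  then have "eventually (\<lambda>x. (\<bar>h X\<bar> + \<epsilon> * (x - X + 1)) / x < e) at_top"
    by (rule order_tendstoD(2)) (use e in \<open>simp add: \<epsilon>_def\<close>)
  then show "eventually (\<lambda>x. dist (h x / x) 0 < e) at_top"
    using eventually_ge_at_top[of X] eventually_gt_at_top[of 0]
  proof eventually_elim
    case (elim x)
    have "\<bar>h x\<bar> / x \<le> (\<bar>h X\<bar> + \<epsilon> * (x - X + 1)) / x" using bd[of x] elim by (intro divide_right_mono) auto
    then show ?case using elim by (simp add: dist_real_def)
  qed
qed

text \<open>Used with \<open>s = ln t\<close>: it makes the factor \<open>l (ln t)\<close> invisible
  on the scale \<open>ln (ln t)\<close>.\<close>

lemma slowly_varying_ln:
  assumes "slowly_varying l"
  shows "((\<lambda>s. ln (l s) / ln s) \<longlongrightarrow> 0) at_top" and "eventually (\<lambda>s. l s > 0) at_top"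
proof -
  obtain a where m: "l \<in> borel_measurable (restrict_space borel {a..})" and pos: "\<And>t. t \<ge> a \<Longrightarrow> l t > 0"
    and lim: "\<And>c. c > 0 \<Longrightarrow> ((\<lambda>t. l (c * t) / l t) \<longlongrightarrow> 1) at_top"
    using assms unfolding slowly_varying_def by auto
  show "eventually (\<lambda>s. l s > 0) at_top" using pos by (auto simp: eventually_at_top_linorder)
  \<comment> \<open>Measurability and positivity are known only from \<open>a\<close> on, so
    \<open>l\<close> is replaced by 1 before \<open>a\<close>.\<close>
  define l' where "l' t = (if t \<in> {a..} then l t else 1)" for t
  have [measurable]: "l' \<in> borel_measurable borel"
    unfolding l'_def[abs_def] using m by (subst measurable_restrict_space_iff[symmetric]) auto
  define h where "h x = ln (l' (exp x))" for x
  have hm: "h \<in> borel_measurable borel" unfolding h_def[abs_def] by measurable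
  have hl: "((\<lambda>x. h (x + u) - h x) \<longlongrightarrow> 0) at_top" for u
  proof -
    have "((\<lambda>x. ln (l (exp u * exp x) / l (exp x))) \<longlongrightarrow> ln 1) at_top"
      by (rule tendsto_ln, rule filterlim_compose[OF lim exp_at_top]) auto
    then have "((\<lambda>x. ln (l (exp u * exp x) / l (exp x))) \<longlongrightarrow> 0) at_top" by simp
    moreover have "eventually (\<lambda>x. exp x \<ge> a) at_top" "eventually (\<lambda>x. exp u * exp x \<ge> a) at_top"
      using eventually_compose_filterlim[OF eventually_ge_at_top[of a] exp_at_top]
        eventually_compose_filterlim[OF eventually_ge_at_top[of "a / exp u"] exp_at_top] by (auto simp: field_simps)
    then have "eventually (\<lambda>x. ln (l (exp u * exp x) / l (exp x)) = h (x + u) - h x) at_top"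
      by eventually_elim (auto simp: h_def l'_def exp_add mult.commute ln_div dest!: pos)
    ultimately show ?thesis by (rule Lim_transform_eventually)
  qed
  have "((\<lambda>s. h (ln s) / ln s) \<longlongrightarrow> 0) at_top"
    by (rule filterlim_compose[OF slow_variation_additive_sublinear[OF hm hl] ln_at_top])
  moreover have "eventually (\<lambda>s. h (ln s) / ln s = ln (l s) / ln s) at_top"
    using eventually_gt_at_top[of 0] eventually_ge_at_top[of a] by eventually_elim (auto simp: h_def l'_def)
  ultimately show "((\<lambda>s. ln (l s) / ln s) \<longlongrightarrow> 0) at_top" by (rule Lim_transform_eventually)
qed

text \<open>The source of the constant in case (i): \<open>ln (v t)\<close> splits into the
  convergent term \<open>ln (v t / g t)\<close>, the main term \<open>\<beta> * ln (ln t)\<close>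
  and the logarithm of the slowly varying factor, which is of smaller order.\<close>

lemma ln_ratio_power_log:
  fixes v L :: "real \<Rightarrow> real"
  assumes \<beta>: "\<beta> > 0" and l: "slowly_varying l" and L: "L \<sim>[at_top] (\<lambda>t. ln t powr \<beta> * l (ln t))"
    and v: "((\<lambda>t. v t / L t) \<longlongrightarrow> c) at_top" and c: "c > 0"
  shows "((\<lambda>t. ln (v t) / ln (ln t)) \<longlongrightarrow> \<beta>) at_top"
proof -
  define g where "g t = ln t powr \<beta> * l (ln t)" for t
  have lpos: "eventually (\<lambda>t. l (ln t) > 0) at_top"
    using eventually_compose_filterlim[OF slowly_varying_ln(2)[OF l] ln_at_top] .
  have gpos: "eventually (\<lambda>t. g t > 0) at_top"
    using lpos eventually_gt_at_top[of 1] by eventually_elim (auto simp: g_def)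
  have Lg: "((\<lambda>t. L t / g t) \<longlongrightarrow> 1) at_top"
    using L unfolding g_def[symmetric] asymp_equiv_def
    by (rule Lim_transform_eventually) (use gpos in \<open>auto elim!: eventually_mono\<close>)
  have "eventually (\<lambda>t. L t / g t > 0) at_top" using Lg by (intro order_tendstoD) auto
  then have Lpos: "eventually (\<lambda>t. L t > 0) at_top" using gpos by eventually_elim (auto simp: zero_less_divide_iff)
  have vL: "((\<lambda>t. v t / L t * (L t / g t)) \<longlongrightarrow> c * 1) at_top" by (intro tendsto_mult v Lg)
  have "eventually (\<lambda>t. v t / L t * (L t / g t) = v t / g t) at_top"
    using Lpos by eventually_elim simp
  then have vg: "((\<lambda>t. v t / g t) \<longlongrightarrow> c) at_top" using Lim_transform_eventually[OF vL] by simp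
  have vgpos: "eventually (\<lambda>t. v t / g t > 0) at_top" using vg c by (intro order_tendstoD) auto
  have lnln: "filterlim (\<lambda>t::real. ln (ln t)) at_top at_top" by real_asymp
  have "((\<lambda>t. ln (v t / g t) / ln (ln t)) \<longlongrightarrow> 0) at_top"
    by (rule tendsto_divide_0[OF tendsto_ln[OF vg]]) (use c lnln in \<open>auto simp: filterlim_at_top_imp_at_infinity\<close>)
  moreover have "((\<lambda>t. ln (l (ln t)) / ln (ln t)) \<longlongrightarrow> 0) at_top"
    by (rule filterlim_compose[OF slowly_varying_ln(1)[OF l] ln_at_top])
  ultimately have "((\<lambda>t. ln (v t / g t) / ln (ln t) + \<beta> + ln (l (ln t)) / ln (ln t)) \<longlongrightarrow> 0 + \<beta> + 0) at_top"
    by (intro tendsto_intros)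
  then have "((\<lambda>t. ln (v t / g t) / ln (ln t) + \<beta> + ln (l (ln t)) / ln (ln t)) \<longlongrightarrow> \<beta>) at_top" by simp
  moreover have "eventually (\<lambda>t. ln (v t / g t) / ln (ln t) + \<beta> + ln (l (ln t)) / ln (ln t) = ln (v t) / ln (ln t)) at_top"
    using vgpos gpos lpos eventually_gt_at_top[of "exp 1"]
  proof eventually_elim
    case (elim t)
    have t1: "ln t > 1" using elim by (metis exp_gt_zero less_trans ln_exp ln_less_cancel_iff)
    then have pos: "ln (ln t) > 0" by simp
    have "v t > 0" using elim by (auto simp: zero_less_divide_iff)
    then have "ln (v t) = ln (v t / g t) + ln (g t)" using elim by (simp add: ln_div)
    also have "ln (g t) = \<beta> * ln (ln t) + ln (l (ln t))" using elim t1 by (simp add: g_def ln_mult ln_powr)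
    finally show ?case using pos by (simp add: field_simps)
  qed
  ultimately show ?thesis by (rule Lim_transform_eventually)
qed

text \<open>The source of the constant in case (ii): one logarithm gives
  \<open>\<sigma> * ln t powr \<alpha>\<close>, so the second gives
  \<open>\<alpha> * ln (ln t)\<close>, while \<sigma> contributes only a constant.\<close>

lemma ln_ratio_exp_power:
  fixes v L :: "real \<Rightarrow> real"
  assumes \<sigma>: "\<sigma> > 0" and \<alpha>: "0 < \<alpha>" and L: "L \<sim>[at_top] (\<lambda>t. exp (\<sigma> * ln t powr \<alpha>))"
    and v: "((\<lambda>t. v t / L t) \<longlongrightarrow> c) at_top" and c: "c > 0"
  shows "((\<lambda>t. ln (v t) / (\<sigma> * ln t powr \<alpha>)) \<longlongrightarrow> 1) at_top"
    and "((\<lambda>t. ln (ln (v t)) / ln (ln t)) \<longlongrightarrow> \<alpha>) at_top"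
proof -
  define g where "g t = exp (\<sigma> * ln t powr \<alpha>)" for t
  have Lg: "((\<lambda>t. L t / g t) \<longlongrightarrow> 1) at_top"
    using L unfolding g_def[symmetric] asymp_equiv_def
    by (rule Lim_transform_eventually) (auto simp: g_def)
  have "eventually (\<lambda>t. L t / g t > 0) at_top" using Lg by (intro order_tendstoD) auto
  then have Lpos: "eventually (\<lambda>t. L t > 0) at_top" by eventually_elim (auto simp: zero_less_divide_iff g_def)
  have vL: "((\<lambda>t. v t / L t * (L t / g t)) \<longlongrightarrow> c * 1) at_top" by (intro tendsto_mult v Lg)
  have "eventually (\<lambda>t. v t / L t * (L t / g t) = v t / g t) at_top"
    using Lpos by eventually_elim simp
  then have vg: "((\<lambda>t. v t / g t) \<longlongrightarrow> c) at_top" using Lim_transform_eventually[OF vL] by simp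
  have vgpos: "eventually (\<lambda>t. v t / g t > 0) at_top" using vg c by (intro order_tendstoD) auto
  have lnln: "filterlim (\<lambda>t::real. ln (ln t)) at_top at_top" by real_asymp
  have stop: "filterlim (\<lambda>t. \<sigma> * ln t powr \<alpha>) at_top at_top" using \<sigma> \<alpha> by real_asymp
  have "((\<lambda>t. ln (v t / g t) / (\<sigma> * ln t powr \<alpha>)) \<longlongrightarrow> 0) at_top"
    by (rule tendsto_divide_0[OF tendsto_ln[OF vg]]) (use c stop in \<open>auto simp: filterlim_at_top_imp_at_infinity\<close>)
  then have "((\<lambda>t. ln (v t / g t) / (\<sigma> * ln t powr \<alpha>) + 1) \<longlongrightarrow> 0 + 1) at_top"
    by (intro tendsto_intros)
  then have "((\<lambda>t. ln (v t / g t) / (\<sigma> * ln t powr \<alpha>) + 1) \<longlongrightarrow> 1) at_top" by simp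
  moreover have "eventually (\<lambda>t. ln (v t / g t) / (\<sigma> * ln t powr \<alpha>) + 1 = ln (v t) / (\<sigma> * ln t powr \<alpha>)) at_top"
    using vgpos eventually_gt_at_top[of 1]
  proof eventually_elim
    case (elim t)
    have "v t > 0" using elim by (auto simp: zero_less_divide_iff g_def)
    then have "ln (v t) = ln (v t / g t) + \<sigma> * ln t powr \<alpha>" by (simp add: ln_div g_def)
    then show ?case using elim \<sigma> by (simp add: field_simps)
  qed
  ultimately show 1: "((\<lambda>t. ln (v t) / (\<sigma> * ln t powr \<alpha>)) \<longlongrightarrow> 1) at_top" by (rule Lim_transform_eventually)
  have "((\<lambda>t. ln (ln (v t) / (\<sigma> * ln t powr \<alpha>)) / ln (ln t)) \<longlongrightarrow> 0) at_top"
    by (rule tendsto_divide_0[OF tendsto_ln[OF 1]]) (use lnln in \<open>auto simp: filterlim_at_top_imp_at_infinity\<close>)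
  moreover have "((\<lambda>t::real. ln \<sigma> / ln (ln t)) \<longlongrightarrow> 0) at_top"
    by (rule tendsto_divide_0[OF tendsto_const]) (use lnln in \<open>auto simp: filterlim_at_top_imp_at_infinity\<close>)
  ultimately have "((\<lambda>t. ln (ln (v t) / (\<sigma> * ln t powr \<alpha>)) / ln (ln t) + ln \<sigma> / ln (ln t) + \<alpha>) \<longlongrightarrow> 0 + 0 + \<alpha>) at_top"
    by (intro tendsto_intros)
  then have "((\<lambda>t. ln (ln (v t) / (\<sigma> * ln t powr \<alpha>)) / ln (ln t) + ln \<sigma> / ln (ln t) + \<alpha>) \<longlongrightarrow> \<alpha>) at_top" by simp
  moreover have "eventually (\<lambda>t. ln (v t) / (\<sigma> * ln t powr \<alpha>) > 0) at_top" using 1 by (intro order_tendstoD) auto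
  then have "eventually (\<lambda>t. ln (ln (v t) / (\<sigma> * ln t powr \<alpha>)) / ln (ln t) + ln \<sigma> / ln (ln t) + \<alpha> = ln (ln (v t)) / ln (ln t)) at_top"
    using eventually_gt_at_top[of "exp 1"]
  proof eventually_elim
    case (elim t)
    have t1: "ln t > 1" using elim by (metis exp_gt_zero less_trans ln_exp ln_less_cancel_iff)
    then have pos: "ln (ln t) > 0" by simp
    have s: "\<sigma> * ln t powr \<alpha> > 0" using \<sigma> t1 by simp
    have "ln (v t) > 0" using elim s by (auto simp: zero_less_divide_iff)
    then have "ln (ln (v t)) = ln (ln (v t) / (\<sigma> * ln t powr \<alpha>)) + ln (\<sigma> * ln t powr \<alpha>)"
      using s by (subst ln_div) auto
    also have "ln (\<sigma> * ln t powr \<alpha>) = ln \<sigma> + \<alpha> * ln (ln t)" using \<sigma> t1 by (simp add: ln_mult ln_powr)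
    finally show ?case using pos by (simp add: field_simps)
  qed
  ultimately show "((\<lambda>t. ln (ln (v t)) / ln (ln t)) \<longlongrightarrow> \<alpha>) at_top" by (rule Lim_transform_eventually)
qed

text \<open>Halving the exponent leaves room for the slowly varying factor. The bound provides
  \<open>L_lower\<close> with \<open>\<kappa> = \<beta> / 2\<close>.\<close>

lemma power_log_lower:
  fixes L :: "real \<Rightarrow> real"
  assumes "\<beta> > 0" "slowly_varying l" "L \<sim>[at_top] (\<lambda>t. ln t powr \<beta> * l (ln t))" "eventually (\<lambda>t. L t > 0) at_top"
  shows "eventually (\<lambda>t. L t \<ge> ln t powr (\<beta> / 2)) at_top"
proof -
  have "((\<lambda>t. L t / L t) \<longlongrightarrow> 1) at_top"
    by (rule Lim_transform_eventually[OF tendsto_const]) (use assms(4) in \<open>auto elim!: eventually_mono\<close>)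
  from ln_ratio_power_log[OF assms(1-3) this] have "((\<lambda>t. ln (L t) / ln (ln t)) \<longlongrightarrow> \<beta>) at_top" by simp
  then have "eventually (\<lambda>t. ln (L t) / ln (ln t) > \<beta> / 2) at_top" using assms(1) by (intro order_tendstoD) auto
  then show ?thesis using assms(4) eventually_gt_at_top[of "exp 1"]
  proof eventually_elim
    case (elim t)
    have t1: "ln t > 1" using elim by (metis exp_gt_zero less_trans ln_exp ln_less_cancel_iff)
    then have "\<beta> / 2 * ln (ln t) \<le> ln (L t)" using elim by (simp add: field_simps)
    then have "exp (\<beta> / 2 * ln (ln t)) \<le> exp (ln (L t))" by (simp only: exp_le_cancel_iff)
    then show ?case using t1 elim by (simp add: powr_def)
  qed
qed

text \<open>A stretched exponential of \<open>ln t\<close> exceeds every power of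
  \<open>ln t\<close>; the power 1 is enough for \<open>L_lower\<close>.\<close>

lemma exp_power_lower:
  fixes L :: "real \<Rightarrow> real"
  assumes "\<sigma> > 0" "0 < \<alpha>" "L \<sim>[at_top] (\<lambda>t. exp (\<sigma> * ln t powr \<alpha>))" "eventually (\<lambda>t. L t > 0) at_top"
  shows "eventually (\<lambda>t. L t \<ge> ln t powr 1) at_top"
proof -
  have "((\<lambda>t. L t / L t) \<longlongrightarrow> 1) at_top"
    by (rule Lim_transform_eventually[OF tendsto_const]) (use assms(4) in \<open>auto elim!: eventually_mono\<close>)
  from ln_ratio_exp_power(1)[OF assms(1-3) this] have "((\<lambda>t. ln (L t) / (\<sigma> * ln t powr \<alpha>)) \<longlongrightarrow> 1) at_top" by simp
  then have "eventually (\<lambda>t. ln (L t) / (\<sigma> * ln t powr \<alpha>) > 1 / 2) at_top" by (intro order_tendstoD) auto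
  moreover have "eventually (\<lambda>t. ln (ln t) \<le> 1 / 2 * (\<sigma> * ln t powr \<alpha>)) at_top" using assms(1,2) by real_asymp
  ultimately show ?thesis using assms(4) eventually_gt_at_top[of "exp 1"]
  proof eventually_elim
    case (elim t)
    have t1: "ln t > 1" using elim by (metis exp_gt_zero less_trans ln_exp ln_less_cancel_iff)
    then have "\<sigma> * ln t powr \<alpha> > 0" using assms(1) by simp
    then have "1 / 2 * (\<sigma> * ln t powr \<alpha>) \<le> ln (L t)" using elim by (simp add: field_simps)
    then have "ln (ln t) \<le> ln (L t)" using elim by linarith
    then have "exp (ln (ln t)) \<le> exp (ln (L t))" by (simp only: exp_le_cancel_iff)
    then show ?case using t1 elim by simp
  qed
qed

section \<open>Asymptotics of the mean\<close>

text \<open>Poisson point probabilities as a function of the mean, the variable in which they are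
  differentiated and integrated below.\<close>

definition pois :: "nat \<Rightarrow> real \<Rightarrow> real" where
  "pois j x = exp (- x) * x ^ j / fact j"

lemma pois_nonneg: "x \<ge> 0 \<Longrightarrow> pois j x \<ge> 0"
  by (simp add: pois_def)

lemma pois_zero: "pois j 0 = (if j = 0 then 1 else 0)"
  by (simp add: pois_def)

lemma pois_le_1:
  assumes "x \<ge> 0"
  shows "pois j x \<le> 1"
proof -
  have "x ^ j / fact j = (\<Sum>n\<in>{j}. x ^ n /\<^sub>R fact n)" by (simp add: field_simps)
  also have "\<dots> \<le> (\<Sum>n. x ^ n /\<^sub>R fact n)"
    using assms summable_exp_generic[of x] by (intro sum_le_suminf) auto
  also have "\<dots> = exp x" by (simp add: exp_def)
  finally show ?thesis by (simp add: pois_def exp_minus field_simps)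
qed

lemma pois_le_self:
  assumes "x \<ge> 0" "j \<ge> 1"
  shows "pois j x \<le> x"
proof -
  obtain i where j: "j = Suc i" using assms(2) by (cases j) auto
  have "pois j x = pois i x * (x / real (Suc i))"
    by (simp add: pois_def j mult_ac del: of_nat_Suc)
  also have "\<dots> \<le> 1 * (x / 1)"
    using assms by (intro mult_mono pois_le_1 divide_left_mono) (auto simp: pois_nonneg)
  finally show ?thesis by simp
qed

lemma pois_Suc: "real (Suc j) * pois (Suc j) x = x * pois j x"
  by (simp add: pois_def field_simps del: of_nat_Suc)

lemma continuous_pois: "isCont (pois j) x"
  unfolding pois_def[abs_def] by (intro continuous_intros) auto

lemma pois_measurable [measurable]: "pois j \<in> borel_measurable borel"
  unfolding pois_def[abs_def] by measurable

lemma has_real_derivative_pois: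
  assumes "j \<ge> 1"
  shows "(pois j has_real_derivative (pois (j - 1) x - pois j x)) (at x within A)"
proof -
  obtain i where j: "j = Suc i" using assms by (cases j) auto
  have "((\<lambda>x. exp (- x) * x ^ Suc i / fact (Suc i)) has_real_derivative
      (- exp (- x) * x ^ Suc i + real (Suc i) * x ^ i * exp (- x)) / fact (Suc i)) (at x within A)"
    by (intro DERIV_cdivide DERIV_mult)
       (auto intro!: derivative_eq_intros DERIV_subset[OF DERIV_pow[of "Suc i", simplified]] simp del: power_Suc of_nat_Suc)
  moreover have "(- exp (- x) * x ^ Suc i + real (Suc i) * x ^ i * exp (- x)) / fact (Suc i) = pois i x - pois (Suc i) x"
    by (simp add: pois_def field_simps del: of_nat_Suc)
  ultimately show ?thesis unfolding j pois_def[abs_def] by simp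
qed

lemma has_bochner_integral_Gamma:
  assumes "s > (0::real)"
  shows "has_bochner_integral lborel (\<lambda>x. indicator {0<..} x * (x powr (s - 1) * exp (- x))) (Gamma s)"
proof (rule has_bochner_integral_nn_integral)
  have "(\<integral>\<^sup>+x. ennreal (indicator {0<..} x * (x powr (s - 1) * exp (- x))) \<partial>lborel) =
      (\<integral>\<^sup>+x. ennreal (indicator {0..} x * x powr (s - 1) / exp x) \<partial>lborel)"
    using AE_lborel_singleton[of 0]
    by (intro nn_integral_cong_AE) (auto simp: indicator_def exp_minus field_simps elim!: eventually_mono)
  then show "(\<integral>\<^sup>+x. ennreal (indicator {0<..} x * (x powr (s - 1) * exp (- x))) \<partial>lborel) = ennreal (Gamma s)"
    by (simp add: Gamma_conv_nn_integral_real[OF assms])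
qed (use assms in \<open>auto simp: Gamma_real_pos less_imp_le\<close>)

lemma has_bochner_integral_pois:
  "has_bochner_integral lborel (\<lambda>x. indicator {0<..} x * pois j x) 1"
proof -
  have "has_bochner_integral lborel (\<lambda>x. (indicator {0<..} x * (x powr (real (Suc j) - 1) * exp (- x))) / fact j) (Gamma (real (Suc j)) / fact j)"
    by (intro has_bochner_integral_divide_zero has_bochner_integral_Gamma) auto
  moreover have "(\<lambda>x. (indicator {0<..} x * (x powr (real (Suc j) - 1) * exp (- x))) / fact j) = (\<lambda>x. indicator {0<..} x * pois j x)"
    by (auto simp: fun_eq_iff pois_def indicator_def powr_realpow)
  moreover have "Gamma (real (Suc j)) = fact j" using Gamma_fact[of j, where 'a=real] by (simp add: add.commute)
  ultimately show ?thesis by simp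
qed

lemma has_bochner_integral_pois_over_self:
  assumes "j \<ge> 1"
  shows "has_bochner_integral lborel (\<lambda>x. indicator {0<..} x * (pois j x / x)) (1 / real j)"
proof -
  obtain i where j: "j = Suc i" using assms by (cases j) auto
  have "has_bochner_integral lborel (\<lambda>x. (indicator {0<..} x * pois i x) / real j) (1 / real j)"
    by (intro has_bochner_integral_divide_zero has_bochner_integral_pois)
  moreover have "(\<lambda>x. (indicator {0<..} x * pois i x) / real j) = (\<lambda>x. indicator {0<..} x * (pois j x / x))"
    by (auto simp: fun_eq_iff pois_def indicator_def j field_simps simp del: of_nat_Suc)
  ultimately show ?thesis by simp
qed

text \<open>\<open>sqrt x + 1 / sqrt x\<close> is the growth of the dominating function that
  \<open>rho_bound\<close> will provide.\<close>

lemma integrable_pois_sqrt: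
  "integrable lborel (\<lambda>x. indicator {0<..} x * (pois j x * (sqrt x + 1 / sqrt x)))"
proof -
  have "integrable lborel (\<lambda>x. (indicator {0<..} x * (x powr ((real j + 3 / 2) - 1) * exp (- x)) +
      indicator {0<..} x * (x powr ((real j + 1 / 2) - 1) * exp (- x))) / fact j)"
    by (intro integrable_divide_zero Bochner_Integration.integrable_add
        has_bochner_integral_Gamma[THEN has_bochner_integral_iff[THEN iffD1], THEN conjunct1]) auto
  moreover have "(indicator {0<..} x * (x powr ((real j + 3 / 2) - 1) * exp (- x)) +
      indicator {0<..} x * (x powr ((real j + 1 / 2) - 1) * exp (- x))) / fact j = indicator {0<..} x * (pois j x * (sqrt x + 1 / sqrt x))" for x :: real
  proof (cases "x > 0")
    case True
    have f1: "x powr ((real j + 3 / 2) - 1) = x ^ j * sqrt x"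
      using True by (simp add: powr_add[symmetric] powr_realpow[symmetric] powr_half_sqrt[symmetric] add.commute)
    have f2: "x powr ((real j + 1 / 2) - 1) = x ^ j * (1 / sqrt x)"
    proof -
      have "real j + 1 / 2 - 1 = real j - 1 / 2" by simp
      then show ?thesis using True by (simp only: powr_diff powr_realpow powr_half_sqrt less_imp_le) simp
    qed
    show ?thesis unfolding f1 f2 using True by (simp add: pois_def distrib_left add_divide_distrib mult_ac)
  qed auto
  ultimately show ?thesis by simp
qed

lemma abs_ln_le_sqrt:
  assumes "x > (0::real)"
  shows "\<bar>ln x\<bar> \<le> 2 * (sqrt x + 1 / sqrt x)"
proof -
  have "ln x = 2 * ln (sqrt x)" using assms by (simp add: ln_sqrt)
  moreover have "ln (sqrt x) \<le> sqrt x" using assms ln_bound[of "sqrt x"] by simp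
  moreover have "- ln (sqrt x) \<le> 1 / sqrt x" using assms ln_bound[of "1 / sqrt x"] by (simp add: ln_div)
  moreover define a b where "a = sqrt x" and "b = 1 / sqrt x"
  moreover have "0 < a" "0 < b" using assms by (auto simp: a_def b_def)
  ultimately have "ln x = 2 * ln a" "ln a \<le> a" "- ln a \<le> b" "0 < a" "0 < b" by simp_all
  then have "ln x \<le> 2 * (a + b)" "- ln x \<le> 2 * (a + b)" by simp_all
  then have "\<bar>ln x\<bar> \<le> 2 * (a + b)" by (rule abs_leI)
  then show ?thesis by (simp add: a_def b_def)
qed

text \<open>Integration by parts: the boundary values of \<open>pois j x * ln x\<close> vanish, at 0
  because \<open>pois j x \<le> x\<close>, and what remains is the integral of
  \<open>pois j x / x\<close>. This is where the constant in the mean arises.\<close>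

lemma integral_pois_deriv_ln:
  assumes j: "j \<ge> 1"
  shows "(\<integral>x. indicator {0<..} x * ((pois (j - 1) x - pois j x) * (- ln x)) \<partial>lborel) = 1 / real j"
proof -
  let ?fd = "\<lambda>x. pois (j - 1) x - pois j x"
  let ?F = "\<lambda>x. pois j x * ln x"
  have int1: "integrable lborel (\<lambda>x. indicator {0<..} x * (?fd x * (- ln x)))"
  proof (rule Bochner_Integration.integrable_bound)
    show "integrable lborel (\<lambda>x. 2 * (indicator {0<..} x * (pois (j - 1) x * (sqrt x + 1 / sqrt x))) +
        2 * (indicator {0<..} x * (pois j x * (sqrt x + 1 / sqrt x))))"
      by (intro Bochner_Integration.integrable_add integrable_mult_right integrable_pois_sqrt)
    show "AE x in lborel. norm (indicator {0<..} x * (?fd x * (- ln x))) \<le> norm (2 * (indicator {0<..} x * (pois (j - 1) x * (sqrt x + 1 / sqrt x))) +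
        2 * (indicator {0<..} x * (pois j x * (sqrt x + 1 / sqrt x))))"
    proof (rule AE_I2)
      fix x :: real
      show "norm (indicator {0<..} x * (?fd x * (- ln x))) \<le> norm (2 * (indicator {0<..} x * (pois (j - 1) x * (sqrt x + 1 / sqrt x))) +
        2 * (indicator {0<..} x * (pois j x * (sqrt x + 1 / sqrt x))))"
      proof (cases "x > 0")
        case True
        have "\<bar>?fd x\<bar> * \<bar>ln x\<bar> \<le> (pois (j - 1) x + pois j x) * (2 * (sqrt x + 1 / sqrt x))"
          using True pois_nonneg[of x j] pois_nonneg[of x "j - 1"] by (intro mult_mono abs_ln_le_sqrt) auto
        also have "\<dots> \<le> \<bar>\<dots>\<bar>" by (rule abs_ge_self)
        finally have "\<bar>?fd x * (- ln x)\<bar> \<le> \<bar>(pois (j - 1) x + pois j x) * (2 * (sqrt x + 1 / sqrt x))\<bar>"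
          by (simp only: abs_mult abs_minus)
        moreover have "2 * (pois (j - 1) x * (sqrt x + 1 / sqrt x)) + 2 * (pois j x * (sqrt x + 1 / sqrt x)) =
           (pois (j - 1) x + pois j x) * (2 * (sqrt x + 1 / sqrt x))"
        proof -
          have "2 * (u * s) + 2 * (v * s) = (u + v) * (2 * s)" for u v s :: real by (simp add: algebra_simps)
          then show ?thesis by this
        qed
        ultimately show ?thesis using True by (simp only: real_norm_def) simp
      qed simp
    qed
  qed measurable
  have int2: "integrable lborel (\<lambda>x. indicator {0<..} x * (pois j x / x))"
    "(\<integral>x. indicator {0<..} x * (pois j x / x) \<partial>lborel) = 1 / real j"
    using has_bochner_integral_pois_over_self[OF j] by (auto simp: has_bochner_integral_iff)
  have e: "einterval (ereal 0) \<infinity> = {0<..}" by (auto simp: einterval_def)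
  have eq: "indicator {0<..} x * (?fd x * ln x + pois j x / x) =
     indicator {0<..} x * (pois j x / x) - indicator {0<..} x * (?fd x * (- ln x))" for x by (simp add: algebra_simps)
  have "(LBINT x=ereal 0..\<infinity>. ?fd x * ln x + pois j x / x) = 0 - 0"
  proof (rule interval_integral_FTC_integrable[where F="?F"])
    fix x assume "ereal 0 < ereal x" "ereal x < \<infinity>"
    then have x: "x > 0" by simp
    show "(?F has_vector_derivative ?fd x * ln x + pois j x / x) (at x)"
      unfolding has_real_derivative_iff_has_vector_derivative[symmetric]
      using x by (auto intro!: derivative_eq_intros has_real_derivative_pois[OF j] simp: field_simps)
    show "isCont (\<lambda>x. ?fd x * ln x + pois j x / x) x"
      using x by (intro continuous_intros continuous_pois) auto
  next
    show "set_integrable lborel (einterval (ereal 0) \<infinity>) (\<lambda>x. ?fd x * ln x + pois j x / x)"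
      unfolding set_integrable_def e real_scaleR_def eq using int1 int2 by (intro Bochner_Integration.integrable_diff)
    have "((\<lambda>x::real. x * ln x) \<longlongrightarrow> 0) (at_right 0)" by real_asymp
    then have "(?F \<longlongrightarrow> 0) (at_right 0)"
    proof (rule Lim_null_comparison[rotated, OF tendsto_rabs_zero])
      show "\<forall>\<^sub>F x in at_right 0. norm (?F x) \<le> \<bar>x * ln x\<bar>"
        using eventually_at_right_less[of "0::real"]
        by eventually_elim (auto simp: abs_mult pois_nonneg intro!: mult_right_mono pois_le_self j)
    qed
    then show "((?F \<circ> real_of_ereal) \<longlongrightarrow> 0) (at_right (ereal 0))" by (simp only: ereal_tendsto_simps)
    have "((\<lambda>x::real. x ^ Suc j / exp x) \<longlongrightarrow> 0) at_top" by (rule tendsto_power_div_exp_0)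
    then have "(?F \<longlongrightarrow> 0) at_top"
    proof (rule Lim_null_comparison[rotated])
      show "\<forall>\<^sub>F x in at_top. norm (?F x) \<le> x ^ Suc j / exp x"
        using eventually_ge_at_top[of "1::real"]
      proof eventually_elim
        case (elim x)
        have "pois j x \<le> exp (- x) * x ^ j / 1"
          unfolding pois_def using elim by (intro divide_left_mono) (auto simp: fact_ge_1)
        moreover have "ln x \<le> x" using elim by (intro ln_bound) auto
        ultimately have "pois j x * ln x \<le> exp (- x) * x ^ j * x"
          using elim by (intro mult_mono) (auto simp: pois_nonneg)
        then show ?case using elim by (simp add: abs_mult pois_nonneg exp_minus field_simps)
      qed
    qed
    then show "((?F \<circ> real_of_ereal) \<longlongrightarrow> 0) (at_left \<infinity>)" by (simp only: ereal_tendsto_simps)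
  qed auto
  moreover have "(LBINT x=ereal 0..\<infinity>. ?fd x * ln x + pois j x / x) =
     (\<integral>x. indicator {0<..} x * (?fd x * ln x + pois j x / x) \<partial>lborel)"
    by (simp add: interval_lebesgue_integral_def e set_lebesgue_integral_def)
  moreover have "\<dots> = 1 / real j - (\<integral>x. indicator {0<..} x * (?fd x * (- ln x)) \<partial>lborel)"
    unfolding eq by (subst Bochner_Integration.integral_diff[OF int2(1) int1]) (simp only: int2)
  ultimately show ?thesis by simp
qed

lemma pois_summable:
  assumes "\<And>k. p k \<ge> 0" "summable p" "t \<ge> 0" "j \<ge> 1"
  shows "summable (\<lambda>k. pois j (p k * t))"
proof (rule summable_comparison_test')
  show "summable (\<lambda>k. p k * t)" using assms(2) by (rule summable_mult2)
  show "norm (pois j (p k * t)) \<le> p k * t" if "k \<ge> 0" for k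
    using assms by (simp add: pois_nonneg pois_le_self)
qed

text \<open>Identified as the mean of \<open>Kstar\<close> in \<open>Kstar_moments\<close>.\<close>

definition psum :: "(nat \<Rightarrow> real) \<Rightarrow> nat \<Rightarrow> real \<Rightarrow> real" where
  "psum p j t = (\<Sum>k. pois j (p k * t))"

text \<open>The analytic side of the hypotheses: \<open>rho p\<close> lies in de Haan's class with
  auxiliary function \<open>L\<close>, and \<open>L\<close> tends to infinity, as it does in both
  growth regimes.\<close>

locale karlin_regular =
  fixes p :: "nat \<Rightarrow> real" and L :: "real \<Rightarrow> real"
  assumes p_ge_0: "\<And>k. p k \<ge> 0"
    and p_sums_1: "p sums 1"
    and L_top: "filterlim L at_top at_top"
    and L_slow: "\<And>c. c > 0 \<Longrightarrow> ((\<lambda>t. L (c * t) / L t) \<longlongrightarrow> 1) at_top"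
    and rho_lim: "\<And>c. c > 0 \<Longrightarrow> ((\<lambda>t. (rho p (c * t) - rho p t) / L t) \<longlongrightarrow> ln c) at_top"
begin

lemma summable_p: "summable p"
  using p_sums_1 by (rule sums_summable)

lemma finite_rho: "finite {k. 0 < p k \<and> 1 / p k \<le> t}"
proof (cases "t > 0")
  case True
  have "p \<longlonglongrightarrow> 0" using summable_p by (rule summable_LIMSEQ_zero)
  then have "eventually (\<lambda>k. p k < 1 / t) sequentially" using True by (intro order_tendstoD) auto
  then obtain N where N: "\<And>k. k \<ge> N \<Longrightarrow> p k < 1 / t" by (auto simp: eventually_sequentially)
  have "{k. 0 < p k \<and> 1 / p k \<le> t} \<subseteq> {..<N}"
  proof safe
    fix k assume k: "0 < p k" "1 / p k \<le> t"
    then have "\<not> p k < 1 / t" using True by (simp add: field_simps)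
    then show "k < N" using N by (cases "k < N") auto
  qed
  then show ?thesis by (rule finite_subset) auto
next
  case False
  then have "\<not> (0 < p k \<and> 1 / p k \<le> t)" for k
    by (smt (verit) divide_pos_pos)
  then have "{k. 0 < p k \<and> 1 / p k \<le> t} = {}" by blast
  then show ?thesis by (simp only: finite.emptyI)
qed

lemma mono_rho: "s \<le> t \<Longrightarrow> rho p s \<le> rho p t"
  unfolding rho_def by (intro of_nat_mono card_mono finite_rho) auto

lemma rho_nonneg: "rho p t \<ge> 0" by (simp add: rho_def)

lemma rho_measurable [measurable]: "rho p \<in> borel_measurable borel"
  by (intro borel_measurable_mono monoI mono_rho)

lemma L_pos_eventually: "eventually (\<lambda>t. L t > 0) at_top"
  using L_top by (auto simp: filterlim_at_top_dense)

text \<open>Each step by the factor 4 multiplies \<open>L\<close> by at most 3/2 and changes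
  \<open>rho p\<close> by at most \<open>2 * L t\<close>, because \<open>ln 4 < 2\<close>. Iteration
  gives at most the order of \<open>2 ^ n\<close>, the square root of \<open>4 ^ n\<close>, and this
  square root is what keeps the resulting bound integrable against Poisson weights.\<close>

lemma rho_growth:
  "\<exists>C t0. C \<ge> 0 \<and> t0 > 0 \<and> (\<forall>t\<ge>t0. L t \<ge> 1 \<and> (\<forall>n. rho p (4 ^ n * t) - rho p t \<le> C * 2 ^ n * L t \<and>
      rho p t - rho p (t / 4 ^ n) \<le> C * 2 ^ n * L t))"
proof -
  have ln4: "ln 4 < (2::real)"
  proof -
    have "ln (4::real) = 2 * ln 2" using ln_realpow[of "2::real" 2] by simp
    then show ?thesis using ln_2_less_1 by simp
  qed
  have "eventually (\<lambda>t. L (4 * t) / L t < 3 / 2) at_top" "eventually (\<lambda>t. L (1 / 4 * t) / L t < 3 / 2) at_top"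
    "eventually (\<lambda>t. (rho p (4 * t) - rho p t) / L t < 2) at_top"
    "eventually (\<lambda>t. (rho p (1 / 4 * t) - rho p t) / L t > - 2) at_top"
    using ln4 order_tendstoD(2)[OF L_slow[of 4], of "3 / 2"] order_tendstoD(2)[OF L_slow[of "1 / 4"], of "3 / 2"]
      order_tendstoD(2)[OF rho_lim[of 4], of 2] order_tendstoD(1)[OF rho_lim[of "1 / 4"], of "- 2"] by (simp_all add: ln_div)
  moreover have "eventually (\<lambda>t. L t \<ge> 1) at_top" using L_top by (auto simp: filterlim_at_top)
  ultimately have "eventually (\<lambda>t. t > 0 \<and> L t \<ge> 1 \<and> L (4 * t) \<le> 3 / 2 * L t \<and> L (t / 4) \<le> 3 / 2 * L t \<and>
      rho p (4 * t) - rho p t \<le> 2 * L t \<and> rho p t - rho p (t / 4) \<le> 2 * L t) at_top"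
    using eventually_gt_at_top[of 0]
  proof eventually_elim
    case (elim t)
    then have "L t > 0" by linarith
    then show ?case using elim by (simp add: divide_less_eq less_divide_eq)
  qed
  then obtain t1 where t1: "\<And>t. t \<ge> t1 \<Longrightarrow> t > 0 \<and> L t \<ge> 1 \<and> L (4 * t) \<le> 3 / 2 * L t \<and> L (t / 4) \<le> 3 / 2 * L t \<and>
      rho p (4 * t) - rho p t \<le> 2 * L t \<and> rho p t - rho p (t / 4) \<le> 2 * L t"
    by (auto simp: eventually_at_top_linorder)
  define t0 where "t0 = t1"
  have t0: "t0 > 0" using t1[of t1] by (simp add: t0_def)
  \<comment> \<open>The 4 absorbs the new term \<open>2 * L t\<close> of each step;
    \<open>rho p (4 * t0)\<close> covers the downward iteration once it leaves the range of the
    one-step bounds.\<close>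
  define C where "C = 4 + rho p (4 * t0)"
  have C4: "C \<ge> 4" using rho_nonneg by (simp add: C_def)
  have step: "2 * l + C * 2 ^ n * (3 / 2 * l) \<le> C * 2 ^ Suc n * l" if "l \<ge> 1" for l and n :: nat
  proof -
    have "4 * 1 \<le> C * 2 ^ n" using C4 by (intro mult_mono) auto
    then have "4 * l \<le> C * 2 ^ n * l" using that by (intro mult_right_mono) auto
    then show ?thesis by (simp add: field_simps)
  qed
  have up: "rho p (4 ^ n * t) - rho p t \<le> C * 2 ^ n * L t" if "t \<ge> t0" for n t
    using that
  proof (induction n arbitrary: t)
    case 0
    then show ?case using t1[of t] C4 by (simp add: t0_def)
  next
    case (Suc n)
    have t: "L t \<ge> 1" "L (4 * t) \<le> 3 / 2 * L t" "rho p (4 * t) - rho p t \<le> 2 * L t" "t > 0"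
      using t1[of t] Suc.prems by (auto simp: t0_def)
    have "rho p (4 ^ n * (4 * t)) - rho p (4 * t) \<le> C * 2 ^ n * L (4 * t)"
      using Suc.prems t(4) by (intro Suc.IH) auto
    also have "\<dots> \<le> C * 2 ^ n * (3 / 2 * L t)" using C4 t by (intro mult_left_mono) auto
    finally have "rho p (4 ^ Suc n * t) - rho p t \<le> 2 * L t + C * 2 ^ n * (3 / 2 * L t)"
      using t(3) by (simp add: mult_ac)
    then show ?case using step[OF t(1), of n] by linarith
  qed
  have down: "rho p t - rho p (t / 4 ^ n) \<le> C * 2 ^ n * L t" if "t \<ge> t0" for n t
    using that
  proof (induction n arbitrary: t)
    case 0
    then show ?case using t1[of t] C4 by (simp add: t0_def)
  next
    case (Suc n)
    have t: "L t \<ge> 1" "L (t / 4) \<le> 3 / 2 * L t" "rho p t - rho p (t / 4) \<le> 2 * L t" "t > 0"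
      using t1[of t] Suc.prems by (auto simp: t0_def)
    show ?case
    proof (cases "t / 4 \<ge> t0")
      case True
      have "rho p (t / 4) - rho p (t / 4 / 4 ^ n) \<le> C * 2 ^ n * L (t / 4)" by (rule Suc.IH[OF True])
      also have "\<dots> \<le> C * 2 ^ n * (3 / 2 * L t)" using C4 t by (intro mult_left_mono) auto
      finally have "rho p t - rho p (t / 4 ^ Suc n) \<le> 2 * L t + C * 2 ^ n * (3 / 2 * L t)"
        using t(3) by (simp add: field_simps)
      then show ?thesis using step[OF t(1), of n] by linarith
    next
      case False
      have "rho p t - rho p (t / 4 ^ Suc n) \<le> rho p t" using rho_nonneg by simp
      also have "\<dots> \<le> rho p (4 * t0)" using False by (intro mono_rho) auto
      also have "\<dots> \<le> C * 1 * 1" by (simp add: C_def)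
      also have "\<dots> \<le> C * 2 ^ Suc n * L t"
        using C4 t(1) by (intro mult_mono) (auto intro: one_le_power simp del: power_Suc)
      finally show ?thesis .
    qed
  qed
  show ?thesis
    by (intro exI[of _ C] exI[of _ t0] conjI allI impI) (use C4 t0 up down t1 t0_def in auto)
qed

text \<open>A Potter-type bound, obtained by comparing \<open>x\<close> or \<open>1 / x\<close> with
  the least power of 4 above it; it supplies the dominating function in
  \<open>psum_lim\<close>.\<close>

lemma rho_bound:
  "\<exists>C t0. C \<ge> 0 \<and> t0 > 0 \<and> (\<forall>t\<ge>t0. L t \<ge> 1 \<and> (\<forall>x>0. \<bar>rho p (t / x) - rho p t\<bar> \<le> C * (sqrt x + 1 / sqrt x) * L t))"
proof -
  obtain C t0 where C: "C \<ge> 0" "t0 > 0" and L1: "\<And>t. t \<ge> t0 \<Longrightarrow> L t \<ge> 1"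
    and up: "\<And>t n. t \<ge> t0 \<Longrightarrow> rho p (4 ^ n * t) - rho p t \<le> C * 2 ^ n * L t"
    and down: "\<And>t n. t \<ge> t0 \<Longrightarrow> rho p t - rho p (t / 4 ^ n) \<le> C * 2 ^ n * L t"
    using rho_growth by blast
  have pick: "\<exists>n. y \<le> 4 ^ n \<and> 2 ^ n \<le> 2 * sqrt y" if y: "y \<ge> 1" for y :: real
  proof -
    obtain m where m: "y < 4 ^ m" using real_arch_pow[of 4 y] by auto
    define n where "n = (LEAST n. y \<le> 4 ^ n)"
    have n: "y \<le> 4 ^ n" unfolding n_def by (rule LeastI[of _ m]) (use m in auto)
    have "(2::real) ^ n \<le> 2 * sqrt y"
    proof (cases n)
      case 0 then show ?thesis using y real_sqrt_ge_1_iff[of y] by (simp del: real_sqrt_ge_1_iff)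
    next
      case (Suc i)
      then have "\<not> y \<le> 4 ^ i" using not_less_Least[of i "\<lambda>n. y \<le> 4 ^ n"] by (auto simp: n_def)
      then have "sqrt (4 ^ i) \<le> sqrt y" by simp
      also have "sqrt (4 ^ i) = 2 ^ i" by (simp add: real_sqrt_power)
      finally show ?thesis using Suc by simp
    qed
    with n show ?thesis by blast
  qed
  have "\<bar>rho p (t / x) - rho p t\<bar> \<le> 2 * C * (sqrt x + 1 / sqrt x) * L t" if t: "t \<ge> t0" and x: "x > 0" for t x
  proof (cases "x \<ge> 1")
    case True
    obtain n where n: "x \<le> 4 ^ n" "2 ^ n \<le> 2 * sqrt x" using pick[OF True] by auto
    have tp: "t > 0" using t C by simp
    have "t / x \<le> t" using True tp by (simp add: field_simps)
    then have "\<bar>rho p (t / x) - rho p t\<bar> = rho p t - rho p (t / x)" using mono_rho[of "t / x" t] by simp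
    also have "\<dots> \<le> rho p t - rho p (t / 4 ^ n)"
      using n x tp by (intro diff_left_mono mono_rho divide_left_mono) auto
    also have "\<dots> \<le> C * 2 ^ n * L t" by (rule down[OF t])
    also have "\<dots> \<le> C * (2 * (sqrt x + 1 / sqrt x)) * L t"
    proof (intro mult_right_mono mult_left_mono)
      show "2 ^ n \<le> 2 * (sqrt x + 1 / sqrt x)" by (rule order_trans[OF n(2)]) (use x in simp)
    qed (use C L1[OF t] in auto)
    finally show ?thesis by (simp add: mult_ac)
  next
    case False
    then have "1 / x \<ge> 1" using x by simp
    then obtain n where n: "1 / x \<le> 4 ^ n" "2 ^ n \<le> 2 * sqrt (1 / x)" using pick by blast
    have tp: "t > 0" using t C by simp
    have "t \<le> t / x" using False x tp by (simp add: field_simps)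
    then have "\<bar>rho p (t / x) - rho p t\<bar> = rho p (t / x) - rho p t" using mono_rho[of t "t / x"] by simp
    also have "\<dots> \<le> rho p (4 ^ n * t) - rho p t"
      using mult_right_mono[OF n(1), of t] tp by (intro diff_right_mono mono_rho) auto
    also have "\<dots> \<le> C * 2 ^ n * L t" by (rule up[OF t])
    also have "\<dots> \<le> C * (2 * (sqrt x + 1 / sqrt x)) * L t"
    proof (intro mult_right_mono mult_left_mono)
      show "2 ^ n \<le> 2 * (sqrt x + 1 / sqrt x)" by (rule order_trans[OF n(2)]) (use x in \<open>simp add: real_sqrt_divide\<close>)
    qed (use C L1[OF t] in auto)
    finally show ?thesis by (simp add: mult_ac)
  qed
  then show ?thesis using C L1 by (intro exI[of _ "2 * C"] exI[of _ t0]) auto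
qed

lemma summable_pois: "t \<ge> 0 \<Longrightarrow> j \<ge> 1 \<Longrightarrow> summable (\<lambda>k. pois j (p k * t))"
  by (rule pois_summable[OF p_ge_0 summable_p])

text \<open>Each term is the integral of the derivative of \<open>pois j\<close> from 0 to
  \<open>p k * t\<close>, as \<open>pois j 0 = 0\<close>. Exchanging sum and integral counts the
  \<open>k\<close> with \<open>x \<le> p k * t\<close>, and there are \<open>rho p (t / x)\<close>
  of them.\<close>

lemma psum_integral:
  assumes t: "t > 0" and j: "j \<ge> 1"
  shows "integrable lborel (\<lambda>x. indicator {0<..} x * ((pois (j - 1) x - pois j x) * rho p (t / x)))"
    and "psum p j t = (\<integral>x. indicator {0<..} x * ((pois (j - 1) x - pois j x) * rho p (t / x)) \<partial>lborel)"
proof -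
  let ?fd = "\<lambda>x. pois (j - 1) x - pois j x"
  define g where "g k x = ?fd x * indicator {0..p k * t} x" for k x
  have pt: "p k * t \<ge> 0" for k using p_ge_0[of k] t by simp
  have hb: "has_bochner_integral lborel (g k) (pois j (p k * t))" for k
  proof -
    have "has_bochner_integral lborel (\<lambda>x. ?fd x * indicator {0..p k * t} x) (pois j (p k * t) - pois j 0)"
      using pt[of k] by (intro has_bochner_integral_FTC_Icc_real has_real_derivative_pois[OF j] continuous_intros continuous_pois)
    then show ?thesis using j by (simp add: g_def[abs_def] pois_zero)
  qed
  have int: "integrable lborel (g k)" for k using hb by (auto simp: has_bochner_integral_iff)
  have fin: "finite {k. x \<le> p k * t}" and crd: "real (card {k. x \<le> p k * t}) = rho p (t / x)" if x: "x > 0" for x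
  proof -
    have "x \<le> p k * t \<longleftrightarrow> 0 < p k \<and> 1 / p k \<le> t / x" for k
    proof (cases "p k = 0")
      case False
      then have "p k > 0" using p_ge_0[of k] by simp
      then show ?thesis using x by (simp add: field_simps)
    qed (use x in auto)
    then have "{k. x \<le> p k * t} = {k. 0 < p k \<and> 1 / p k \<le> t / x}" by auto
    then show "finite {k. x \<le> p k * t}" "real (card {k. x \<le> p k * t}) = rho p (t / x)"
      using finite_rho[of "t / x"] by (auto simp: rho_def)
  qed
  have sumg: "(\<lambda>k. g k x) sums (?fd x * rho p (t / x))" if x: "x > 0" for x
  proof -
    have "(\<lambda>k. g k x) sums (\<Sum>k\<in>{k. x \<le> p k * t}. g k x)"
      using fin[OF x] x by (intro sums_finite) (auto simp: g_def)
    also have "(\<Sum>k\<in>{k. x \<le> p k * t}. g k x) = (\<Sum>k\<in>{k. x \<le> p k * t}. ?fd x)"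
      using x by (intro sum.cong) (auto simp: g_def)
    also have "\<dots> = ?fd x * rho p (t / x)" using crd[OF x] by simp
    finally show ?thesis .
  qed
  have AE0: "AE x in lborel. x \<noteq> (0::real)" by (rule AE_lborel_singleton)
  have AEs: "AE x in lborel. summable (\<lambda>k. norm (g k x))"
    using AE0
  proof eventually_elim
    case (elim x)
    show ?case
    proof (cases "x > 0")
      case True
      then show ?thesis using fin[OF True] by (intro summable_finite[of "{k. x \<le> p k * t}"]) (auto simp: g_def)
    next
      case False
      then have "g k x = 0" for k using elim by (simp add: g_def)
      then show ?thesis by simp
    qed
  qed
  have sn: "summable (\<lambda>k. \<integral>x. norm (g k x) \<partial>lborel)"
  proof (rule summable_comparison_test')
    show "summable (\<lambda>k. 2 * (p k * t))" using summable_p by (intro summable_mult summable_mult2)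
    fix k :: nat
    have "(\<integral>x. norm (g k x) \<partial>lborel) \<le> (\<integral>x. 2 * indicator {0..p k * t} x \<partial>lborel)"
    proof (intro integral_mono integrable_norm int)
      show "integrable lborel (\<lambda>x. 2 * indicat_real {0..p k * t} x)"
        by (intro integrable_mult_right integrable_real_indicator) (auto simp: emeasure_lborel_Icc_eq)
      show "norm (g k x) \<le> 2 * indicator {0..p k * t} x" for x
        using pois_le_1[of x j] pois_le_1[of x "j - 1"] pois_nonneg[of x j] pois_nonneg[of x "j - 1"]
        by (auto simp: g_def indicator_def)
    qed
    also have "\<dots> = 2 * (p k * t)" using pt[of k] by simp
    finally show "norm (\<integral>x. norm (g k x) \<partial>lborel) \<le> 2 * (p k * t)" by simp
  qed
  have cong: "AE x in lborel. (\<Sum>k. g k x) = indicator {0<..} x * (?fd x * rho p (t / x))"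
    using AE0
  proof eventually_elim
    case (elim x)
    show ?case
    proof (cases "x > 0")
      case True then show ?thesis using sumg[OF True] by (simp add: sums_iff)
    next
      case False
      then have "g k x = 0" for k using elim by (simp add: g_def)
      then show ?thesis using False by simp
    qed
  qed
  have m [measurable]: "(\<lambda>x. \<Sum>k. g k x) \<in> borel_measurable lborel"
    using integrable_suminf[OF int AEs sn] by (rule borel_measurable_integrable)
  show "integrable lborel (\<lambda>x. indicator {0<..} x * (?fd x * rho p (t / x)))"
    by (rule integrable_cong_AE_imp[OF integrable_suminf[OF int AEs sn]]) (use cong in \<open>auto elim!: eventually_mono\<close>)
  have "psum p j t = (\<Sum>k. \<integral>x. g k x \<partial>lborel)"
    unfolding psum_def using hb by (simp add: has_bochner_integral_iff)
  also have "\<dots> = (\<integral>x. (\<Sum>k. g k x) \<partial>lborel)" by (rule integral_suminf[OF int AEs sn, symmetric])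
  also have "\<dots> = (\<integral>x. indicator {0<..} x * (?fd x * rho p (t / x)) \<partial>lborel)"
    by (intro integral_cong_AE cong) measurable
  finally show "psum p j t = (\<integral>x. indicator {0<..} x * (?fd x * rho p (t / x)) \<partial>lborel)" .
qed

text \<open>\<open>rho p t\<close> itself may outgrow \<open>L t\<close>, but the derivative of
  \<open>pois j\<close> integrates to 0. Subtracting \<open>rho p t\<close> therefore costs nothing
  and leaves differences that the hypothesis controls.\<close>

lemma psum_lim:
  assumes j: "j \<ge> 1"
  shows "((\<lambda>t. psum p j t / L t) \<longlongrightarrow> 1 / real j) at_top"
proof -
  let ?fd = "\<lambda>x. pois (j - 1) x - pois j x"
  let ?s = "\<lambda>t x. indicator {0<..} x * (?fd x * ((rho p (t / x) - rho p t) / L t))"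
  obtain C t0 where C: "C \<ge> 0" "t0 > 0" and L1: "\<And>t. t \<ge> t0 \<Longrightarrow> L t \<ge> 1"
    and bd: "\<And>t x. t \<ge> t0 \<Longrightarrow> x > 0 \<Longrightarrow> \<bar>rho p (t / x) - rho p t\<bar> \<le> C * (sqrt x + 1 / sqrt x) * L t"
    using rho_bound by blast
  define w where "w x = C * (indicator {0<..} x * (pois (j - 1) x * (sqrt x + 1 / sqrt x))) +
        C * (indicator {0<..} x * (pois j x * (sqrt x + 1 / sqrt x)))" for x
  have "((\<lambda>t. \<integral>x. ?s t x \<partial>lborel) \<longlongrightarrow> (\<integral>x. indicator {0<..} x * (?fd x * (- ln x)) \<partial>lborel)) at_top"
  proof (rule integral_dominated_convergence_at_top)
    show "integrable lborel w" unfolding w_def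
      by (intro Bochner_Integration.integrable_add integrable_mult_right integrable_pois_sqrt)
    show "AE x in lborel. ((\<lambda>t. ?s t x) \<longlongrightarrow> indicator {0<..} x * (?fd x * (- ln x))) at_top"
    proof (rule AE_I2)
      fix x :: real
      show "((\<lambda>t. ?s t x) \<longlongrightarrow> indicator {0<..} x * (?fd x * (- ln x))) at_top"
      proof (cases "x > 0")
        case True
        then have "((\<lambda>t. (rho p (1 / x * t) - rho p t) / L t) \<longlongrightarrow> - ln x) at_top"
          using rho_lim[of "1 / x"] by (simp add: ln_div)
        then show ?thesis by (intro tendsto_intros) simp
      qed simp
    qed
    show "\<forall>\<^sub>F t in at_top. AE x in lborel. norm (?s t x) \<le> w x"
      using eventually_ge_at_top[of t0]
    proof eventually_elim
      case (elim t)
      show ?case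
      proof (rule AE_I2)
        fix x :: real
        show "norm (?s t x) \<le> w x"
        proof (cases "x > 0")
          case True
          have "\<bar>(rho p (t / x) - rho p t) / L t\<bar> \<le> C * (sqrt x + 1 / sqrt x)"
            using bd[OF elim True] L1[OF elim] by (simp add: divide_le_eq)
          then have "\<bar>?fd x\<bar> * \<bar>(rho p (t / x) - rho p t) / L t\<bar> \<le> (pois (j - 1) x + pois j x) * (C * (sqrt x + 1 / sqrt x))"
            using True pois_nonneg[of x j] pois_nonneg[of x "j - 1"] by (intro mult_mono) auto
          moreover have "w x = (pois (j - 1) x + pois j x) * (C * (sqrt x + 1 / sqrt x))"
            using True by (simp add: w_def algebra_simps)
          ultimately show ?thesis using True by (simp only: abs_mult real_norm_def) simp
        qed (simp add: w_def)
      qed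
    qed
  qed measurable
  then have lim: "((\<lambda>t. \<integral>x. ?s t x \<partial>lborel) \<longlongrightarrow> 1 / real j) at_top"
    by (simp only: integral_pois_deriv_ln[OF j])
  show ?thesis
  proof (rule Lim_transform_eventually[OF lim])
    show "\<forall>\<^sub>F t in at_top. (\<integral>x. ?s t x \<partial>lborel) = psum p j t / L t"
      using eventually_gt_at_top[of 0]
    proof eventually_elim
      case (elim t)
      have ip: "integrable lborel (\<lambda>x. indicator {0<..} x * pois i x)" "(\<integral>x. indicator {0<..} x * pois i x \<partial>lborel) = 1" for i
        using has_bochner_integral_pois[of i] by (auto simp: has_bochner_integral_iff)
      have "?s t x = (indicator {0<..} x * (?fd x * rho p (t / x)) -
        (indicator {0<..} x * pois (j - 1) x - indicator {0<..} x * pois j x) * rho p t) / L t" for x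
        by (simp add: field_simps)
      then have "(\<integral>x. ?s t x \<partial>lborel) = (\<integral>x. (indicator {0<..} x * (?fd x * rho p (t / x)) -
        (indicator {0<..} x * pois (j - 1) x - indicator {0<..} x * pois j x) * rho p t) / L t \<partial>lborel)" by presburger
      also have "\<dots> = (psum p j t - (1 - 1) * rho p t) / L t"
        using ip psum_integral[OF elim j]
        by (subst integral_divide_zero, subst Bochner_Integration.integral_diff) (auto simp: Bochner_Integration.integral_diff)
      finally show ?case by simp
    qed
  qed
qed

end

section \<open>Moments and deviations of the counts\<close>

text \<open>The probability that a Poisson variable with mean \<open>x\<close> is at least
  \<open>i\<close>.\<close>

definition pois_tail :: "nat \<Rightarrow> real \<Rightarrow> real" where
  "pois_tail i x = 1 - (\<Sum>l<i. pois l x)"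

lemma pois_tail_Suc: "pois_tail (Suc i) x = pois_tail i x - pois i x"
  by (simp add: pois_tail_def)

lemma has_real_derivative_pois_tail:
  "(pois_tail (Suc i) has_real_derivative pois i x) (at x within A)"
proof (induction i)
  case 0
  show ?case unfolding pois_tail_def[abs_def] pois_def by (auto intro!: derivative_eq_intros)
next
  case (Suc i)
  have "((\<lambda>x. pois_tail (Suc i) x - pois (Suc i) x) has_real_derivative pois i x - (pois (Suc i - 1) x - pois (Suc i) x)) (at x within A)"
    by (intro DERIV_diff Suc has_real_derivative_pois) auto
  then show ?case by (simp add: pois_tail_Suc[of "Suc i", abs_def])
qed

lemma pois_tail_mono:
  assumes "0 \<le> x" "x \<le> y"
  shows "pois_tail i x \<le> pois_tail i y"
proof (cases i)
  case 0 then show ?thesis by (simp add: pois_tail_def)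
next
  case (Suc n)
  show ?thesis unfolding Suc
    by (rule DERIV_nonneg_imp_nondecreasing[OF assms(2)])
       (use assms in \<open>auto intro!: exI has_real_derivative_pois_tail pois_nonneg\<close>)
qed

lemma pois_tail_nonneg:
  assumes "0 \<le> x" shows "pois_tail i x \<ge> 0"
proof -
  have "pois_tail i 0 \<le> pois_tail i x" by (rule pois_tail_mono) (use assms in auto)
  moreover have "pois_tail i 0 \<ge> 0"
    by (cases i) (auto simp: pois_tail_def pois_zero lessThan_Suc_eq_insert_0 sum.reindex)
  ultimately show ?thesis by linarith
qed

lemma pois_tail_le_self:
  assumes "0 \<le> x" "i \<ge> 1" shows "pois_tail i x \<le> x"
proof -
  have "pois 0 x \<le> (\<Sum>l<i. pois l x)"
    using assms by (intro member_le_sum) (auto simp: pois_nonneg)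
  then have "pois_tail i x \<le> 1 - exp (- x)" by (simp add: pois_tail_def pois_def)
  also have "\<dots> \<le> x" using exp_ge_add_one_self[of "- x"] by simp
  finally show ?thesis .
qed

text \<open>With \<open>m = i - 1\<close>, the mean value theorem gives some \<open>z\<close>
  between \<open>q * a\<close> and \<open>2 * (q * a)\<close>, where
  \<open>pois m z \<le> 2 ^ m * pois m (q * a)\<close>; the factor \<open>q * a\<close> is absorbed
  by raising the index to \<open>i\<close>. Ending at \<open>pois i\<close> makes the sum over the
  boxes a \<open>psum\<close>, hence of order \<open>L\<close>.\<close>

lemma pois_tail_increment:
  assumes q: "q \<ge> 0" and a: "0 < a" "a \<le> s" "s \<le> t" "t \<le> 2 * a" and i: "i \<ge> 1"
  shows "pois_tail i (q * t) - pois_tail i (q * s) \<le> (t - s) / a * (real i * 2 ^ (i - 1)) * pois i (q * a)"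
proof (cases "q * s < q * t")
  case True
  obtain m where m: "i = Suc m" using i by (cases i) auto
  obtain z where z: "z > q * s" "z < q * t" "pois_tail (Suc m) (q * t) - pois_tail (Suc m) (q * s) = (q * t - q * s) * pois m z"
    using MVT2[OF True, of "pois_tail (Suc m)" "pois m"] has_real_derivative_pois_tail by blast
  have zb: "q * a \<le> z" "z \<le> 2 * (q * a)" "z \<ge> 0"
    using z q a mult_left_mono[of a s q] mult_left_mono[of t "2 * a" q] by (auto intro: order_trans[of 0 "q * s"])
  have "pois m z \<le> exp (- (q * a)) * (2 * (q * a)) ^ m / fact m"
    unfolding pois_def using zb by (intro divide_right_mono mult_mono power_mono) auto
  also have "\<dots> = 2 ^ m * pois m (q * a)" by (simp add: pois_def power_mult_distrib)
  finally have "(q * t - q * s) * pois m z \<le> (q * t - q * s) * (2 ^ m * pois m (q * a))"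
    using True by (intro mult_left_mono) auto
  also have "\<dots> = (t - s) / a * 2 ^ m * (q * a * pois m (q * a))" using a by (simp add: field_simps)
  also have "\<dots> = (t - s) / a * (real i * 2 ^ (i - 1)) * pois i (q * a)"
    by (simp add: m pois_Suc[symmetric] mult_ac del: of_nat_Suc)
  finally show ?thesis using z(3) by (simp add: m)
next
  case False
  then have "q * t \<le> q * s" by simp
  then have "pois_tail i (q * t) \<le> pois_tail i (q * s)" using q a by (intro pois_tail_mono) auto
  moreover have "0 \<le> (t - s) / a * (real i * 2 ^ (i - 1)) * pois i (q * a)"
    using q a by (intro mult_nonneg_nonneg divide_nonneg_pos pois_nonneg) auto
  ultimately show ?thesis by linarith
qed

definition tail_sum :: "(nat \<Rightarrow> real) \<Rightarrow> nat \<Rightarrow> real \<Rightarrow> real" where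
  "tail_sum p i t = (\<Sum>k. pois_tail i (p k * t))"

definition var_sum :: "(nat \<Rightarrow> real) \<Rightarrow> nat \<Rightarrow> real \<Rightarrow> real" where
  "var_sum p j t = (\<Sum>k. pois j (p k * t) * (1 - pois j (p k * t)))"

definition Kge :: "(nat \<Rightarrow> 'a \<Rightarrow> real) \<Rightarrow> (nat \<Rightarrow> 'a \<Rightarrow> nat) \<Rightarrow> nat \<Rightarrow> real \<Rightarrow> 'a \<Rightarrow> real" where
  "Kge S X i t \<omega> = real (card {k. i \<le> box_count S X k t \<omega>})"

lemma pois_tail_summable:
  assumes "\<And>k. p k \<ge> 0" "summable p" "t \<ge> 0" "j \<ge> 1"
  shows "summable (\<lambda>k. pois_tail j (p k * t))"
proof (rule summable_comparison_test')
  show "summable (\<lambda>k. p k * t)" using assms(2) by (rule summable_mult2)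
  show "norm (pois_tail j (p k * t)) \<le> p k * t" if "k \<ge> 0" for k
    using assms by (simp add: pois_tail_nonneg pois_tail_le_self)
qed

lemma tail_sum_increment:
  assumes p: "\<And>k. p k \<ge> 0" "summable p" and a: "0 < a" "a \<le> s" "s \<le> t" "t \<le> 2 * a" and i: "i \<ge> 1"
  shows "tail_sum p i s \<le> tail_sum p i t"
    and "tail_sum p i t - tail_sum p i s \<le> (t - s) / a * (real i * 2 ^ (i - 1)) * psum p i a"
proof -
  note sm = pois_tail_summable[of p, OF p _ i] pois_summable[of p, OF p _ i]
  show "tail_sum p i s \<le> tail_sum p i t"
    unfolding tail_sum_def using a p(1) by (intro suminf_le sm pois_tail_mono mult_left_mono) auto
  have "tail_sum p i t - tail_sum p i s = (\<Sum>k. pois_tail i (p k * t) - pois_tail i (p k * s))"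
    unfolding tail_sum_def using a by (intro suminf_diff sm) auto
  also have "\<dots> \<le> (\<Sum>k. (t - s) / a * (real i * 2 ^ (i - 1)) * pois i (p k * a))"
    using a p(1) i by (intro suminf_le pois_tail_increment summable_diff sm summable_mult) auto
  also have "\<dots> = (t - s) / a * (real i * 2 ^ (i - 1)) * psum p i a"
    unfolding psum_def using a by (intro suminf_mult sm) auto
  finally show "tail_sum p i t - tail_sum p i s \<le> (t - s) / a * (real i * 2 ^ (i - 1)) * psum p i a" .
qed

lemma psum_eq_tail_sum_diff:
  assumes p: "\<And>k. p k \<ge> 0" "summable p" and "t \<ge> 0" "j \<ge> 1"
  shows "psum p j t = tail_sum p j t - tail_sum p (Suc j) t"
proof -
  note sm = pois_tail_summable[of p t, OF assms(1-3)]
  have "tail_sum p j t - tail_sum p (Suc j) t = (\<Sum>k. pois_tail j (p k * t) - pois_tail (Suc j) (p k * t))"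
    unfolding tail_sum_def using assms(4) by (intro suminf_diff sm) auto
  then show ?thesis by (simp add: psum_def pois_tail_Suc)
qed

section \<open>Paths of the counts and the indicator families behind them\<close>

context poissonized_karlin_scheme
begin

lemma p_summable: "summable p"
  using p_sums by (rule sums_summable)

text \<open>One condition on the path under which the pathwise relations hold at all times
  simultaneously, so that no null set depends on \<open>t\<close>.\<close>

definition good :: "'a \<Rightarrow> bool" where
  "good \<omega> \<longleftrightarrow> (\<forall>t. finite {n. S n \<omega> \<le> t})"

lemma AE_good: "AE \<omega> in M. good \<omega>"
  using S_arrivals by eventually_elim (auto simp: good_def)

lemma good_mono:
  assumes "good \<omega>" "s \<le> t"
  shows "box_count S X k s \<omega> \<le> box_count S X k t \<omega>"
  unfolding box_count_def
proof (rule card_mono)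
  show "finite {n. S n \<omega> \<le> t \<and> X n \<omega> = k}"
    by (rule finite_subset[of _ "{n. S n \<omega> \<le> t}"]) (use assms in \<open>auto simp: good_def\<close>)
  show "{n. S n \<omega> \<le> s \<and> X n \<omega> = k} \<subseteq> {n. S n \<omega> \<le> t \<and> X n \<omega> = k}" using assms by auto
qed

lemma good_finite:
  assumes "good \<omega>" "i \<ge> 1"
  shows "finite {k. i \<le> box_count S X k t \<omega>}"
proof -
  have "{k. i \<le> box_count S X k t \<omega>} \<subseteq> (\<lambda>n. X n \<omega>) ` {n. S n \<omega> \<le> t}"
  proof
    fix k assume "k \<in> {k. i \<le> box_count S X k t \<omega>}"
    then have "card {n. S n \<omega> \<le> t \<and> X n \<omega> = k} \<noteq> 0" using assms(2) by (simp add: box_count_def)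
    then have "{n. S n \<omega> \<le> t \<and> X n \<omega> = k} \<noteq> {}" by (metis card.empty)
    then show "k \<in> (\<lambda>n. X n \<omega>) ` {n. S n \<omega> \<le> t}" by auto
  qed
  then show ?thesis using assms(1) by (auto simp: good_def intro: finite_subset)
qed

lemma good_Kge_mono:
  assumes "good \<omega>" "i \<ge> 1" "s \<le> t"
  shows "Kge S X i s \<omega> \<le> Kge S X i t \<omega>"
  unfolding Kge_def using good_mono[OF assms(1,3)] good_finite[OF assms(1,2)]
  by (intro of_nat_mono card_mono) (auto intro: order_trans)

lemma good_Kge_diff:
  assumes "good \<omega>" "i \<ge> 1" "s \<le> t"
  shows "Kge S X i t \<omega> - Kge S X i s \<omega> = real (card {k. box_count S X k s \<omega> < i \<and> i \<le> box_count S X k t \<omega>})"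
proof -
  let ?A = "{k. i \<le> box_count S X k s \<omega>}" and ?B = "{k. box_count S X k s \<omega> < i \<and> i \<le> box_count S X k t \<omega>}"
  have "{k. i \<le> box_count S X k t \<omega>} = ?A \<union> ?B" using good_mono[OF assms(1,3)] by (auto intro: order_trans)
  moreover have "finite ?A" "finite ?B" using good_finite[OF assms(1,2)]
    by (auto intro: finite_subset[of _ "{k. i \<le> box_count S X k t \<omega>}"])
  moreover have "?A \<inter> ?B = {}" by auto
  ultimately show ?thesis unfolding Kge_def by (simp add: card_Un_disjoint)
qed

lemma good_Kstar:
  assumes "good \<omega>" "j \<ge> 1"
  shows "Kstar S X j t \<omega> = Kge S X j t \<omega> - Kge S X (Suc j) t \<omega>"
proof -
  let ?A = "{k. box_count S X k t \<omega> = j}" and ?B = "{k. Suc j \<le> box_count S X k t \<omega>}"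
  have "{k. j \<le> box_count S X k t \<omega>} = ?A \<union> ?B" by auto
  moreover have "finite ?A" "finite ?B" using good_finite[OF assms] 
    by (auto intro: finite_subset[of _ "{k. j \<le> box_count S X k t \<omega>}"])
  moreover have "?A \<inter> ?B = {}" by auto
  ultimately show ?thesis unfolding Kge_def Kstar_def by (simp add: card_Un_disjoint)
qed

lemma Kge_measurable [measurable]: "Kge S X i t \<in> borel_measurable M"
  unfolding Kge_def[abs_def] by measurable

lemma Kstar_measurable [measurable]: "Kstar S X j t \<in> borel_measurable M"
  unfolding Kstar_def[abs_def] by measurable

lemma indep_box_pred:
  assumes "0 < s" "s < t"
  shows "indep_vars (\<lambda>_. count_space UNIV) (\<lambda>k \<omega>. Q k (box_count S X k s \<omega>, box_count S X k t \<omega>)) UNIV"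
  by (rule indep_vars_compose2[OF box_counts_indep[OF assms]]) auto

lemma box_count_prob:
  assumes "0 < t"
  shows "prob {\<omega> \<in> space M. box_count S X k t \<omega> = j} = pois j (p k * t)"
  using box_count_law[OF assms] by (simp add: pois_def)

lemma box_count_tail_prob:
  assumes "0 < t"
  shows "prob {\<omega> \<in> space M. i \<le> box_count S X k t \<omega>} = pois_tail i (p k * t)"
proof -
  have "prob {\<omega> \<in> space M. box_count S X k t \<omega> < i} = prob (\<Union>l<i. {\<omega> \<in> space M. box_count S X k t \<omega> = l})"
    by (intro arg_cong[where f=prob]) auto
  also have "\<dots> = (\<Sum>l<i. prob {\<omega> \<in> space M. box_count S X k t \<omega> = l})"
    by (intro finite_measure_finite_Union) (auto simp: disjoint_family_on_def)
  also have "\<dots> = (\<Sum>l<i. pois l (p k * t))" by (simp add: box_count_prob[OF assms])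
  finally have "prob {\<omega> \<in> space M. box_count S X k t \<omega> < i} = (\<Sum>l<i. pois l (p k * t))" .
  moreover have "prob {\<omega> \<in> space M. \<not> box_count S X k t \<omega> < i} = 1 - prob {\<omega> \<in> space M. box_count S X k t \<omega> < i}"
    by (rule prob_neg) measurable
  ultimately show ?thesis by (simp add: pois_tail_def not_less)
qed

lemma exact_family:
  assumes t: "0 < t" and j: "j \<ge> 1"
  shows "bernoulli_family M (\<lambda>k \<omega>. k \<in> I \<and> box_count S X k t \<omega> = j)"
    and "bernoulli_family.bprob M (\<lambda>k \<omega>. k \<in> I \<and> box_count S X k t \<omega> = j) k = (if k \<in> I then pois j (p k * t) else 0)"
proof -
  have pr: "prob {\<omega> \<in> space M. k \<in> I \<and> box_count S X k t \<omega> = j} = (if k \<in> I then pois j (p k * t) else 0)" for k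
    using box_count_prob[OF t, of k j] by simp
  have sm: "summable (\<lambda>k. if k \<in> I then pois j (p k * t) else 0)"
    by (rule summable_comparison_test'[OF pois_summable[of p t j, OF p_nonneg p_summable _ j], of 0])
       (use t p_nonneg in \<open>auto simp: pois_nonneg\<close>)
  show bf: "bernoulli_family M (\<lambda>k \<omega>. k \<in> I \<and> box_count S X k t \<omega> = j)"
  proof (intro bernoulli_family.intro prob_space_axioms bernoulli_family_axioms.intro)
    show "indep_vars (\<lambda>_. count_space UNIV) (\<lambda>k \<omega>. k \<in> I \<and> box_count S X k t \<omega> = j) UNIV"
      \<comment> \<open>Independence is available for pairs of times; \<open>t + 1\<close> is a
        dummy second time.\<close>
      using indep_box_pred[of t "t + 1" "\<lambda>k z. k \<in> I \<and> fst z = j"] t by simp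
  qed (simp only: pr sm)
  show "bernoulli_family.bprob M (\<lambda>k \<omega>. k \<in> I \<and> box_count S X k t \<omega> = j) k = (if k \<in> I then pois j (p k * t) else 0)"
    unfolding bernoulli_family.bprob_def[OF bf] by (rule pr)
qed

text \<open>A box contributes to the increment of \<open>Kge\<close> exactly when its count crosses
  the level \<open>i\<close>. Only the mean is computed, as it dominates the variance.\<close>

lemma increment_family:
  assumes st: "0 < s" "s < t" and i: "i \<ge> 1"
  shows "bernoulli_family M (\<lambda>k \<omega>. box_count S X k s \<omega> < i \<and> i \<le> box_count S X k t \<omega>)"
    and "bernoulli_family.bmean M (\<lambda>k \<omega>. box_count S X k s \<omega> < i \<and> i \<le> box_count S X k t \<omega>) = tail_sum p i t - tail_sum p i s"
proof -
  have pr: "prob {\<omega> \<in> space M. box_count S X k s \<omega> < i \<and> i \<le> box_count S X k t \<omega>} = pois_tail i (p k * t) - pois_tail i (p k * s)" for k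
  proof -
    have "prob {\<omega> \<in> space M. box_count S X k s \<omega> < i \<and> i \<le> box_count S X k t \<omega>} =
       prob ({\<omega> \<in> space M. i \<le> box_count S X k t \<omega>} - {\<omega> \<in> space M. i \<le> box_count S X k t \<omega> \<and> i \<le> box_count S X k s \<omega>})"
      by (intro arg_cong[where f=prob]) auto
    also have "\<dots> = prob {\<omega> \<in> space M. i \<le> box_count S X k t \<omega>} - prob {\<omega> \<in> space M. i \<le> box_count S X k t \<omega> \<and> i \<le> box_count S X k s \<omega>}"
      by (intro finite_measure_Diff) auto
    also have "prob {\<omega> \<in> space M. i \<le> box_count S X k t \<omega> \<and> i \<le> box_count S X k s \<omega>} = prob {\<omega> \<in> space M. i \<le> box_count S X k s \<omega>}"
    proof (intro finite_measure_eq_AE)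
      show "AE \<omega> in M. (\<omega> \<in> {\<omega> \<in> space M. i \<le> box_count S X k t \<omega> \<and> i \<le> box_count S X k s \<omega>}) = (\<omega> \<in> {\<omega> \<in> space M. i \<le> box_count S X k s \<omega>})"
        using AE_good by eventually_elim (use good_mono[of _ s t k] st in \<open>auto intro: order_trans\<close>)
    qed measurable
    finally show ?thesis using st by (simp add: box_count_tail_prob)
  qed
  note sm = pois_tail_summable[of p, OF p_nonneg p_summable _ i]
  show bf: "bernoulli_family M (\<lambda>k \<omega>. box_count S X k s \<omega> < i \<and> i \<le> box_count S X k t \<omega>)"
  proof (intro bernoulli_family.intro prob_space_axioms bernoulli_family_axioms.intro)
    show "indep_vars (\<lambda>_. count_space UNIV) (\<lambda>k \<omega>. box_count S X k s \<omega> < i \<and> i \<le> box_count S X k t \<omega>) UNIV"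
      using indep_box_pred[OF st, of "\<lambda>k z. fst z < i \<and> i \<le> snd z"] by simp
    show "summable (\<lambda>k. prob {\<omega> \<in> space M. box_count S X k s \<omega> < i \<and> i \<le> box_count S X k t \<omega>})"
      unfolding pr using st by (intro summable_diff sm) auto
  qed
  show "bernoulli_family.bmean M (\<lambda>k \<omega>. box_count S X k s \<omega> < i \<and> i \<le> box_count S X k t \<omega>) = tail_sum p i t - tail_sum p i s"
    unfolding bernoulli_family.bmean_def[OF bf] bernoulli_family.bprob_def[OF bf] pr tail_sum_def using st
    by (intro suminf_diff[symmetric] sm) auto
qed

lemma Kstar_moments:
  assumes t: "0 < t" and j: "j \<ge> 1"
  shows "expectation (Kstar S X j t) = psum p j t" and "variance (Kstar S X j t) = var_sum p j t"
proof -
  interpret bf: bernoulli_family M "\<lambda>k \<omega>. k \<in> UNIV \<and> box_count S X k t \<omega> = j" by (rule exact_family[OF t j])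
  have bp: "bf.bprob k = pois j (p k * t)" for k using exact_family(2)[OF t j, of UNIV k] by simp
  have eq: "bf.btotal = Kstar S X j t" unfolding bf.btotal_def[abs_def] Kstar_def[abs_def] by simp
  show "expectation (Kstar S X j t) = psum p j t"
    using bf.expectation_btotal unfolding eq bf.bmean_def bp psum_def .
  show "variance (Kstar S X j t) = var_sum p j t"
    using bf.variance_btotal unfolding eq bf.bvar_def bp var_sum_def .
qed

text \<open>Keeps the exact variance, because the bound on the skeleton needs the sharp constant in
  the exponent.\<close>

lemma Kstar_chernoff:
  assumes t: "0 < t" and j: "j \<ge> 1" and u: "0 < u" "u \<le> 1"
  shows "prob {\<omega> \<in> space M. \<bar>Kstar S X j t \<omega> - psum p j t\<bar> \<ge> x} \<le> 2 * exp (- u * x + var_sum p j t * (u\<^sup>2 / 2 * (1 + u)))"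
proof -
  interpret bf: bernoulli_family M "\<lambda>k \<omega>. k \<in> UNIV \<and> box_count S X k t \<omega> = j" by (rule exact_family[OF t j])
  have bp: "bf.bprob k = pois j (p k * t)" for k using exact_family(2)[OF t j, of UNIV k] by simp
  have eq: "bf.btotal = Kstar S X j t" unfolding bf.btotal_def[abs_def] Kstar_def[abs_def] by simp
  have m: "bf.bmean = psum p j t" "bf.bvar = var_sum p j t" unfolding bf.bmean_def bf.bvar_def bp psum_def var_sum_def by auto
  show ?thesis using bf.chernoff[OF u order_refl, of x] unfolding m eq .
qed

definition cdev :: "nat \<Rightarrow> real \<Rightarrow> 'a \<Rightarrow> real" where
  "cdev i t \<omega> = Kge S X i t \<omega> - tail_sum p i t"

lemma cdev_measurable [measurable]: "cdev i t \<in> borel_measurable M"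
  unfolding cdev_def[abs_def] by measurable

lemma Kstar_cdev:
  assumes "good \<omega>" "0 < t" "j \<ge> 1"
  shows "Kstar S X j t \<omega> - psum p j t = cdev j t \<omega> - cdev (Suc j) t \<omega>"
  using assms psum_eq_tail_sum_diff[of p t j, OF p_nonneg p_summable] by (simp add: good_Kstar cdev_def)

text \<open>A bound on the mean replaces the variance, and \<open>u\<^sup>2\<close> replaces
  \<open>u\<^sup>2 / 2 * (1 + u)\<close>. Oscillations only have to be a small multiple of the
  target, so a sharp constant would bring nothing.\<close>

lemma increment_chernoff:
  assumes st: "0 < s" "s \<le> t" and i: "i \<ge> 1" and u: "0 < u" "u \<le> 1" and V: "tail_sum p i t - tail_sum p i s \<le> V" and x: "x > 0"
  shows "prob {\<omega> \<in> space M. \<bar>cdev i t \<omega> - cdev i s \<omega>\<bar> \<ge> x} \<le> 2 * exp (- u * x + u\<^sup>2 * V)"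
proof (cases "s < t")
  case True
  interpret bf: bernoulli_family M "\<lambda>k \<omega>. box_count S X k s \<omega> < i \<and> i \<le> box_count S X k t \<omega>" by (rule increment_family[OF st(1) True i])
  have m: "bf.bmean = tail_sum p i t - tail_sum p i s" by (rule increment_family(2)[OF st(1) True i])
  have "prob {\<omega> \<in> space M. \<bar>cdev i t \<omega> - cdev i s \<omega>\<bar> \<ge> x} = prob {\<omega> \<in> space M. \<bar>bf.btotal \<omega> - bf.bmean\<bar> \<ge> x}"
  proof (intro finite_measure_eq_AE)
    show "AE \<omega> in M. (\<omega> \<in> {\<omega> \<in> space M. \<bar>cdev i t \<omega> - cdev i s \<omega>\<bar> \<ge> x}) = (\<omega> \<in> {\<omega> \<in> space M. \<bar>bf.btotal \<omega> - bf.bmean\<bar> \<ge> x})"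
      using AE_good
    proof eventually_elim
      case (elim \<omega>)
      have "cdev i t \<omega> - cdev i s \<omega> = bf.btotal \<omega> - bf.bmean"
        using good_Kge_diff[OF elim i st(2)] unfolding m cdev_def bf.btotal_def by linarith
      then show ?case by simp
    qed
  qed measurable
  also have "\<dots> \<le> 2 * exp (- u * x + V * (u\<^sup>2 / 2 * (1 + u)))"
    using V bf.bvar_le_bmean m by (intro bf.chernoff u) auto
  also have "\<dots> \<le> 2 * exp (- u * x + u\<^sup>2 * V)"
  proof -
    have "V \<ge> 0" using bf.bvar_nonneg bf.bvar_le_bmean m V by linarith
    then have "V * (u\<^sup>2 / 2 * (1 + u)) \<le> V * (u\<^sup>2 / 2 * 2)" using u by (intro mult_left_mono) auto
    then show ?thesis by (simp add: mult_ac)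
  qed
  finally show ?thesis .
next
  case False
  \<comment> \<open>For \<open>s = t\<close> the increment is 0 and \<open>x > 0\<close> makes the
    event empty. Chaining produces such trivial pairs at the left ends of cells.\<close>
  then have "{\<omega> \<in> space M. \<bar>cdev i t \<omega> - cdev i s \<omega>\<bar> \<ge> x} = {}" using st x by auto
  then have "prob {\<omega> \<in> space M. \<bar>cdev i t \<omega> - cdev i s \<omega>\<bar> \<ge> x} = 0" by (simp only: measure_empty)
  then show ?thesis by simp
qed

end

section \<open>Oscillation between skeleton points\<close>

context poissonized_karlin_scheme
begin

text \<open>Monotonicity trades a supremum over a subinterval for the increment between its ends, at
  the price of the increment of the mean.\<close>

lemma cdev_sandwich:
  assumes "good \<omega>" "i \<ge> 1" "0 < c" "c \<le> t" "t \<le> c'" "c' \<le> 2 * c"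
  shows "\<bar>cdev i t \<omega> - cdev i c \<omega>\<bar> \<le> \<bar>cdev i c' \<omega> - cdev i c \<omega>\<bar> + (tail_sum p i c' - tail_sum p i c)"
proof -
  have "Kge S X i c \<omega> \<le> Kge S X i t \<omega>" "Kge S X i t \<omega> \<le> Kge S X i c' \<omega>"
    using assms by (auto intro: good_Kge_mono)
  moreover have "tail_sum p i c \<le> tail_sum p i t"
    by (rule tail_sum_increment(1)[of p c, OF p_nonneg p_summable]) (use assms in auto)
  moreover have "tail_sum p i t \<le> tail_sum p i c'"
    by (rule tail_sum_increment(1)[of p c, OF p_nonneg p_summable]) (use assms in auto)
  ultimately show ?thesis unfolding cdev_def by linarith
qed

text \<open>Two-scale chaining: \<open>N\<close> cells of \<open>[a, a (1 + D)]\<close> are each divided into \<open>m\<close> subcells, and within a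
  subcell the monotonicity of \<open>Kge\<close> bounds the oscillation. The Gaussian regime of the coarse
  increments governs the probability; the cells are so short that a union over many subcells is harmless.\<close>

lemma cdev_oscillation:
  fixes N m :: nat
  assumes i: "i \<ge> 1" and a: "a > 0" and D: "0 < D" "D \<le> 1" and N: "N > 0" "m > 0"
    and e: "psum p i a \<le> e"
    and C: "C = real i * 2 ^ (i - 1)"
    and u1: "0 < u1" "u1 \<le> 1" and u2: "0 < u2" "u2 \<le> 1" and x: "x > 0" and fine: "D * C * e / (real N * real m) \<le> x"
  shows "\<exists>Bad\<in>events. prob Bad \<le> 2 * real N * exp (- u1 * x + u1\<^sup>2 * (D * C * e)) +
      4 * (real N * real m) * exp (- u2 * x + u2\<^sup>2 * (D * C * e / real N)) \<and>
    (\<forall>\<omega>\<in>space M - Bad. good \<omega> \<longrightarrow> (\<forall>t\<in>{a..a * (1 + D)}. \<bar>cdev i t \<omega> - cdev i a \<omega>\<bar> \<le> 4 * x))"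
proof -
  define h where "h = D * a / (real N * real m)"
  define c where "c q = a + real q * h" for q :: nat
  have h: "h > 0" using a D N by (simp add: h_def)
  have hm: "h * real m = D * a / real N" "h * (real N * real m) = D * a" using N by (simp_all add: h_def)
  have cN: "c (N * m) = a * (1 + D)" using hm by (simp add: c_def algebra_simps)
  have c_mono: "c q \<le> c r" if "q \<le> r" for q r using that h by (simp add: c_def)
  have c_ge: "a \<le> c q" for q using h by (simp add: c_def)
  have c_le: "c q \<le> a * (1 + D)" if "q \<le> N * m" for q using c_mono[OF that] cN by simp
  have aD: "a * (1 + D) \<le> 2 * a" using a D by (simp add: algebra_simps)
  have C0: "C \<ge> 0" by (simp add: C)
  have e0: "e \<ge> 0"
  proof -
    have "psum p i a \<ge> 0" unfolding psum_def using a p_nonneg i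
      by (intro suminf_nonneg pois_summable p_summable) (auto simp: pois_nonneg)
    then show ?thesis using e by linarith
  qed
  have inc: "tail_sum p i t - tail_sum p i s \<le> (t - s) / a * (C * e)" if "a \<le> s" "s \<le> t" "t \<le> a * (1 + D)" for s t
  proof -
    have "tail_sum p i t - tail_sum p i s \<le> (t - s) / a * (real i * 2 ^ (i - 1)) * psum p i a"
      using order_trans[OF that(3) aD] that a i by (intro tail_sum_increment(2)[of p a, OF p_nonneg p_summable]) auto
    also have "\<dots> \<le> (t - s) / a * (real i * 2 ^ (i - 1)) * e"
      using that a e by (intro mult_left_mono mult_nonneg_nonneg) auto
    finally show ?thesis by (simp add: C mult_ac)
  qed
  have V1: "tail_sum p i t - tail_sum p i s \<le> D * C * e" if "a \<le> s" "s \<le> t" "t \<le> a * (1 + D)" for s t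
  proof -
    have "(t - s) / a \<le> D" using that a by (simp add: field_simps)
    then have "(t - s) / a * (C * e) \<le> D * (C * e)" using C0 e0 by (intro mult_right_mono) auto
    then show ?thesis using inc[OF that] by simp
  qed
  have V2: "tail_sum p i t - tail_sum p i s \<le> D * C * e / real N" if "a \<le> s" "s \<le> t" "t \<le> a * (1 + D)" "t - s \<le> h * real m" for s t
  proof -
    have "(t - s) / a \<le> D / real N" using that(4) a N unfolding hm by (simp add: field_simps)
    then have "(t - s) / a * (C * e) \<le> D / real N * (C * e)" using C0 e0 by (intro mult_right_mono) auto
    then show ?thesis using inc[OF that(1-3)] by simp
  qed
  define E where "E s t = {\<omega> \<in> space M. \<bar>cdev i t \<omega> - cdev i s \<omega>\<bar> \<ge> x}" for s t
  have [measurable]: "E s t \<in> events" for s t unfolding E_def by measurable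
  \<comment> \<open>The left end of the coarse cell containing subcell \<open>q\<close>, through
    which chaining from \<open>a\<close> passes: \<open>B1\<close> controls the coarse increments,
    \<open>B2\<close> those inside a coarse cell, \<open>B3\<close> those over one subcell.\<close>
  define cell where "cell q = q div m * m" for q
  define B1 where "B1 = (\<Union>q<N. E a (c (q * m)))"
  define B2 where "B2 = (\<Union>q<N * m. E (c (cell q)) (c q))"
  define B3 where "B3 = (\<Union>q<N * m. E (c q) (c (Suc q)))"
  have [measurable]: "B1 \<in> events" "B2 \<in> events" "B3 \<in> events" unfolding B1_def B2_def B3_def by measurable
  have cell: "cell q \<le> q" "c q - c (cell q) \<le> h * real m" "c (Suc q) - c q \<le> h * real m" for q
  proof -
    show le: "cell q \<le> q" by (simp add: cell_def)
    have "q - cell q = q mod m" by (simp add: cell_def minus_div_mult_eq_mod)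
    then have "real q - real (cell q) = real (q mod m)" using le by (metis of_nat_diff)
    also have "\<dots> \<le> real m" using N by (simp add: less_imp_le)
    finally have "(real q - real (cell q)) * h \<le> real m * h" using h by (intro mult_right_mono) auto
    then show "c q - c (cell q) \<le> h * real m" by (simp add: c_def algebra_simps)
    have "1 * h \<le> real m * h" using h N by (intro mult_right_mono) auto
    then show "c (Suc q) - c q \<le> h * real m" by (simp add: c_def algebra_simps)
  qed
  have p1: "prob B1 \<le> real N * (2 * exp (- u1 * x + u1\<^sup>2 * (D * C * e)))"
  proof -
    have "prob B1 \<le> (\<Sum>q<N. prob (E a (c (q * m))))" unfolding B1_def by (intro measure_UNION_le) auto
    also have "\<dots> \<le> (\<Sum>q<N. 2 * exp (- u1 * x + u1\<^sup>2 * (D * C * e)))"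
      unfolding E_def by (intro sum_mono increment_chernoff i u1 x V1) (use a c_ge in \<open>auto intro!: c_le\<close>)
    finally show ?thesis by simp
  qed
  have p2: "prob B2 \<le> real (N * m) * (2 * exp (- u2 * x + u2\<^sup>2 * (D * C * e / real N)))"
  proof -
    have "prob B2 \<le> (\<Sum>q<N * m. prob (E (c (cell q)) (c q)))" unfolding B2_def by (intro measure_UNION_le) auto
    also have "\<dots> \<le> (\<Sum>q<N * m. 2 * exp (- u2 * x + u2\<^sup>2 * (D * C * e / real N)))"
      unfolding E_def by (intro sum_mono increment_chernoff i u2 x V2)
        (use a c_ge cell in \<open>auto intro!: c_le c_mono intro: less_le_trans\<close>)
    finally show ?thesis by simp
  qed
  have p3: "prob B3 \<le> real (N * m) * (2 * exp (- u2 * x + u2\<^sup>2 * (D * C * e / real N)))"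
  proof -
    have "prob B3 \<le> (\<Sum>q<N * m. prob (E (c q) (c (Suc q))))" unfolding B3_def by (intro measure_UNION_le) auto
    also have "\<dots> \<le> (\<Sum>q<N * m. 2 * exp (- u2 * x + u2\<^sup>2 * (D * C * e / real N)))"
      unfolding E_def by (intro sum_mono increment_chernoff i u2 x V2)
        (use a c_ge cell in \<open>auto intro!: c_le c_mono intro: less_le_trans\<close>)
    finally show ?thesis by simp
  qed
  have "prob (B1 \<union> B2 \<union> B3) \<le> prob B1 + prob B2 + prob B3"
    using measure_Un_le[of "B1 \<union> B2" M B3] measure_Un_le[of B1 M B2] by simp
  then have pr: "prob (B1 \<union> B2 \<union> B3) \<le> 2 * real N * exp (- u1 * x + u1\<^sup>2 * (D * C * e)) +
      4 * (real N * real m) * exp (- u2 * x + u2\<^sup>2 * (D * C * e / real N))"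
    using p1 p2 p3 by simp
  have osc: "\<bar>cdev i t \<omega> - cdev i a \<omega>\<bar> \<le> 4 * x" if \<omega>: "\<omega> \<in> space M - (B1 \<union> B2 \<union> B3)" "good \<omega>" and t: "t \<in> {a..a * (1 + D)}" for \<omega> t
  proof -
    define r where "r = nat \<lfloor>(t - a) / h\<rfloor>"
    \<comment> \<open>Without the cap the right end \<open>t = a * (1 + D)\<close> would fall into a
      subcell beyond the last one.\<close>
    define q where "q = min r (N * m - 1)"
    have "N * m > 0" using N by simp
    then have q: "q < N * m" unfolding q_def by linarith
    have "real r \<le> (t - a) / h" "(t - a) / h < real r + 1" using t h by (auto simp: r_def)
    then have r: "c r \<le> t" "t \<le> c (Suc r)" using h by (auto simp: c_def field_simps)
    have ct: "c q \<le> t \<and> t \<le> c (Suc q)"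
    proof (cases "r < N * m")
      case True
      then have "q = r" by (simp add: q_def)
      then show ?thesis using r by simp
    next
      case False
      then have "q \<le> r" "Suc q = N * m" using q by (auto simp: q_def)
      then show ?thesis using c_mono[of q r] r(1) t cN by auto
    qed
    have cell_q: "cell q = (q div m) * m" "q div m < N" using q N by (auto simp: cell_def less_mult_imp_div_less)
    have 1: "\<bar>cdev i (c (cell q)) \<omega> - cdev i a \<omega>\<bar> \<le> x"
    proof -
      have "\<omega> \<notin> E a (c (q div m * m))" using \<omega>(1) cell_q(2) unfolding B1_def by blast
      then show ?thesis using \<omega>(1) unfolding E_def cell_q(1) by auto
    qed
    have 2: "\<bar>cdev i (c q) \<omega> - cdev i (c (cell q)) \<omega>\<bar> \<le> x"
    proof -
      have "\<omega> \<notin> E (c (cell q)) (c q)" using \<omega>(1) q unfolding B2_def by blast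
      then show ?thesis using \<omega>(1) unfolding E_def by auto
    qed
    have 3: "\<bar>cdev i (c (Suc q)) \<omega> - cdev i (c q) \<omega>\<bar> \<le> x"
    proof -
      have "\<omega> \<notin> E (c q) (c (Suc q))" using \<omega>(1) q unfolding B3_def by blast
      then show ?thesis using \<omega>(1) unfolding E_def by auto
    qed
    have cS: "c (Suc q) \<le> a * (1 + D)" using q by (intro c_le) auto
    have "\<bar>cdev i t \<omega> - cdev i (c q) \<omega>\<bar> \<le> \<bar>cdev i (c (Suc q)) \<omega> - cdev i (c q) \<omega>\<bar> + (tail_sum p i (c (Suc q)) - tail_sum p i (c q))"
    proof (intro cdev_sandwich)
      show "c (Suc q) \<le> 2 * c q" using cS aD c_ge[of q] by linarith
    qed (use ct a c_ge[of q] \<omega>(2) i in auto)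
    moreover have "tail_sum p i (c (Suc q)) - tail_sum p i (c q) \<le> x"
    proof -
      have "tail_sum p i (c (Suc q)) - tail_sum p i (c q) \<le> (c (Suc q) - c q) / a * (C * e)"
        by (rule inc) (use c_ge cS c_mono[of q "Suc q"] in auto)
      also have "(c (Suc q) - c q) / a = D / (real N * real m)"
      proof -
        have "c (Suc q) - c q = h" by (simp add: c_def algebra_simps)
        then show ?thesis using a by (simp add: h_def)
      qed
      also have "D / (real N * real m) * (C * e) \<le> x" using fine by simp
      finally show ?thesis .
    qed
    \<comment> \<open>The four units of \<open>x\<close> are the coarse increment, the step inside
      the coarse cell, the increment over the subcell and the increment of the mean over it.\<close>
    ultimately show ?thesis using 1 2 3 by linarith
  qed
  show ?thesis
    by (rule bexI[of _ "B1 \<union> B2 \<union> B3"]) (use pr osc in auto)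
qed

end

text \<open>Unites the two growth regimes: the fluctuation bounds need no more of them than
  \<open>L_lower\<close>.\<close>

locale karlin_lil = poissonized_karlin_scheme M p S X + karlin_regular p L
  for M :: "'a measure" and p :: "nat \<Rightarrow> real" and S :: "nat \<Rightarrow> 'a \<Rightarrow> real" and X :: "nat \<Rightarrow> 'a \<Rightarrow> nat"
    and L :: "real \<Rightarrow> real" +
  fixes \<kappa> :: real
  assumes \<kappa>_pos: "\<kappa> > 0" and L_lower: "eventually (\<lambda>t. L t \<ge> ln t powr \<kappa>) at_top"
begin

lemma exp_seq_at_top:
  assumes "\<delta> > 0" shows "filterlim (\<lambda>n. exp (\<delta> * real n)) at_top sequentially"
  using assms by real_asymp

lemma eventually_psum_le:
  assumes "i \<ge> 1" shows "eventually (\<lambda>t. psum p i t \<le> 2 * L t) at_top"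
proof -
  have "1 / real i < 2" using assms by (simp add: field_simps)
  then have "eventually (\<lambda>t. psum p i t / L t < 2) at_top" using psum_lim[OF assms] by (intro order_tendstoD)
  then show ?thesis using L_pos_eventually by eventually_elim (simp add: divide_less_eq)
qed

lemma eventually_L_ge:
  assumes "\<delta> > 0" shows "eventually (\<lambda>n. L (exp (\<delta> * real n)) \<ge> c) sequentially"
  using eventually_compose_filterlim[OF L_top[THEN filterlim_at_top[THEN iffD1], rule_format, of c] exp_seq_at_top[OF assms]] .

text \<open>At skeleton times \<open>ln t powr \<kappa>\<close> is a power of \<open>n\<close> and
  beats \<open>ln (real n)\<close>. This keeps the tilts below any prescribed bound.\<close>

lemma eventually_ln_le_sqrt_L:
  assumes "\<delta> > 0" "\<eta> > 0"
  shows "eventually (\<lambda>n. ln (real n) \<le> \<eta> * sqrt (L (exp (\<delta> * real n)))) sequentially"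
proof -
  have "eventually (\<lambda>n. L (exp (\<delta> * real n)) \<ge> ln (exp (\<delta> * real n)) powr \<kappa>) sequentially"
    by (rule eventually_compose_filterlim[OF L_lower exp_seq_at_top[OF assms(1)]])
  moreover have "eventually (\<lambda>n::nat. ln (real n) \<le> \<eta> * (\<delta> * real n) powr (\<kappa> / 2)) sequentially"
    using assms \<kappa>_pos by real_asymp
  ultimately show ?thesis using eventually_gt_at_top[of 0]
  proof eventually_elim
    case (elim n)
    have pos: "\<delta> * real n > 0" using elim assms by simp
    have "(\<delta> * real n) powr (\<kappa> / 2) = sqrt ((\<delta> * real n) powr \<kappa>)"
      using pos by (simp add: powr_half_sqrt[symmetric] powr_powr)
    also have "\<dots> \<le> sqrt (L (exp (\<delta> * real n)))" using elim by simp
    finally have "\<eta> * (\<delta> * real n) powr (\<kappa> / 2) \<le> \<eta> * sqrt (L (exp (\<delta> * real n)))"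
      using assms by (intro mult_left_mono) auto
    then show ?case using elim by linarith
  qed
qed

text \<open>By slow variation the ratio of consecutive values of \<open>L\<close> on the skeleton is
  eventually below any \<open>exp \<eta>\<close>. The number of subcells is proportional to
  \<open>sqrt (L t)\<close> and must not outweigh tails that are exponential in
  \<open>n\<close>.\<close>

lemma eventually_sqrt_L_le_exp:
  assumes \<delta>: "\<delta> > 0" and \<eta>: "\<eta> > 0"
  shows "eventually (\<lambda>n. sqrt (L (exp (\<delta> * real n))) \<le> exp (\<eta> * real n)) sequentially"
proof -
  define l where "l n = L (exp (\<delta> * real n))" for n
  have "eventually (\<lambda>t. L (exp \<delta> * t) / L t < exp \<eta>) at_top"
    using \<eta> by (intro order_tendstoD(2)[OF L_slow]) auto
  from eventually_compose_filterlim[OF this exp_seq_at_top[OF \<delta>]]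
  have "eventually (\<lambda>n. l (Suc n) \<le> exp \<eta> * l n) sequentially"
    using eventually_L_ge[OF \<delta>, of 1]
    by eventually_elim (auto simp: l_def exp_add[symmetric] field_simps divide_less_eq)
  then obtain n0 where n0: "\<And>n. n \<ge> n0 \<Longrightarrow> l (Suc n) \<le> exp \<eta> * l n" by (auto simp: eventually_sequentially)
  have ind: "l (n0 + k) \<le> exp (\<eta> * real k) * l n0" for k
  proof (induction k)
    case (Suc k)
    have "l (n0 + Suc k) \<le> exp \<eta> * l (n0 + k)" using n0[of "n0 + k"] by simp
    also have "\<dots> \<le> exp \<eta> * (exp (\<eta> * real k) * l n0)" using Suc by (intro mult_left_mono) auto
    finally show ?case by (simp add: exp_add algebra_simps)
  qed simp
  have "eventually (\<lambda>n. exp (\<eta> * real n) * \<bar>l n0\<bar> \<le> exp (2 * \<eta> * real n)) sequentially"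
    using \<eta> by real_asymp
  then have "eventually (\<lambda>n. l n \<le> (exp (\<eta> * real n))\<^sup>2) sequentially"
    using eventually_ge_at_top[of n0]
  proof eventually_elim
    case (elim n)
    have "l n \<le> exp (\<eta> * real (n - n0)) * l n0" using ind[of "n - n0"] elim by simp
    also have "\<dots> \<le> exp (\<eta> * real (n - n0)) * \<bar>l n0\<bar>" by (intro mult_left_mono) auto
    also have "\<dots> \<le> exp (\<eta> * real n) * \<bar>l n0\<bar>" using \<eta> by (intro mult_right_mono) auto
    also have "\<dots> \<le> exp (2 * \<eta> * real n)" by fact
    also have "\<dots> = (exp (\<eta> * real n))\<^sup>2" by (simp add: exp_double[symmetric])
    finally show ?case .
  qed
  then show ?thesis by eventually_elim (auto simp: l_def intro!: real_le_lsqrt)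
qed

lemma cdev_oscillation_AE:
  assumes i: "i \<ge> 1" and \<epsilon>: "\<epsilon> > 0" and \<delta>: "\<delta> > 0" "exp \<delta> \<le> 2"
    and small: "32 * (real i * 2 ^ (i - 1)) * (exp \<delta> - 1) \<le> \<epsilon>\<^sup>2"
  shows "AE \<omega> in M. eventually (\<lambda>n. \<forall>t\<in>{exp (\<delta> * real n)..exp (\<delta> * real (Suc n))}.
     \<bar>cdev i t \<omega> - cdev i (exp (\<delta> * real n)) \<omega>\<bar> \<le> 4 * (\<epsilon> * sqrt (L (exp (\<delta> * real n)) * ln (real n)))) sequentially"
proof -
  define a where "a n = exp (\<delta> * real n)" for n
  define D where "D = exp \<delta> - 1"
  define C where "C = real i * 2 ^ (i - 1)"
  define R where "R n = sqrt (L (a n))" for n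
  define x where "x n = \<epsilon> * sqrt (L (a n) * ln (real n))" for n
  define b where "b n = (2 + 8 * exp (2 * D * C) * (2 / \<epsilon> + 1)) * (1 / real n ^ 2)" for n
  have D: "0 < D" "D \<le> 1" using \<delta> by (auto simp: D_def)
  have C: "C > 0" using i by (simp add: C_def)
  have sm: "32 * C * D \<le> \<epsilon>\<^sup>2" using small by (simp add: C_def D_def)
  have ev1: "eventually (\<lambda>n. psum p i (a n) \<le> 2 * L (a n)) sequentially"
    unfolding a_def by (rule eventually_compose_filterlim[OF eventually_psum_le[OF i] exp_seq_at_top[OF \<delta>(1)]])
  have ev2: "eventually (\<lambda>n. L (a n) \<ge> 1) sequentially" unfolding a_def by (rule eventually_L_ge[OF \<delta>(1)])
  have ev3: "eventually (\<lambda>n. ln (real n) \<le> (4 * D * C / \<epsilon>) * R n) sequentially"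
    "eventually (\<lambda>n. ln (real n) \<le> (\<epsilon> / 8) * R n) sequentially"
    unfolding a_def R_def using D C \<epsilon> by (intro eventually_ln_le_sqrt_L[OF \<delta>(1)]; simp)+
  have ev4: "eventually (\<lambda>n. R n \<le> exp (\<epsilon> / 2 * real n)) sequentially"
    unfolding a_def R_def using \<epsilon> by (intro eventually_sqrt_L_le_exp[OF \<delta>(1)]) auto
  have ev5: "eventually (\<lambda>n::nat. real n ^ 4 \<le> exp (\<epsilon> / 2 * real n)) sequentially" using \<epsilon> by real_asymp
  have ev6: "eventually (\<lambda>n::nat. 2 * D * C / real n ^ 2 \<le> \<epsilon>) sequentially" using \<epsilon> by real_asymp
  have ev7: "eventually (\<lambda>n::nat. ln (real n) \<ge> 1) sequentially" by real_asymp
  have "eventually (\<lambda>n. \<exists>Bad\<in>events. prob Bad \<le> b n \<and>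
     (\<forall>\<omega>\<in>space M - Bad. good \<omega> \<longrightarrow> (\<forall>t\<in>{a n..a (Suc n)}. \<bar>cdev i t \<omega> - cdev i (a n) \<omega>\<bar> \<le> 4 * x n))) sequentially"
    using ev1 ev2 ev3 ev4 ev5 ev6 ev7 eventually_ge_at_top[of 1]
  proof eventually_elim
    case (elim n)
    define l where "l = ln (real n)"
    have l1: "l \<ge> 1" using elim by (simp add: l_def)
    have n: "real n \<ge> 1" using elim by simp
    have R1: "R n \<ge> 1" using elim by (simp add: R_def)
    have RL: "R n ^ 2 = L (a n)" using elim by (simp add: R_def)
    have sl: "sqrt l \<ge> 1" "sqrt l \<le> l" "sqrt l ^ 2 = l"
    proof -
      show s1: "sqrt l \<ge> 1" using l1 by simp
      show s2: "sqrt l ^ 2 = l" using l1 by simp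
      show "sqrt l \<le> l" using s1 mult_left_mono[of 1 "sqrt l" "sqrt l"] s2 by (simp add: power2_eq_square)
    qed
    have xe: "x n = \<epsilon> * (R n * sqrt l)" by (simp add: x_def R_def l_def real_sqrt_mult)
    have x0: "x n > 0" unfolding xe using \<epsilon> R1 sl by (intro mult_pos_pos) auto
    \<comment> \<open>With \<open>n\<^sup>2\<close> coarse cells, about \<open>R n\<close> subcells
      in each bring the mean increment over a subcell down to order \<open>R n / n\<^sup>2\<close>,
      below the target \<open>x n\<close>.\<close>
    define m where "m = nat \<lceil>R n\<rceil>"
    have m: "R n \<le> real m" "real m \<le> 2 * R n" "m > 0"
    proof -
      show 1: "R n \<le> real m" using R1 by (simp add: m_def real_nat_ceiling_ge)
      have "real m < R n + 1" using R1 by (simp add: m_def) linarith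
      then show "real m \<le> 2 * R n" using R1 by linarith
      show "m > 0" using 1 R1 by (cases m) auto
    qed
    \<comment> \<open>The minimiser of
      \<open>- u * x n + u\<^sup>2 * (2 * D * C * (R n)\<^sup>2)\<close>.\<close>
    define u1 where "u1 = \<epsilon> * sqrt l / (4 * D * C * R n)"
    \<comment> \<open>Inside a coarse cell the variance bound is of order
      \<open>L (a n) / n\<^sup>2\<close>, so the tilt \<open>real n / R n\<close> keeps the
      quadratic term bounded; the cap 1 is the range of the exponential bound.\<close>
    define u2 where "u2 = min 1 (real n / R n)"
    have u1: "0 < u1" "u1 \<le> 1"
    proof -
      show "0 < u1" unfolding u1_def using \<epsilon> sl D C R1 by (intro divide_pos_pos mult_pos_pos) auto
      have "\<epsilon> * sqrt l \<le> \<epsilon> * l" using sl \<epsilon> by (intro mult_left_mono) auto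
      also have "\<dots> \<le> \<epsilon> * ((4 * D * C / \<epsilon>) * R n)" using elim(3) \<epsilon> unfolding l_def by (intro mult_left_mono) auto
      also have "\<dots> = 4 * D * C * R n" using \<epsilon> by simp
      finally show "u1 \<le> 1" unfolding u1_def using D C R1 by (simp add: divide_le_eq)
    qed
    have u2: "0 < u2" "u2 \<le> 1" using n R1 by (auto simp: u2_def)
    have fine: "D * C * (2 * L (a n)) / (real (n\<^sup>2) * real m) \<le> x n"
    proof -
      have "D * C * (2 * L (a n)) / (real (n\<^sup>2) * real m) \<le> D * C * (2 * L (a n)) / (real (n\<^sup>2) * R n)"
        using D C m R1 n elim by (intro divide_left_mono mult_left_mono mult_pos_pos) auto
      also have "\<dots> = 2 * D * C / real n ^ 2 * R n" using R1 n unfolding RL[symmetric] by (simp add: power2_eq_square field_simps)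
      also have "\<dots> \<le> \<epsilon> * R n" using elim(7) R1 by (intro mult_right_mono) auto
      also have "\<dots> \<le> x n" unfolding xe using \<epsilon> R1 sl by (intro mult_left_mono) auto
      finally show ?thesis .
    qed
    obtain Bad where Bad: "Bad \<in> events"
      and pr: "prob Bad \<le> 2 * real (n\<^sup>2) * exp (- u1 * x n + u1\<^sup>2 * (D * C * (2 * L (a n)))) +
      4 * (real (n\<^sup>2) * real m) * exp (- u2 * x n + u2\<^sup>2 * (D * C * (2 * L (a n)) / real (n\<^sup>2)))"
      and osc: "\<forall>\<omega>\<in>space M - Bad. good \<omega> \<longrightarrow> (\<forall>t\<in>{a n..a n * (1 + D)}. \<bar>cdev i t \<omega> - cdev i (a n) \<omega>\<bar> \<le> 4 * x n)"
      using cdev_oscillation[OF i _ D _ m(3) elim(1) C_def u1 u2 x0 fine] n by (auto simp: a_def)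
    \<comment> \<open>At the minimiser the exponent is
      \<open>- (\<epsilon>\<^sup>2 / (8 * D * C) * l)\<close>. The constant 32 in
      \<open>small\<close> makes it at most \<open>- (4 * l)\<close>, so the union over
      \<open>n\<^sup>2\<close> coarse cells leaves the summable order
      \<open>1 / n\<^sup>2\<close>.\<close>
    have e1: "- u1 * x n + u1\<^sup>2 * (D * C * (2 * L (a n))) \<le> - (4 * l)"
    proof -
      have "- u1 * x n + u1\<^sup>2 * (D * C * (2 * L (a n))) = - (\<epsilon>\<^sup>2 * (sqrt l)\<^sup>2 / (8 * D * C))"
        unfolding xe RL[symmetric] u1_def using D C R1 by (simp add: power2_eq_square field_simps)
      also have "\<dots> = - (\<epsilon>\<^sup>2 / (8 * D * C) * l)" unfolding sl by simp
      also have "\<dots> \<le> - (4 * l)"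
      proof -
        have "4 \<le> \<epsilon>\<^sup>2 / (8 * D * C)" using sm D C by (simp add: field_simps)
        then have "4 * l \<le> \<epsilon>\<^sup>2 / (8 * D * C) * l" using l1 by (intro mult_right_mono) auto
        then show ?thesis by simp
      qed
      finally show ?thesis .
    qed
    have pow: "exp (- (4 * l)) = 1 / real n ^ 4"
    proof -
      have "exp (4 * l) = exp l ^ 4" using exp_of_nat_mult[of 4 l] by simp
      also have "exp l = real n" using n by (simp add: l_def)
      finally show ?thesis by (simp add: exp_minus field_simps)
    qed
    have t1: "2 * real (n\<^sup>2) * exp (- u1 * x n + u1\<^sup>2 * (D * C * (2 * L (a n)))) \<le> 2 * (1 / real n ^ 2)"
    proof -
      have "2 * real (n\<^sup>2) * exp (- u1 * x n + u1\<^sup>2 * (D * C * (2 * L (a n)))) \<le> 2 * real (n\<^sup>2) * (1 / real n ^ 4)"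
        unfolding pow[symmetric] using e1 by (intro mult_left_mono) auto
      also have "\<dots> = 2 * (1 / real n ^ 2)" using n by (simp add: field_simps power2_eq_square power4_eq_xxxx)
      finally show ?thesis .
    qed
    have e2: "exp (- u2 * x n + u2\<^sup>2 * (D * C * (2 * L (a n)) / real (n\<^sup>2))) \<le> exp (2 * D * C) * (exp (- \<epsilon> * R n) + exp (- \<epsilon> * real n))"
    proof -
      have "u2\<^sup>2 \<le> (real n / R n)\<^sup>2" using u2 by (intro power_mono) (auto simp: u2_def)
      then have "u2\<^sup>2 * (D * C * (2 * L (a n)) / real (n\<^sup>2)) \<le> (real n / R n)\<^sup>2 * (D * C * (2 * L (a n)) / real (n\<^sup>2))"
        using D C elim by (intro mult_right_mono) auto
      also have "\<dots> = 2 * D * C" unfolding RL[symmetric] using n R1 by (simp add: power2_eq_square field_simps)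
      finally have A: "u2\<^sup>2 * (D * C * (2 * L (a n)) / real (n\<^sup>2)) \<le> 2 * D * C" .
      have "u2 * R n = min (R n) (real n)" using R1 by (auto simp: u2_def min_def field_simps)
      then have "u2 * x n = \<epsilon> * min (R n) (real n) * sqrt l" unfolding xe by (metis mult.assoc mult.left_commute)
      moreover have "\<epsilon> * min (R n) (real n) * 1 \<le> \<epsilon> * min (R n) (real n) * sqrt l"
        using \<epsilon> R1 n sl by (intro mult_left_mono mult_nonneg_nonneg) auto
      ultimately have B: "- u2 * x n \<le> - \<epsilon> * min (R n) (real n)" by simp
      have "exp (- u2 * x n + u2\<^sup>2 * (D * C * (2 * L (a n)) / real (n\<^sup>2))) \<le> exp (- \<epsilon> * min (R n) (real n) + 2 * D * C)"
        using A B by simp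
      also have "\<dots> = exp (2 * D * C) * exp (- \<epsilon> * min (R n) (real n))" by (simp add: mult_exp_exp)
      also have "exp (- \<epsilon> * min (R n) (real n)) \<le> exp (- \<epsilon> * R n) + exp (- \<epsilon> * real n)"
        by (auto simp: min_def)
      finally show ?thesis by simp
    qed
    \<comment> \<open>In both terms half of the exponent compensates the factor \<open>R n\<close>
      from the number of subcells, and the other half yields \<open>1 / real n ^ 4\<close>.\<close>
    have t2: "R n * (exp (- \<epsilon> * R n) + exp (- \<epsilon> * real n)) \<le> (2 / \<epsilon> + 1) * (1 / real n ^ 4)"
    proof -
      have "\<epsilon> / 2 * R n \<le> exp (\<epsilon> / 2 * R n)" using exp_ge_add_one_self[of "\<epsilon> / 2 * R n"] by linarith
      then have "R n \<le> 2 / \<epsilon> * exp (\<epsilon> / 2 * R n)" using \<epsilon> by (simp add: field_simps)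
      then have "R n * exp (- \<epsilon> * R n) \<le> 2 / \<epsilon> * exp (\<epsilon> / 2 * R n) * exp (- \<epsilon> * R n)" by (intro mult_right_mono) auto
      also have "\<dots> = 2 / \<epsilon> * exp (- (\<epsilon> / 2 * R n))" by (simp add: mult_exp_exp)
      also have "\<dots> \<le> 2 / \<epsilon> * exp (- (4 * l))" using elim(4) \<epsilon> by (intro mult_left_mono) (auto simp: l_def)
      finally have A: "R n * exp (- \<epsilon> * R n) \<le> 2 / \<epsilon> * (1 / real n ^ 4)" unfolding pow .
      have "R n * exp (- \<epsilon> * real n) \<le> exp (\<epsilon> / 2 * real n) * exp (- \<epsilon> * real n)" using elim(5) by (intro mult_right_mono) auto
      also have "\<dots> = 1 / exp (\<epsilon> / 2 * real n)"
      proof -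
        have "\<epsilon> / 2 * real n + - \<epsilon> * real n = - (\<epsilon> / 2 * real n)" by simp
        then show ?thesis by (simp only: mult_exp_exp exp_minus inverse_eq_divide)
      qed
      also have "\<dots> \<le> 1 / real n ^ 4" using elim(6) n by (intro divide_left_mono) auto
      finally show ?thesis using A unfolding distrib_left distrib_right by simp
    qed
    have t3: "4 * (real (n\<^sup>2) * real m) * exp (- u2 * x n + u2\<^sup>2 * (D * C * (2 * L (a n)) / real (n\<^sup>2))) \<le>
       8 * exp (2 * D * C) * (2 / \<epsilon> + 1) * (1 / real n ^ 2)"
    proof -
      have "4 * (real (n\<^sup>2) * real m) * exp (- u2 * x n + u2\<^sup>2 * (D * C * (2 * L (a n)) / real (n\<^sup>2))) \<le>
        4 * (real (n\<^sup>2) * (2 * R n)) * (exp (2 * D * C) * (exp (- \<epsilon> * R n) + exp (- \<epsilon> * real n)))"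
        using e2 m R1 by (intro mult_mono mult_left_mono) auto
      also have "\<dots> = 8 * exp (2 * D * C) * real n ^ 2 * (R n * (exp (- \<epsilon> * R n) + exp (- \<epsilon> * real n)))" by simp
      also have "\<dots> \<le> 8 * exp (2 * D * C) * real n ^ 2 * ((2 / \<epsilon> + 1) * (1 / real n ^ 4))"
        using t2 by (intro mult_left_mono) auto
      also have "\<dots> = 8 * exp (2 * D * C) * (2 / \<epsilon> + 1) * (1 / real n ^ 2)"
        using n by (simp add: field_simps power2_eq_square power4_eq_xxxx)
      finally show ?thesis .
    qed
    have "prob Bad \<le> b n" using pr t1 t3 unfolding b_def distrib_right by linarith
    moreover have "a n * (1 + D) = a (Suc n)" by (simp add: a_def D_def exp_add[symmetric] algebra_simps)
    ultimately show ?case using Bad osc by auto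
  qed
  moreover have "summable b" unfolding b_def
    using inverse_power_summable[of 2, where 'a=real] by (intro summable_mult) (simp add: inverse_eq_divide)
  ultimately have "AE \<omega> in M. eventually (\<lambda>n. good \<omega> \<longrightarrow> (\<forall>t\<in>{a n..a (Suc n)}. \<bar>cdev i t \<omega> - cdev i (a n) \<omega>\<bar> \<le> 4 * x n)) sequentially"
    by (rule borel_cantelli_choice)
  then show ?thesis using AE_good by eventually_elim (simp add: a_def x_def)
qed

end

section \<open>The upper bound\<close>

definition var_const :: "nat \<Rightarrow> real" where
  "var_const j = 1 / real j - fact (2 * j - 1) / ((fact j)\<^sup>2 * 2 ^ (2 * j))"

lemma pois_square: "(pois j x)\<^sup>2 = fact (2 * j) / ((fact j)\<^sup>2 * 2 ^ (2 * j)) * pois (2 * j) (x * 2)"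
proof -
  have "exp (- (x * 2)) = (exp (- x))\<^sup>2" using exp_double[of "- x"] by (simp add: mult.commute)
  moreover have "(x ^ j)\<^sup>2 = (x\<^sup>2) ^ j" by (simp add: power_mult[symmetric] mult.commute)
  ultimately show ?thesis
    by (simp add: pois_def power_mult_distrib power_divide power_mult)
qed

lemma var_const_eq:
  assumes "j \<ge> 1"
  shows "var_const j = 1 / real j - fact (2 * j) / ((fact j)\<^sup>2 * 2 ^ (2 * j)) * (1 / real (2 * j))"
proof -
  have "fact (2 * j) = real (2 * j) * fact (2 * j - 1)" using assms by (intro fact_reduce) auto
  then show ?thesis using assms by (simp add: var_const_def)
qed

text \<open>The central binomial coefficient is at most \<open>2 ^ (2 * j)\<close>, so the
  subtracted term is at most half of \<open>1 / real j\<close>. Positivity makes the variance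
  comparable to \<open>L\<close>.\<close>

lemma var_const_pos:
  assumes "j \<ge> 1" shows "var_const j > 0"
proof -
  have "real (2 * j choose j) \<le> real (2 ^ (2 * j))" by (intro of_nat_mono binomial_le_pow2)
  moreover have "real (2 * j choose j) = fact (2 * j) / (fact j)\<^sup>2"
    by (subst binomial_fact) (auto simp: power2_eq_square mult_2)
  ultimately have "fact (2 * j) / (fact j)\<^sup>2 \<le> (2::real) ^ (2 * j)" by simp
  then have "fact (2 * j) / (fact j)\<^sup>2 / 2 ^ (2 * j) \<le> (1::real)" by (subst divide_le_eq_1_pos) auto
  then have "fact (2 * j) / ((fact j)\<^sup>2 * 2 ^ (2 * j)) \<le> (1::real)" by (simp only: divide_divide_eq_left)
  then have "fact (2 * j) / ((fact j)\<^sup>2 * 2 ^ (2 * j)) * (1 / real (2 * j)) \<le> 1 * (1 / real (2 * j))"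
    by (intro mult_right_mono) auto
  also have "\<dots> < 1 / real j" using assms by (simp add: field_simps)
  finally show ?thesis unfolding var_const_eq[OF assms] by simp
qed

section \<open>Asymptotics and local regularity of the variance\<close>

context karlin_regular
begin

lemma var_sum_eq:
  assumes t: "t \<ge> 0" and j: "j \<ge> 1"
  shows "var_sum p j t = psum p j t - fact (2 * j) / ((fact j)\<^sup>2 * 2 ^ (2 * j)) * psum p (2 * j) (2 * t)"
proof -
  have s: "summable (\<lambda>k. pois (2 * j) (p k * (2 * t)))" using t j by (intro summable_pois) auto
  have "var_sum p j t = (\<Sum>k. pois j (p k * t) - fact (2 * j) / ((fact j)\<^sup>2 * 2 ^ (2 * j)) * pois (2 * j) (p k * (2 * t)))"
    unfolding var_sum_def
  proof (rule suminf_cong)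
    fix k
    have "pois j (p k * t) * (1 - pois j (p k * t)) = pois j (p k * t) - (pois j (p k * t))\<^sup>2"
      by (simp add: algebra_simps power2_eq_square)
    then show "pois j (p k * t) * (1 - pois j (p k * t)) = pois j (p k * t) - fact (2 * j) / ((fact j)\<^sup>2 * 2 ^ (2 * j)) * pois (2 * j) (p k * (2 * t))"
      by (simp only: pois_square mult_ac)
  qed
  also have "\<dots> = psum p j t - fact (2 * j) / ((fact j)\<^sup>2 * 2 ^ (2 * j)) * psum p (2 * j) (2 * t)"
    unfolding psum_def
    by (subst suminf_diff[symmetric], rule summable_pois[OF t j], rule summable_mult[OF s], subst suminf_mult[OF s], rule refl)
  finally show ?thesis .
qed

lemma psum_scaled_lim:
  assumes "j \<ge> 1" "c > 0"
  shows "((\<lambda>t. psum p j (c * t) / L t) \<longlongrightarrow> 1 / real j) at_top"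
proof -
  have ct: "filterlim (\<lambda>t. c * t) at_top at_top" using assms(2) by real_asymp
  have "((\<lambda>t. psum p j (c * t) / L (c * t) * (L (c * t) / L t)) \<longlongrightarrow> 1 / real j * 1) at_top"
    by (intro tendsto_mult L_slow assms filterlim_compose[OF psum_lim[OF assms(1)] ct])
  then have *: "((\<lambda>t. psum p j (c * t) / L (c * t) * (L (c * t) / L t)) \<longlongrightarrow> 1 / real j) at_top" by simp
  have "eventually (\<lambda>t. psum p j (c * t) / L (c * t) * (L (c * t) / L t) = psum p j (c * t) / L t) at_top"
    using eventually_compose_filterlim[OF L_pos_eventually ct] by eventually_elim simp
  then show ?thesis by (rule Lim_transform_eventually[OF *])
qed

lemma var_sum_lim:
  assumes j: "j \<ge> 1"
  shows "((\<lambda>t. var_sum p j t / L t) \<longlongrightarrow> var_const j) at_top"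
proof -
  let ?K = "fact (2 * j) / ((fact j)\<^sup>2 * 2 ^ (2 * j)) :: real"
  have "((\<lambda>t. psum p j t / L t - ?K * (psum p (2 * j) (2 * t) / L t)) \<longlongrightarrow> 1 / real j - ?K * (1 / real (2 * j))) at_top"
    using j by (intro tendsto_intros psum_lim psum_scaled_lim) auto
  moreover have "eventually (\<lambda>t. psum p j t / L t - ?K * (psum p (2 * j) (2 * t) / L t) = var_sum p j t / L t) at_top"
    using eventually_ge_at_top[of 0] by eventually_elim (simp add: var_sum_eq[OF _ j] diff_divide_distrib)
  ultimately show ?thesis unfolding var_const_eq[OF j] by (rule Lim_transform_eventually)
qed

lemma psum_measurable [measurable]: "psum p j \<in> borel_measurable borel"
  unfolding psum_def[abs_def] by measurable

lemma var_sum_measurable [measurable]: "var_sum p j \<in> borel_measurable borel"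
  unfolding var_sum_def[abs_def] by measurable

lemma var_sum_pos_eventually:
  assumes "j \<ge> 1" shows "eventually (\<lambda>t. var_sum p j t > 0) at_top"
proof -
  have "eventually (\<lambda>t. var_sum p j t / L t > 0) at_top"
    using var_sum_lim[OF assms] var_const_pos[OF assms] by (intro order_tendstoD)
  then show ?thesis using L_pos_eventually by eventually_elim (simp add: zero_less_divide_iff)
qed

lemma L_le_var_sum_eventually:
  assumes j: "j \<ge> 1" shows "eventually (\<lambda>t. L t \<le> 2 / var_const j * var_sum p j t) at_top"
proof -
  have c: "var_const j > 0" by (rule var_const_pos[OF j])
  have "eventually (\<lambda>t. var_sum p j t / L t > var_const j / 2) at_top"
    using var_sum_lim[OF j] c by (intro order_tendstoD) auto
  then show ?thesis using L_pos_eventually by eventually_elim (use c in \<open>simp add: field_simps\<close>)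
qed

text \<open>The uniform convergence theorem is applied to the variance itself, which is measurable
  and inherits slow variation from \<open>L\<close>. Shifts up to 1 suffice because the skeleton is
  chosen with \<open>\<delta> \<le> 1\<close>.\<close>

lemma var_sum_local:
  assumes j: "j \<ge> 1" and \<theta>: "0 < \<theta>" "\<theta> < 1"
  shows "eventually (\<lambda>x. \<forall>u\<in>{0..1}. (1 - \<theta>) * var_sum p j (exp x) \<le> var_sum p j (exp (x + u))) at_top"
proof -
  define h where "h x = ln \<bar>var_sum p j (exp x)\<bar>" for x
  have hm: "h \<in> borel_measurable borel" unfolding h_def[abs_def] by measurable
  have vpos: "eventually (\<lambda>x. var_sum p j (exp x) > 0) at_top"
    by (rule eventually_compose_filterlim[OF var_sum_pos_eventually[OF j] exp_at_top])
  have c: "var_const j > 0" by (rule var_const_pos[OF j])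
  have hl: "((\<lambda>x. h (x + u) - h x) \<longlongrightarrow> 0) at_top" for u
  proof -
    have t1: "filterlim (\<lambda>t::real. exp u * t) at_top at_top"
      by (rule filterlim_tendsto_pos_mult_at_top[OF tendsto_const _ filterlim_ident]) simp
    have "((\<lambda>t. (var_sum p j (exp u * t) / L (exp u * t)) * (L (exp u * t) / L t) / (var_sum p j t / L t)) \<longlongrightarrow> var_const j * 1 / var_const j) at_top"
      using c by (intro tendsto_divide tendsto_mult L_slow var_sum_lim[OF j] filterlim_compose[OF var_sum_lim[OF j] t1]) auto
    then have 1: "((\<lambda>t. (var_sum p j (exp u * t) / L (exp u * t)) * (L (exp u * t) / L t) / (var_sum p j t / L t)) \<longlongrightarrow> 1) at_top" using c by simp
    have "eventually (\<lambda>t. (var_sum p j (exp u * t) / L (exp u * t)) * (L (exp u * t) / L t) / (var_sum p j t / L t) = var_sum p j (exp u * t) / var_sum p j t) at_top"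
      using L_pos_eventually eventually_compose_filterlim[OF L_pos_eventually t1] by eventually_elim simp
    from Lim_transform_eventually[OF 1 this]
    have "((\<lambda>x. ln (var_sum p j (exp u * exp x) / var_sum p j (exp x))) \<longlongrightarrow> ln 1) at_top"
      by (intro tendsto_ln filterlim_compose[OF _ exp_at_top]) auto
    then have 2: "((\<lambda>x. ln (var_sum p j (exp u * exp x) / var_sum p j (exp x))) \<longlongrightarrow> 0) at_top" by simp
    have "eventually (\<lambda>x. var_sum p j (exp u * exp x) > 0) at_top"
      by (rule eventually_compose_filterlim[OF eventually_compose_filterlim[OF var_sum_pos_eventually[OF j] t1] exp_at_top])
    then have "eventually (\<lambda>x. ln (var_sum p j (exp u * exp x) / var_sum p j (exp x)) = h (x + u) - h x) at_top"
      using vpos by eventually_elim (simp add: h_def exp_add mult.commute ln_div)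
    with 2 show ?thesis by (rule Lim_transform_eventually)
  qed
  have e: "- ln (1 - \<theta>) > 0" using \<theta> by simp
  obtain X where X: "\<And>x. x \<ge> X \<Longrightarrow> var_sum p j (exp x) > 0" using vpos by (auto simp: eventually_at_top_linorder)
  show ?thesis
    using uniform_convergence_slow_variation[OF hm hl e] eventually_ge_at_top[of X]
  proof eventually_elim
    case (elim x)
    show ?case
    proof
      fix u :: real assume u: "u \<in> {0..1}"
      have pos: "var_sum p j (exp x) > 0" "var_sum p j (exp (x + u)) > 0" using X elim(2) u by auto
      have "h x + ln (1 - \<theta>) \<le> h (x + u)" using elim(1) u by fastforce
      then have "ln ((1 - \<theta>) * var_sum p j (exp x)) \<le> ln (var_sum p j (exp (x + u)))"
        using pos \<theta> by (simp add: h_def ln_mult)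
      then show "(1 - \<theta>) * var_sum p j (exp x) \<le> var_sum p j (exp (x + u))"
        using pos \<theta> by (subst (asm) ln_le_cancel_iff) auto
    qed
  qed
qed

end

section \<open>Upper bound on the skeleton and between its points\<close>

context karlin_lil
begin

lemma Kstar_skeleton_AE:
  assumes j: "j \<ge> 1" and \<eta>: "\<eta> > 0" and \<delta>: "\<delta> > 0"
  shows "AE \<omega> in M. eventually (\<lambda>n. \<bar>Kstar S X j (exp (\<delta> * real n)) \<omega> - psum p j (exp (\<delta> * real n))\<bar> \<le>
     (1 + \<eta>) * sqrt (2 * var_sum p j (exp (\<delta> * real n)) * ln (real n))) sequentially"
proof -
  define a where "a n = exp (\<delta> * real n)" for n
  define v where "v n = var_sum p j (a n)" for n
  define x where "x n = (1 + \<eta>) * sqrt (2 * v n * ln (real n))" for n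
  define B where "B = 2 / var_const j"
  \<comment> \<open>Chosen so that \<open>(1 + \<eta>) * \<tau> = \<eta> / (1 + \<eta>)\<close>: a
    tilt up to this value costs at most one of the two factors \<open>1 + \<eta>\<close> in the
    exponent, and the other makes the series converge.\<close>
  define \<tau> where "\<tau> = \<eta> / (1 + \<eta>) / (1 + \<eta>)"
  have B: "B > 0" using var_const_pos[OF j] by (simp add: B_def)
  have \<tau>: "\<tau> > 0" using \<eta> by (simp add: \<tau>_def)
  have ev1: "eventually (\<lambda>n. ln (real n) \<le> (\<tau>\<^sup>2 / (2 * B)) * sqrt (L (a n))) sequentially"
    unfolding a_def using \<tau> B by (intro eventually_ln_le_sqrt_L[OF \<delta>]) auto
  have ev2: "eventually (\<lambda>n. L (a n) \<ge> 1) sequentially" unfolding a_def by (rule eventually_L_ge[OF \<delta>])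
  have ev3: "eventually (\<lambda>n. L (a n) \<le> B * v n) sequentially" unfolding a_def B_def v_def
    by (rule eventually_compose_filterlim[OF L_le_var_sum_eventually[OF j] exp_seq_at_top[OF \<delta>]])
  have ev4: "eventually (\<lambda>n. v n > 0) sequentially" unfolding a_def v_def
    by (rule eventually_compose_filterlim[OF var_sum_pos_eventually[OF j] exp_seq_at_top[OF \<delta>]])
  have "eventually (\<lambda>n. \<exists>Bad\<in>events. prob Bad \<le> 2 * real n powr (- (1 + \<eta>)) \<and>
     (\<forall>\<omega>\<in>space M - Bad. \<bar>Kstar S X j (a n) \<omega> - psum p j (a n)\<bar> \<le> x n)) sequentially"
    using ev1 ev2 ev3 ev4 eventually_ge_at_top[of 2]
  proof eventually_elim
    case (elim n)
    define l where "l = ln (real n)"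
    have n: "real n \<ge> 2" using elim by simp
    have l: "l > 0" using n by (simp add: l_def)
    \<comment> \<open>The Gaussian optimum \<open>x n / v n\<close>; the exponent becomes
      \<open>- (u\<^sup>2 * v n) / 2 * (1 - u)\<close>.\<close>
    define u where "u = (1 + \<eta>) * sqrt (2 * l / v n)"
    have u0: "u > 0" unfolding u_def using \<eta> l elim by (intro mult_pos_pos) auto
    have "sqrt (L (a n)) \<le> L (a n)"
      using elim(2) by (intro real_le_lsqrt) (auto simp: power2_eq_square mult_le_cancel_left1)
    then have "(\<tau>\<^sup>2 / (2 * B)) * sqrt (L (a n)) \<le> (\<tau>\<^sup>2 / (2 * B)) * (B * v n)"
      using elim(3) B by (intro mult_left_mono) auto
    then have "l \<le> (\<tau>\<^sup>2 / (2 * B)) * (B * v n)" using elim(1) by (simp add: l_def)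
    also have "\<dots> = \<tau>\<^sup>2 * v n / 2" using B by simp
    finally have "2 * l / v n \<le> \<tau>\<^sup>2" using elim(4) by (simp add: field_simps)
    then have "sqrt (2 * l / v n) \<le> \<tau>" using \<tau> by (intro real_le_lsqrt) auto
    then have "u \<le> (1 + \<eta>) * \<tau>" unfolding u_def using \<eta> by (intro mult_left_mono) auto
    then have u1: "u \<le> \<eta> / (1 + \<eta>)" using \<eta> by (simp add: \<tau>_def)
    then have u2: "u \<le> 1" using \<eta> by (smt (verit) divide_le_eq_1)
    have xu: "x n = u * v n"
    proof -
      have "sqrt (2 * v n * l) = sqrt (2 * l / v n * (v n)\<^sup>2)" using elim(4) by (intro arg_cong[where f=sqrt]) (simp add: power2_eq_square)
      also have "\<dots> = sqrt (2 * l / v n) * v n" using elim(4) by (subst real_sqrt_mult) simp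
      finally show ?thesis by (simp add: x_def u_def l_def)
    qed
    have uu: "u\<^sup>2 * v n = (1 + \<eta>)\<^sup>2 * (2 * l)" using elim(4) l by (simp add: u_def power_mult_distrib)
    have "- u * x n + v n * (u\<^sup>2 / 2 * (1 + u)) = - (u\<^sup>2 * v n) / 2 * (1 - u)"
      unfolding xu by (simp add: field_simps power2_eq_square)
    also have "\<dots> = - ((1 + \<eta>)\<^sup>2 * (1 - u)) * l" unfolding uu by simp
    also have "\<dots> \<le> - (1 + \<eta>) * l"
    proof -
      have "(1 + \<eta>)\<^sup>2 * (1 - u) \<ge> (1 + \<eta>)\<^sup>2 * (1 - \<eta> / (1 + \<eta>))" using u1 by (intro mult_left_mono) auto
      also have "(1 + \<eta>)\<^sup>2 * (1 - \<eta> / (1 + \<eta>)) = 1 + \<eta>" using \<eta> by (simp add: power2_eq_square field_simps)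
      finally have "(1 + \<eta>) * l \<le> ((1 + \<eta>)\<^sup>2 * (1 - u)) * l" using l by (intro mult_right_mono) auto
      then show ?thesis by (simp only: mult_minus_left neg_le_iff_le)
    qed
    finally have ex: "- u * x n + v n * (u\<^sup>2 / 2 * (1 + u)) \<le> - (1 + \<eta>) * l" .
    have "prob {\<omega> \<in> space M. \<bar>Kstar S X j (a n) \<omega> - psum p j (a n)\<bar> \<ge> x n} \<le> 2 * exp (- u * x n + v n * (u\<^sup>2 / 2 * (1 + u)))"
      unfolding v_def by (rule Kstar_chernoff[OF _ j u0 u2]) (simp add: a_def)
    also have "\<dots> \<le> 2 * exp (- (1 + \<eta>) * l)" using ex by simp
    also have "\<dots> = 2 * real n powr (- (1 + \<eta>))" using n by (simp add: powr_def l_def)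
    finally have "prob {\<omega> \<in> space M. \<bar>Kstar S X j (a n) \<omega> - psum p j (a n)\<bar> \<ge> x n} \<le> 2 * real n powr (- (1 + \<eta>))" .
    then show ?case
      by (intro bexI[of _ "{\<omega> \<in> space M. \<bar>Kstar S X j (a n) \<omega> - psum p j (a n)\<bar> \<ge> x n}"]) auto
  qed
  moreover have "summable (\<lambda>n. 2 * real n powr (- (1 + \<eta>)))"
    using \<eta> by (intro summable_mult) (simp add: summable_real_powr_iff)
  ultimately have "AE \<omega> in M. eventually (\<lambda>n. \<bar>Kstar S X j (a n) \<omega> - psum p j (a n)\<bar> \<le> x n) sequentially"
    by (rule borel_cantelli_choice)
  then show ?thesis by (simp add: a_def x_def v_def)
qed

lemma Kstar_lil_upper:
  assumes j: "j \<ge> 1" and \<eta>: "\<eta> > 0"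
  shows "AE \<omega> in M. eventually (\<lambda>t. \<bar>Kstar S X j t \<omega> - psum p j t\<bar> \<le> (1 + \<eta>) * sqrt (2 * var_sum p j t * ln (ln t))) at_top"
proof -
  define B where "B = 2 / var_const j"
  have B: "B > 0" using var_const_pos[OF j] by (simp add: B_def)
  \<comment> \<open>The 32 lets the oscillations of the counts for \<open>j\<close> and
    \<open>Suc j\<close> cost \<open>\<eta> / 8\<close> each, besides \<open>\<eta> / 4\<close> on
    the skeleton. The remaining \<open>\<eta> / 2\<close> goes, through \<theta>, into replacing the
    variance and the logarithm at the skeleton time by those at \<open>t\<close>.\<close>
  define \<epsilon> where "\<epsilon> = \<eta> / (32 * sqrt B)"
  have \<epsilon>: "\<epsilon> > 0" using \<eta> B by (simp add: \<epsilon>_def)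
  define \<theta> where "\<theta> = \<eta> / (2 * (1 + \<eta>))"
  have \<theta>: "0 < \<theta>" "\<theta> < 1" "(1 + \<eta>) * (1 - \<theta>) = 1 + \<eta> / 2" using \<eta> by (auto simp: \<theta>_def field_simps)
  define C where "C = max (real j * 2 ^ (j - 1)) (real (Suc j) * 2 ^ j)"
  have C: "C \<ge> 1"
  proof -
    have "(1::real) * 1 \<le> real (Suc j) * 2 ^ j" by (intro mult_mono) auto
    then show ?thesis by (simp add: C_def)
  qed
  \<comment> \<open>Gives the smallness condition of \<open>cdev_oscillation_AE\<close> for both
    \<open>j\<close> and \<open>Suc j\<close>, and \<open>exp \<delta> \<le> 2\<close>.\<close>
  define D where "D = min 1 (\<epsilon>\<^sup>2 / (32 * C))"
  have D: "D > 0" "D \<le> 1" using \<epsilon> C by (auto simp: D_def)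
  define \<delta> where "\<delta> = ln (1 + D)"
  have \<delta>: "\<delta> > 0" "exp \<delta> = 1 + D" using D by (auto simp: \<delta>_def)
  have \<delta>1: "\<delta> \<le> 1" using ln_add_one_self_le_self[of D] D by (simp add: \<delta>_def)
  have "D * (32 * C) \<le> \<epsilon>\<^sup>2" using C by (auto simp: D_def min_def field_simps)
  moreover have "real i * 2 ^ (i - 1) \<le> C" if "i = j \<or> i = Suc j" for i using that by (auto simp: C_def)
  then have "32 * (real i * 2 ^ (i - 1)) * D \<le> 32 * C * D" if "i = j \<or> i = Suc j" for i
    using that D by (intro mult_right_mono mult_left_mono) auto
  ultimately have small: "32 * (real i * 2 ^ (i - 1)) * (exp \<delta> - 1) \<le> \<epsilon>\<^sup>2" if "i = j \<or> i = Suc j" for i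
    using that unfolding \<delta>(2) by (smt (verit) mult.commute)
  define a where "a n = exp (\<delta> * real n)" for n
  define v where "v n = var_sum p j (a n)" for n
  have ev1: "eventually (\<lambda>n. L (a n) \<le> B * v n) sequentially" unfolding a_def B_def v_def
    by (rule eventually_compose_filterlim[OF L_le_var_sum_eventually[OF j] exp_seq_at_top[OF \<delta>(1)]])
  have ev2: "eventually (\<lambda>n. v n > 0) sequentially" unfolding a_def v_def
    by (rule eventually_compose_filterlim[OF var_sum_pos_eventually[OF j] exp_seq_at_top[OF \<delta>(1)]])
  have dn: "filterlim (\<lambda>n. \<delta> * real n) at_top sequentially" using \<delta>(1) by real_asymp
  have ev3: "eventually (\<lambda>n. \<forall>u\<in>{0..1}. (1 - \<theta>) * v n \<le> var_sum p j (exp (\<delta> * real n + u))) sequentially"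
    unfolding v_def a_def by (rule eventually_compose_filterlim[OF var_sum_local[OF j \<theta>(1,2)] dn])
  have ev4: "eventually (\<lambda>n::nat. (1 - \<theta>) * ln (real n) \<le> ln (\<delta> * real n)) sequentially"
    using \<delta>(1) \<theta>(1) by real_asymp
  have ev5: "eventually (\<lambda>n::nat. real n > 1 \<and> \<delta> * real n > 1) sequentially"
    using \<delta>(1) by (intro eventually_conj) real_asymp+
  have "exp \<delta> \<le> 2" using \<delta> D by simp
  have i1: "j \<ge> 1" "Suc j \<ge> 1" using j by auto
  have \<eta>4: "\<eta> / 4 > 0" using \<eta> by simp
  show ?thesis
    using cdev_oscillation_AE[OF i1(1) \<epsilon> \<delta>(1) \<open>exp \<delta> \<le> 2\<close> small[OF disjI1[OF refl]]]
      cdev_oscillation_AE[OF i1(2) \<epsilon> \<delta>(1) \<open>exp \<delta> \<le> 2\<close> small[OF disjI2[OF refl]]] Kstar_skeleton_AE[OF j \<eta>4 \<delta>(1)] AE_good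
  proof eventually_elim
    case (elim \<omega>)
    note o1 = elim(1) and o2 = elim(2) and o3 = elim(3) and g = elim(4)
    have "eventually (\<lambda>n. \<forall>t\<in>{a n..a (Suc n)}. \<bar>Kstar S X j t \<omega> - psum p j t\<bar> \<le> (1 + \<eta>) * sqrt (2 * var_sum p j t * ln (ln t))) sequentially"
      using o1 o2 o3 ev1 ev2 ev3 ev4 ev5
    proof eventually_elim
      case (elim n)
      note o = elim(1-3)[folded a_def v_def]
      define l where "l = ln (real n)"
      have l: "l > 0" using elim by (simp add: l_def)
      show ?case
      proof
        fix t assume t: "t \<in> {a n..a (Suc n)}"
        have tp: "t > 0" "a n > 0" using t by (auto simp: a_def intro: less_le_trans[OF exp_gt_zero])
        define s where "s = sqrt (2 * v n * l)"
        have s0: "s \<ge> 0" using elim l by (simp add: s_def)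
        have "B * v n \<le> B * (2 * v n)" using elim(5) B by simp
        then have "L (a n) \<le> B * (2 * v n)" using elim(4) by linarith
        then have "L (a n) * l \<le> B * (2 * v n) * l" using l by (intro mult_right_mono) auto
        then have "sqrt (L (a n) * l) \<le> sqrt (B * (2 * v n * l))" by (simp add: mult.assoc)
        also have "\<dots> = sqrt B * s" by (simp add: s_def real_sqrt_mult)
        finally have "4 * (\<epsilon> * sqrt (L (a n) * l)) \<le> 4 * (\<epsilon> * (sqrt B * s))" using \<epsilon> by (intro mult_left_mono) auto
        also have "\<dots> = \<eta> / 8 * s" using B by (simp add: \<epsilon>_def)
        finally have os: "4 * (\<epsilon> * sqrt (L (a n) * l)) \<le> \<eta> / 8 * s" .
        have "\<bar>Kstar S X j t \<omega> - psum p j t\<bar> \<le> \<bar>Kstar S X j (a n) \<omega> - psum p j (a n)\<bar> +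
           \<bar>cdev j t \<omega> - cdev j (a n) \<omega>\<bar> + \<bar>cdev (Suc j) t \<omega> - cdev (Suc j) (a n) \<omega>\<bar>"
          unfolding Kstar_cdev[OF g tp(1) j] Kstar_cdev[OF g tp(2) j] by linarith
        also have "\<dots> \<le> (1 + \<eta> / 4) * s + \<eta> / 8 * s + \<eta> / 8 * s"
          using order_trans[OF o(1)[rule_format, OF t, folded l_def] os] order_trans[OF o(2)[rule_format, OF t, folded l_def] os]
            o(3)[folded l_def, folded s_def] by (intro add_mono)
        also have "\<dots> = (1 + \<eta>) * ((1 - \<theta>) * s)" unfolding mult.assoc[symmetric] \<theta>(3) by (simp add: algebra_simps)
        also have "(1 - \<theta>) * s \<le> sqrt (2 * var_sum p j t * ln (ln t))"
        proof -
          define u where "u = ln t - \<delta> * real n"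
          have "ln (a n) \<le> ln t" "ln t \<le> ln (a (Suc n))" using t tp by (auto simp del: ln_exp)
          then have u: "u \<in> {0..1}" "exp (\<delta> * real n + u) = t" using \<delta>1 tp by (auto simp: u_def a_def algebra_simps)
          have "(1 - \<theta>) * v n \<le> var_sum p j t" using elim(6) u by auto
          moreover have "(1 - \<theta>) * l \<le> ln (ln t)"
          proof -
            have "ln (\<delta> * real n) \<le> ln (ln t)" using u elim(8) by (intro ln_mono) (auto simp: u_def)
            then show ?thesis using elim(7) by (simp add: l_def)
          qed
          \<comment> \<open>One factor \<open>1 - \<theta>\<close> pays for the variance and one for
            the iterated logarithm; the square root leaves a single one.\<close>
          ultimately have "((1 - \<theta>) * v n) * ((1 - \<theta>) * l) \<le> var_sum p j t * ln (ln t)"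
            using \<theta> l elim(5) by (intro mult_mono) (auto intro: order_trans[of 0 "(1 - \<theta>) * v n"])
          moreover have "(1 - \<theta>)\<^sup>2 * (2 * v n * l) = 2 * (((1 - \<theta>) * v n) * ((1 - \<theta>) * l))"
            by (simp add: power2_eq_square)
          ultimately have "(1 - \<theta>)\<^sup>2 * (2 * v n * l) \<le> 2 * var_sum p j t * ln (ln t)" by linarith
          then have "sqrt ((1 - \<theta>)\<^sup>2 * (2 * v n * l)) \<le> sqrt (2 * var_sum p j t * ln (ln t))" by (rule real_sqrt_le_mono)
          then show ?thesis using \<theta> by (simp add: real_sqrt_mult s_def)
        qed
        finally show "\<bar>Kstar S X j t \<omega> - psum p j t\<bar> \<le> (1 + \<eta>) * sqrt (2 * var_sum p j t * ln (ln t))"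
          using \<eta> by (simp add: mult_left_mono)
      qed
    qed
    then obtain N where N: "\<And>n t. n \<ge> N \<Longrightarrow> t \<in> {a n..a (Suc n)} \<Longrightarrow>
      \<bar>Kstar S X j t \<omega> - psum p j t\<bar> \<le> (1 + \<eta>) * sqrt (2 * var_sum p j t * ln (ln t))" unfolding eventually_sequentially by blast
    show ?case
      using eventually_ge_at_top[of "a N"]
    proof eventually_elim
      case (elim t)
      have tp: "t > 0" using elim by (auto simp: a_def intro: less_le_trans[OF exp_gt_zero])
      have lt: "\<delta> * real N \<le> ln t" using elim tp by (simp add: a_def ln_ge_iff)
      define n where "n = nat \<lfloor>ln t / \<delta>\<rfloor>"
      have "0 \<le> ln t / \<delta>" using lt \<delta>(1) by (smt (verit) divide_nonneg_pos mult_nonneg_nonneg of_nat_0_le_iff)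
      then have n: "real n \<le> ln t / \<delta>" "ln t / \<delta> < real n + 1" by (auto simp: n_def)
      have "real N \<le> ln t / \<delta>" using lt \<delta>(1) by (simp add: field_simps)
      then have "n \<ge> N" unfolding n_def by (simp add: le_nat_floor)
      moreover have "\<delta> * real n \<le> ln t" "ln t \<le> \<delta> * real (Suc n)" using n \<delta>(1) by (auto simp: field_simps)
      then have "exp (\<delta> * real n) \<le> exp (ln t)" "exp (ln t) \<le> exp (\<delta> * real (Suc n))" by (simp_all only: exp_le_cancel_iff)
      then have "t \<in> {a n..a (Suc n)}" using tp by (simp add: a_def)
      ultimately show ?case by (rule N)
    qed
  qed
qed

end

section \<open>The lower bound\<close>

definition part_sum :: "(nat \<Rightarrow> real) \<Rightarrow> nat set \<Rightarrow> nat \<Rightarrow> real \<Rightarrow> real" where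
  "part_sum p I j t = (\<Sum>k. if k \<in> I then pois j (p k * t) else 0)"

definition part_var :: "(nat \<Rightarrow> real) \<Rightarrow> nat set \<Rightarrow> nat \<Rightarrow> real \<Rightarrow> real" where
  "part_var p I j t = (\<Sum>k. if k \<in> I then pois j (p k * t) * (1 - pois j (p k * t)) else 0)"

lemma summable_restrict:
  fixes f :: "nat \<Rightarrow> real"
  assumes "summable f" "\<And>k. f k \<ge> 0"
  shows "summable (\<lambda>k. if k \<in> I then f k else 0)"
  by (rule summable_comparison_test'[OF assms(1), of 0]) (auto simp: assms(2))

lemma suminf_split:
  fixes f :: "nat \<Rightarrow> real"
  assumes "summable f" "\<And>k. f k \<ge> 0"
  shows "suminf f = (\<Sum>k. if k \<in> I then f k else 0) + (\<Sum>k. if k \<in> - I then f k else 0)"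
  by (subst suminf_add[OF summable_restrict summable_restrict]) (auto simp: assms intro!: suminf_cong)

section \<open>Counts restricted to a set of boxes\<close>

context poissonized_karlin_scheme
begin

definition Kpart :: "nat set \<Rightarrow> nat \<Rightarrow> real \<Rightarrow> 'a \<Rightarrow> real" where
  "Kpart I j t \<omega> = real (card {k. k \<in> I \<and> box_count S X k t \<omega> = j})"

lemma Kpart_measurable [measurable]: "Kpart I j t \<in> borel_measurable M"
  unfolding Kpart_def[abs_def] by measurable

lemma part_family:
  fixes I :: "nat set"
  assumes t: "0 < t" and j: "j \<ge> 1"
  defines "B \<equiv> \<lambda>k \<omega>. k \<in> I \<and> box_count S X k t \<omega> = j"
  shows "bernoulli_family.btotal B = Kpart I j t" "bernoulli_family.bmean M B = part_sum p I j t"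
    "bernoulli_family.bvar M B = part_var p I j t"
proof -
  interpret bf: bernoulli_family M B unfolding B_def by (rule exact_family[OF t j])
  have bp: "bf.bprob k = (if k \<in> I then pois j (p k * t) else 0)" for k
    using exact_family(2)[OF t j, of I k] unfolding B_def .
  show "bf.btotal = Kpart I j t" unfolding bf.btotal_def[abs_def] Kpart_def[abs_def] by (simp add: B_def)
  show "bf.bmean = part_sum p I j t" unfolding bf.bmean_def bp part_sum_def ..
  show "bf.bvar = part_var p I j t" unfolding bf.bvar_def bp part_var_def by (intro suminf_cong) auto
qed

lemma part_var_le_part_sum:
  assumes t: "0 < t" and j: "j \<ge> 1"
  shows "part_var p I j t \<le> part_sum p I j t"
proof -
  interpret bf: bernoulli_family M "\<lambda>k \<omega>. k \<in> I \<and> box_count S X k t \<omega> = j" by (rule exact_family[OF t j])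
  show ?thesis using bf.bvar_le_bmean unfolding part_family[OF t j] .
qed

lemma part_chernoff:
  assumes t: "0 < t" and j: "j \<ge> 1" and u: "0 < u" "u \<le> 1" and V: "part_sum p I j t \<le> V"
  shows "prob {\<omega> \<in> space M. \<bar>Kpart I j t \<omega> - part_sum p I j t\<bar> \<ge> x} \<le> 2 * exp (- u * x + u\<^sup>2 * V)"
proof -
  interpret bf: bernoulli_family M "\<lambda>k \<omega>. k \<in> I \<and> box_count S X k t \<omega> = j" by (rule exact_family[OF t j])
  have le: "bf.bvar \<le> V" using bf.bvar_le_bmean V unfolding part_family[OF t j] by simp
  have "V \<ge> 0" using bf.bvar_nonneg le by simp
  then have "V * (u\<^sup>2 / 2 * (1 + u)) \<le> V * (u\<^sup>2 / 2 * 2)" using u by (intro mult_left_mono) auto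
  then have "2 * exp (- u * x + V * (u\<^sup>2 / 2 * (1 + u))) \<le> 2 * exp (- u * x + u\<^sup>2 * V)" by (simp add: mult_ac)
  with bf.chernoff[OF u le, of x] show ?thesis unfolding part_family[OF t j] by linarith
qed

text \<open>For tilts up to \<open>\<eta>\<^sup>2 / 20\<close> the factors
  \<open>1 + \<bar>u\<bar>\<close> and \<open>1 - 2 * \<bar>u\<bar>\<close> are within
  \<open>\<eta>\<^sup>2 / 10\<close> of 1, as \<open>mgf_tail_lower\<close> requires. Finiteness of
  \<open>I\<close> is what \<open>mgf_lower\<close> needs, and the sign \<open>s\<close> serves
  limsup and liminf at once.\<close>

lemma part_tail_lower:
  assumes t: "0 < t" and j: "j \<ge> 1" and I: "finite I" and \<eta>: "0 < \<eta>" "\<eta> < 1"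
    and V: "part_var p I j t > 0" and x: "x > 0" and small: "(1 + \<eta>) * (x / part_var p I j t) \<le> \<eta>\<^sup>2 / 20"
    and large: "x\<^sup>2 / part_var p I j t \<ge> 4 * ln 4 / \<eta>\<^sup>2" and s: "s = 1 \<or> s = - 1"
  shows "prob {\<omega> \<in> space M. s * (Kpart I j t \<omega> - part_sum p I j t) \<ge> (1 - \<eta>) * x} \<ge>
    1 / 2 * exp (- (x\<^sup>2 / part_var p I j t) * (1 / 2 + 2 * \<eta>))"
proof -
  interpret bf: bernoulli_family M "\<lambda>k \<omega>. k \<in> I \<and> box_count S X k t \<omega> = j" by (rule exact_family[OF t j])
  note pf = part_family[OF t j, of I]
  obtain n where n: "I \<subseteq> {..<n}" using I by (metis finite_nat_iff_bounded)
  have nI: "\<not> (k \<in> I \<and> box_count S X k t \<omega> = j)" if "k \<ge> n" for k \<omega> using n that by auto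
  let ?V = "part_var p I j t" and ?W = "\<lambda>\<omega>. Kpart I j t \<omega> - part_sum p I j t"
  have \<eta>2: "\<eta>\<^sup>2 \<le> 1" using \<eta> by (simp add: power_le_one)
  have su: "\<bar>s * u\<bar> = \<bar>u\<bar>" "(s * u)\<^sup>2 = u\<^sup>2" "u * (s * w) = s * u * w" for u w :: real using s by auto
  show ?thesis
  proof (rule mgf_tail_lower[OF _ V x \<eta> small _ _ _ large])
    fix u :: real assume u: "\<bar>u\<bar> \<le> \<eta>\<^sup>2 / 20"
    then have u1: "\<bar>s * u\<bar> \<le> 1" using \<eta>2 unfolding su by linarith
    show "integrable M (\<lambda>\<omega>. exp (u * (s * ?W \<omega>)))"
      using bf.mgf_upper(1)[OF u1] unfolding pf su(3) .
    have "expectation (\<lambda>\<omega>. exp (u * (s * ?W \<omega>))) \<le> exp (?V * (u\<^sup>2 / 2 * (1 + \<bar>u\<bar>)))"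
      using bf.mgf_upper(2)[OF u1] unfolding pf su .
    also have "\<dots> \<le> exp (?V * (u\<^sup>2 / 2 * (1 + \<eta>\<^sup>2 / 10)))"
      unfolding exp_le_cancel_iff using V u by (intro mult_left_mono) auto
    finally show "expectation (\<lambda>\<omega>. exp (u * (s * ?W \<omega>))) \<le> exp (?V * (u\<^sup>2 / 2 * (1 + \<eta>\<^sup>2 / 10)))" .
    have "exp (?V * (u\<^sup>2 / 2 * (1 - \<eta>\<^sup>2 / 10))) \<le> exp (?V * (u\<^sup>2 / 2 * (1 - 2 * \<bar>u\<bar>)))"
      unfolding exp_le_cancel_iff using V u by (intro mult_left_mono) auto
    also have "\<dots> \<le> expectation (\<lambda>\<omega>. exp (u * (s * ?W \<omega>)))"
      using bf.mgf_lower[OF u1 nI] unfolding pf su .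
    finally show "exp (?V * (u\<^sup>2 / 2 * (1 - \<eta>\<^sup>2 / 10))) \<le> expectation (\<lambda>\<omega>. exp (u * (s * ?W \<omega>)))" .
  qed measurable
qed

lemma good_Kstar_split:
  assumes "good \<omega>" "j \<ge> 1"
  shows "Kstar S X j t \<omega> = Kpart I j t \<omega> + Kpart (- I) j t \<omega>"
proof -
  let ?A = "{k. k \<in> I \<and> box_count S X k t \<omega> = j}" and ?B = "{k. k \<in> - I \<and> box_count S X k t \<omega> = j}"
  have "{k. box_count S X k t \<omega> = j} = ?A \<union> ?B" by auto
  moreover have "finite ?A" "finite ?B" using good_finite[OF assms, of t]
    by (auto elim: finite_subset[rotated])
  moreover have "?A \<inter> ?B = {}" by auto
  ultimately show ?thesis unfolding Kpart_def Kstar_def by (simp only: card_Un_disjoint of_nat_add)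
qed

lemma psum_split:
  assumes "0 < t" "j \<ge> 1"
  shows "psum p j t = part_sum p I j t + part_sum p (- I) j t"
  unfolding psum_def part_sum_def using assms p_nonneg
  by (intro suminf_split pois_summable p_summable) (auto simp: pois_nonneg)

lemma var_sum_split:
  assumes "0 < t" "j \<ge> 1"
  shows "var_sum p j t = part_var p I j t + part_var p (- I) j t"
  unfolding var_sum_def part_var_def
proof (intro suminf_split)
  have b: "0 \<le> pois j (p k * t)" "pois j (p k * t) \<le> 1" for k
    using assms p_nonneg by (auto intro!: pois_nonneg pois_le_1)
  show "0 \<le> pois j (p k * t) * (1 - pois j (p k * t))" for k using b[of k] by simp
  show "summable (\<lambda>k. pois j (p k * t) * (1 - pois j (p k * t)))"
    by (rule summable_comparison_test'[OF pois_summable[of p t j, OF p_nonneg p_summable _ assms(2)], of 0])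
       (use assms b in \<open>auto simp: abs_mult intro!: mult_left_le\<close>)
qed

text \<open>The two times are components of pairs that are independent over the boxes, so disjoint
  sets of boxes give independent counts even though the counts of a single box at different times
  are in general dependent.\<close>

lemma Kpart_indep:
  assumes st: "0 < s" "s < t" and IJ: "I \<inter> J = {}" and P: "Measurable.pred borel P" and Q: "Measurable.pred borel Q"
  shows "prob ({\<omega> \<in> space M. P (Kpart I j s \<omega>)} \<inter> {\<omega> \<in> space M. Q (Kpart J j t \<omega>)}) =
    prob {\<omega> \<in> space M. P (Kpart I j s \<omega>)} * prob {\<omega> \<in> space M. Q (Kpart J j t \<omega>)}"
proof -
  let ?N = "count_space UNIV :: (nat \<times> nat) measure"
  let ?Z = "\<lambda>k \<omega>. (box_count S X k s \<omega>, box_count S X k t \<omega>)"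
  have iv: "indep_var (PiM I (\<lambda>_. ?N)) (\<lambda>\<omega>. restrict (\<lambda>k. ?Z k \<omega>) I) (PiM J (\<lambda>_. ?N)) (\<lambda>\<omega>. restrict (\<lambda>k. ?Z k \<omega>) J)"
    by (rule indep_var_restrict[OF box_counts_indep[OF st] IJ]) auto
  have m: "{f \<in> space (PiM I (\<lambda>_. ?N)). R (real (card {k. k \<in> I \<and> \<pi> (f k) = j}))} \<in> sets (PiM I (\<lambda>_. ?N))"
    if R: "Measurable.pred borel R" for I :: "nat set" and \<pi> :: "nat \<times> nat \<Rightarrow> nat" and R
  proof -
    have "{f \<in> space (PiM I (\<lambda>_. ?N)). k \<in> {k. k \<in> I \<and> \<pi> (f k) = j}} \<in> sets (PiM I (\<lambda>_. ?N))" for k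
    proof (cases "k \<in> I")
      case True
      have "(\<lambda>f. \<pi> (f k)) \<in> measurable (PiM I (\<lambda>_. ?N)) (count_space UNIV)"
        by (rule measurable_compose[OF measurable_component_singleton[OF True]]) simp
      then show ?thesis using True by simp
    qed simp
    then have [measurable]: "(\<lambda>f. card {k. k \<in> I \<and> \<pi> (f k) = j}) \<in> measurable (PiM I (\<lambda>_. ?N)) (count_space UNIV)"
      by (rule measurable_card)
    have [measurable]: "Measurable.pred borel R" by (rule R)
    show ?thesis by measurable
  qed
  let ?A = "{f \<in> space (PiM I (\<lambda>_. ?N)). P (real (card {k. k \<in> I \<and> fst (f k) = j}))}"
  let ?B = "{f \<in> space (PiM J (\<lambda>_. ?N)). Q (real (card {k. k \<in> J \<and> snd (f k) = j}))}"
  have 1: "(\<lambda>\<omega>. restrict (\<lambda>k. ?Z k \<omega>) I) -` ?A \<inter> space M = {\<omega> \<in> space M. P (Kpart I j s \<omega>)}"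
    by (auto simp: Kpart_def space_PiM cong: conj_cong)
  have 2: "(\<lambda>\<omega>. restrict (\<lambda>k. ?Z k \<omega>) J) -` ?B \<inter> space M = {\<omega> \<in> space M. Q (Kpart J j t \<omega>)}"
    by (auto simp: Kpart_def space_PiM cong: conj_cong)
  have "(\<lambda>\<omega>. (restrict (\<lambda>k. ?Z k \<omega>) I, restrict (\<lambda>k. ?Z k \<omega>) J)) -` (?A \<times> ?B) \<inter> space M =
      {\<omega> \<in> space M. P (Kpart I j s \<omega>)} \<inter> {\<omega> \<in> space M. Q (Kpart J j t \<omega>)}"
    using 1 2 by blast
  then show ?thesis using indep_varD[OF iv m[OF P] m[OF Q], of fst snd] unfolding 1 2 by simp
qed

end

section \<open>Blocks of boxes carrying most of the variance\<close>

context karlin_regular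
begin

text \<open>The boxes with \<open>1 / A \<le> p k * t < A\<close>. The half-open form makes two
  blocks disjoint as soon as the times differ by a factor \<open>A\<^sup>2\<close>.\<close>

definition block :: "real \<Rightarrow> real \<Rightarrow> nat set" where
  "block A t = {k. 0 < p k \<and> t / A < 1 / p k \<and> 1 / p k \<le> t * A}"

lemma finite_block: "finite (block A t)"
  by (rule finite_subset[OF _ finite_rho[of "t * A"]]) (auto simp: block_def)

lemma block_disjoint: "s * A \<le> t / A \<Longrightarrow> block A s \<inter> block A t = {}"
  by (auto simp: block_def)

text \<open>Off the block \<open>x = p k * t\<close> is at least \<open>A\<close> or at most
  \<open>1 / A\<close>. For large \<open>x\<close>, raising the index gains the factor
  \<open>real (Suc j) / x\<close>; for small \<open>x\<close>, replacing \<open>x\<close> by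
  \<open>A * x\<close> gains a factor \<open>A\<close> up to \<open>exp 1\<close>. Both comparison
  terms are again Poisson weights, so their sums have known asymptotics.\<close>

lemma off_block_pois:
  assumes A: "A \<ge> 1" and t: "t > 0" and j: "j \<ge> 1" and k: "k \<notin> block A t"
  shows "pois j (p k * t) \<le> real (Suc j) / A * pois (Suc j) (p k * t) + exp 1 / A * pois j (p k * (A * t))"
proof -
  define x where "x = p k * t"
  have x0: "x \<ge> 0" using p_ge_0[of k] t by (simp add: x_def)
  have nn: "0 \<le> pois (Suc j) x" "0 \<le> pois j (A * x)" using x0 A by (auto intro!: pois_nonneg)
  consider "p k = 0" | "p k > 0" "x \<ge> A" | "p k > 0" "A * x \<le> 1"
  proof (cases "p k = 0")
    case False
    then have pk: "p k > 0" using p_ge_0[of k] by simp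
    then have "1 / p k \<le> t / A \<or> t * A < 1 / p k" using k by (auto simp: block_def)
    then show ?thesis using that pk A by (auto simp: x_def field_simps)
  qed
  then have "pois j x \<le> real (Suc j) / A * pois (Suc j) x + exp 1 / A * pois j (A * x)"
  proof cases
    case 1
    then show ?thesis using j A by (simp add: x_def pois_zero)
  next
    case 2
    then have xp: "x > 0" using A by simp
    have "pois j x = real (Suc j) / x * pois (Suc j) x" using pois_Suc[of j x] xp by (simp add: field_simps del: of_nat_Suc)
    also have "\<dots> \<le> real (Suc j) / A * pois (Suc j) x"
      using 2 A nn by (intro mult_right_mono divide_left_mono) auto
    finally show ?thesis using nn A by (simp add: add_increasing2)
  next
    case 3
    have "A ^ 1 \<le> A ^ j" using A j by (intro power_increasing) auto
    have "A * (exp (- x) * x ^ j) \<le> A ^ j * (1 * x ^ j)"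
      using \<open>A ^ 1 \<le> A ^ j\<close> x0 A by (intro mult_mono) auto
    also have "\<dots> = exp (A * x) * (exp (- (A * x)) * (A * x) ^ j)"
      by (simp add: power_mult_distrib exp_minus)
    also have "\<dots> \<le> exp 1 * (exp (- (A * x)) * (A * x) ^ j)"
      using 3 x0 A by (intro mult_right_mono) auto
    finally have "A * (exp (- x) * x ^ j) / fact j \<le> exp 1 * (exp (- (A * x)) * (A * x) ^ j) / fact j"
      by (intro divide_right_mono) auto
    then have "A * pois j x \<le> exp 1 * pois j (A * x)" by (simp add: pois_def)
    then have "pois j x \<le> exp 1 / A * pois j (A * x)" using A by (simp add: field_simps)
    then show ?thesis using nn A by (simp add: add_increasing)
  qed
  then show ?thesis by (simp add: x_def mult_ac)
qed

lemma off_block_sum: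
  assumes A: "A \<ge> 1" and j: "j \<ge> 1"
  shows "eventually (\<lambda>t. part_sum p (- block A t) j t \<le> 5 / A * L t) at_top"
proof -
  have "((\<lambda>t. real (Suc j) / A * (psum p (Suc j) t / L t) + exp 1 / A * (psum p j (A * t) / L t)) \<longlongrightarrow>
      real (Suc j) / A * (1 / real (Suc j)) + exp 1 / A * (1 / real j)) at_top"
    using A j by (intro tendsto_intros psum_lim psum_scaled_lim) auto
  \<comment> \<open>The limit is at most \<open>1 / A + 3 / A\<close>; the 5 leaves room for a bound
    that holds eventually.\<close>
  moreover have "real (Suc j) / A * (1 / real (Suc j)) + exp 1 / A * (1 / real j) < 5 / A"
  proof -
    have "exp 1 / A * (1 / real j) \<le> 3 / A * 1" using exp_le A j by (intro mult_mono divide_right_mono) auto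
    then have "real (Suc j) / A * (1 / real (Suc j)) + exp 1 / A * (1 / real j) \<le> 1 / A + 3 / A" by simp
    also have "\<dots> < 5 / A" using A by (simp add: add_divide_distrib[symmetric] divide_strict_right_mono)
    finally show ?thesis .
  qed
  ultimately have "eventually (\<lambda>t. real (Suc j) / A * (psum p (Suc j) t / L t) + exp 1 / A * (psum p j (A * t) / L t) < 5 / A) at_top"
    by (rule order_tendstoD)
  then show ?thesis using L_pos_eventually eventually_gt_at_top[of 0]
  proof eventually_elim
    case (elim t)
    have At: "A * t \<ge> 0" "t \<ge> 0" using A elim by auto
    have sj: "Suc j \<ge> 1" by simp
    have s1: "summable (\<lambda>k. real (Suc j) / A * pois (Suc j) (p k * t))" by (intro summable_mult summable_pois[OF At(2) sj])
    have s2: "summable (\<lambda>k. exp 1 / A * pois j (p k * (A * t)))" by (intro summable_mult summable_pois[OF At(1) j])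
    have "part_sum p (- block A t) j t \<le> (\<Sum>k. real (Suc j) / A * pois (Suc j) (p k * t) + exp 1 / A * pois j (p k * (A * t)))"
      unfolding part_sum_def
    proof (intro suminf_le summable_add s1 s2)
      show "summable (\<lambda>k. if k \<in> - block A t then pois j (p k * t) else 0)"
        using elim p_ge_0 by (intro summable_restrict summable_pois j) (auto intro!: pois_nonneg)
      fix k
      have "0 \<le> real (Suc j) / A * pois (Suc j) (p k * t) + exp 1 / A * pois j (p k * (A * t))"
        using A At p_ge_0[of k] by (intro add_nonneg_nonneg mult_nonneg_nonneg pois_nonneg) auto
      then show "(if k \<in> - block A t then pois j (p k * t) else 0) \<le> real (Suc j) / A * pois (Suc j) (p k * t) + exp 1 / A * pois j (p k * (A * t))"
        using off_block_pois[OF A elim(3) j, of k] by auto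
    qed
    also have "\<dots> = real (Suc j) / A * psum p (Suc j) t + exp 1 / A * psum p j (A * t)"
      unfolding psum_def by (simp only: suminf_add[OF s1 s2, symmetric] suminf_mult[OF summable_pois[OF At(2) sj]] suminf_mult[OF summable_pois[OF At(1) j]])
    also have "\<dots> = (real (Suc j) / A * (psum p (Suc j) t / L t) + exp 1 / A * (psum p j (A * t) / L t)) * L t"
      using elim(2) by (simp add: distrib_right del: of_nat_Suc)
    also have "\<dots> \<le> 5 / A * L t" using elim by (intro mult_right_mono) auto
    finally show ?case .
  qed
qed

end

section \<open>Lower bound along sparse geometric times\<close>

context karlin_lil
begin

lemma Kstar_lil_lower:
  assumes j: "j \<ge> 1" and \<eta>: "0 < \<eta>" "\<eta> < 1" and sgn: "s = 1 \<or> s = - 1"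
  shows "AE \<omega> in M. frequently (\<lambda>t. (1 - \<eta>) * sqrt (2 * var_sum p j t * ln (ln t)) \<le> s * (Kstar S X j t \<omega> - psum p j t)) at_top"
proof -
  define B where "B = 2 / var_const j"
  have B: "B > 0" using var_const_pos[OF j] by (simp add: B_def)
  \<comment> \<open>The bracket collects all losses: \<open>1 - h\<close> from the tail bound,
    \<open>1 / sqrt (1 + 4 * h)\<close> from lowering the target, \<open>sqrt (1 - h)\<close> from
    the variance kept by the block, and \<open>sqrt (4 * h)\<close> from the boxes off the
    block.\<close>
  have "((\<lambda>h::real. (1 - h) * (1 / sqrt (1 + 4 * h)) * sqrt (1 - h) - sqrt (4 * h)) \<longlongrightarrow> 1) (at_right 0)" by real_asymp
  then have "eventually (\<lambda>h::real. (1 - h) * (1 / sqrt (1 + 4 * h)) * sqrt (1 - h) - sqrt (4 * h) > 1 - \<eta> / 2) (at_right 0)"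
    by (rule order_tendstoD) (use \<eta> in auto)
  moreover have "eventually (\<lambda>h::real. h \<in> {0<..<1}) (at_right 0)" by (rule eventually_at_right_real) simp
  ultimately have "eventually (\<lambda>h::real. h \<in> {0<..<1} \<and> (1 - h) * (1 / sqrt (1 + 4 * h)) * sqrt (1 - h) - sqrt (4 * h) > 1 - \<eta> / 2) (at_right 0)"
    by eventually_elim auto
  then obtain h :: real where h: "0 < h" "h < 1"
    and bracket: "(1 - h) * (1 / sqrt (1 + 4 * h)) * sqrt (1 - h) - sqrt (4 * h) > 1 - \<eta> / 2"
    using eventually_happens'[OF trivial_limit_at_right_real] by (metis (no_types, lifting) greaterThanLessThan_iff)
  \<comment> \<open>With this target the exponent in \<open>part_tail_lower\<close> is exactly
    \<open>- ln (real n)\<close>, so the probabilities eventually dominate half of the harmonic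
    series.\<close>
  define c where "c = 1 / sqrt (1 + 4 * h)"
  have c: "c > 0" "c\<^sup>2 * (1 + 4 * h) = 1" using h by (simp_all add: c_def power_divide)
  \<comment> \<open>Large enough for the off-block mean, eventually at most
    \<open>5 / A * L (a n)\<close>, to stay below \<open>h * v n\<close>; \<open>B\<close> is the
    constant in \<open>L (a n) \<le> B * v n\<close>.\<close>
  define A where "A = 5 * B / h + 1"
  have A: "A > 1" using B h by (simp add: A_def)
  define \<theta> where "\<theta> = 5 / A"
  have \<theta>: "\<theta> > 0" "\<theta> * B \<le> h"
  proof -
    show "\<theta> > 0" using A by (simp add: \<theta>_def)
    have "5 * B \<le> h * A" using h by (simp add: A_def algebra_simps)
    then show "\<theta> * B \<le> h" using A by (simp add: \<theta>_def field_simps)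
  qed
  \<comment> \<open>Consecutive times then differ by the factor \<open>A\<^sup>2\<close>, at which
    the blocks become disjoint.\<close>
  define \<delta> where "\<delta> = 2 * ln A"
  have \<delta>: "\<delta> > 0" using A by (simp add: \<delta>_def)
  define a where "a n = exp (\<delta> * real n)" for n
  have a0: "a n > 0" for n by (simp add: a_def)
  have aS: "a (Suc n) = a n * A\<^sup>2" for n
  proof -
    have "exp \<delta> = A\<^sup>2" using A by (simp add: \<delta>_def exp_double)
    then show ?thesis by (simp add: a_def distrib_left exp_add mult.commute)
  qed
  define I where "I n = block A (a n)" for n
  have disj: "I m \<inter> I n = {}" if "m < n" for m n
  proof -
    have "a (Suc m) \<le> a n" using that \<delta> by (simp add: a_def)
    then have "a m * A \<le> a n / A" using A unfolding aS by (simp add: power2_eq_square field_simps)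
    then show ?thesis unfolding I_def by (rule block_disjoint)
  qed
  define v where "v n = var_sum p j (a n)" for n
  define V where "V n = part_var p (I n) j (a n)" for n
  define W where "W n \<omega> = Kpart (I n) j (a n) \<omega> - part_sum p (I n) j (a n)" for n \<omega>
  define W' where "W' n \<omega> = Kpart (- I n) j (a n) \<omega> - part_sum p (- I n) j (a n)" for n \<omega>
  define x where "x n = c * sqrt (2 * V n * ln (real n))" for n
  \<comment> \<open>The 8 turns the Chernoff exponent off the block into
    \<open>- (2 * ln (real n))\<close>, which is summable, while \<open>x' n\<close> remains at most
    \<open>sqrt (4 * h)\<close> times the target scale.\<close>
  define x' where "x' n = sqrt (8 * \<theta> * L (a n) * ln (real n))" for n
  have [measurable]: "W n \<in> borel_measurable M" "W' n \<in> borel_measurable M" for n unfolding W_def[abs_def] W'_def[abs_def] by measurable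
  \<comment> \<open>If \<open>2 * ln (real n) / V n \<le> q\<close>, then the tilt condition of
    \<open>part_tail_lower\<close> holds. The constant \<zeta> below secures this and keeps the
    off-block tilt at most 1.\<close>
  define q where "q = (h\<^sup>2 / 20 / ((1 + h) * c))\<^sup>2"
  have q: "q > 0" using h c by (simp add: q_def)
  define \<zeta> where "\<zeta> = min (\<theta> / 2) (q * (1 - h) / (2 * B))"
  have \<zeta>: "\<zeta> > 0" using \<theta> q h B by (simp add: \<zeta>_def)
  have ev1: "eventually (\<lambda>n. L (a n) \<le> B * v n) sequentially" unfolding a_def B_def v_def
    by (rule eventually_compose_filterlim[OF L_le_var_sum_eventually[OF j] exp_seq_at_top[OF \<delta>]])
  have ev2: "eventually (\<lambda>n. v n > 0) sequentially" unfolding a_def v_def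
    by (rule eventually_compose_filterlim[OF var_sum_pos_eventually[OF j] exp_seq_at_top[OF \<delta>]])
  have ev3: "eventually (\<lambda>n. L (a n) \<ge> 1) sequentially" unfolding a_def by (rule eventually_L_ge[OF \<delta>])
  have ev4: "eventually (\<lambda>n. ln (real n) \<le> \<zeta> * sqrt (L (a n))) sequentially"
    unfolding a_def by (rule eventually_ln_le_sqrt_L[OF \<delta> \<zeta>])
  have ev5: "eventually (\<lambda>n. part_sum p (- I n) j (a n) \<le> \<theta> * L (a n)) sequentially" unfolding I_def a_def \<theta>_def
    using A by (intro eventually_compose_filterlim[OF off_block_sum[OF _ j] exp_seq_at_top[OF \<delta>]]) auto
  have ev6: "eventually (\<lambda>n. 2 * c\<^sup>2 * ln (real n) \<ge> 4 * ln 4 / h\<^sup>2) sequentially" using c(1) h(1) by real_asymp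
  have ev7: "eventually (\<lambda>n::nat. ln (real n) \<ge> 1) sequentially" by real_asymp
  \<comment> \<open>\<open>ln (ln (a n))\<close> is \<open>ln (\<delta> * real n)\<close>, which may
    exceed \<open>ln (real n)\<close>; the gap between \<open>1 - \<eta> / 2\<close> and
    \<open>1 - \<eta>\<close> is reserved for this.\<close>
  define \<rho> where "\<rho> = ((1 - \<eta> / 2) / (1 - \<eta>))\<^sup>2"
  have \<rho>: "\<rho> > 1"
  proof -
    have "1 < (1 - \<eta> / 2) / (1 - \<eta>)" using \<eta> by (simp add: field_simps)
    then show ?thesis unfolding \<rho>_def by (simp add: one_less_power)
  qed
  have ev8: "eventually (\<lambda>n::nat. ln (\<delta> * real n) \<le> \<rho> * ln (real n)) sequentially"
    using \<rho> \<delta> by real_asymp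
  have ev: "eventually (\<lambda>n. ln (real n) \<ge> 1 \<and> v n > 0 \<and> L (a n) \<ge> 1 \<and> L (a n) \<le> B * v n \<and>
      ln (real n) \<le> \<zeta> * L (a n) \<and> part_sum p (- I n) j (a n) \<le> \<theta> * L (a n) \<and> V n \<ge> (1 - h) * v n \<and> \<theta> * L (a n) \<le> h * v n) sequentially"
    using ev1 ev2 ev3 ev4 ev5 ev7
  proof eventually_elim
    case (elim n)
    have "sqrt (L (a n)) \<le> L (a n)"
      using elim(3) by (intro real_le_lsqrt) (auto simp: power2_eq_square mult_le_cancel_left1)
    then have "\<zeta> * sqrt (L (a n)) \<le> \<zeta> * L (a n)" using \<zeta> by (intro mult_left_mono) auto
    then have 1: "ln (real n) \<le> \<zeta> * L (a n)" using elim by linarith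
    have "\<theta> * L (a n) \<le> \<theta> * (B * v n)" using elim \<theta> by (intro mult_left_mono) auto
    also have "\<dots> \<le> h * v n" using \<theta> elim by (simp only: mult.assoc[symmetric]) (intro mult_right_mono, auto)
    finally have 2: "\<theta> * L (a n) \<le> h * v n" .
    have "v n = V n + part_var p (- I n) j (a n)" unfolding v_def V_def by (rule var_sum_split[OF a0 j])
    moreover have "part_var p (- I n) j (a n) \<le> part_sum p (- I n) j (a n)" by (rule part_var_le_part_sum[OF a0 j])
    ultimately have "V n \<ge> (1 - h) * v n" using elim(5) 2 by (simp add: algebra_simps)
    then show ?case using elim 1 2 by auto
  qed
  define E where "E n = {\<omega> \<in> space M. s * W n \<omega> \<ge> (1 - h) * x n}" for n
  have E_events [measurable]: "E n \<in> events" for n unfolding E_def by measurable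
  have E_prob: "eventually (\<lambda>n. prob (E n) \<ge> 1 / 2 * (1 / real n)) sequentially"
    using ev ev6
  proof eventually_elim
    case (elim n)
    define l where "l = ln (real n)"
    have l: "l \<ge> 1" using elim by (simp add: l_def)
    then have n: "real n > 0" by (cases n) (auto simp: l_def)
    have "(1 - h) * v n > 0" using elim h by simp
    then have Vp: "V n > 0" using elim by linarith
    have xp: "x n > 0" unfolding x_def using c Vp l by (simp add: l_def)
    have x2: "x n ^ 2 = 2 * c\<^sup>2 * V n * l" using Vp l by (simp add: x_def power_mult_distrib l_def)
    have R: "x n ^ 2 / V n = 2 * c\<^sup>2 * l" using Vp by (simp add: x2)
    have "l \<le> q * (1 - h) / (2 * B) * L (a n)"
    proof -
      have "\<zeta> * L (a n) \<le> q * (1 - h) / (2 * B) * L (a n)" using elim by (intro mult_right_mono) (auto simp: \<zeta>_def)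
      then show ?thesis using elim by (simp add: l_def)
    qed
    also have "\<dots> \<le> q * (1 - h) / (2 * B) * (B * v n)" using elim q h B by (intro mult_left_mono) auto
    also have "\<dots> = q / 2 * ((1 - h) * v n)" using B by simp
    also have "\<dots> \<le> q / 2 * V n" using elim q by (intro mult_left_mono) auto
    finally have lq: "2 * l / V n \<le> q" using Vp by (simp add: field_simps)
    have small: "(1 + h) * (x n / V n) \<le> h\<^sup>2 / 20"
    proof -
      have "x n / V n = c * sqrt (2 * l / V n)"
      proof -
        have "sqrt (2 * V n * l) = sqrt (2 * l / V n * (V n)\<^sup>2)" using Vp by (intro arg_cong[where f=sqrt]) (simp add: power2_eq_square)
        also have "\<dots> = sqrt (2 * l / V n) * V n" using Vp by (subst real_sqrt_mult) simp
        finally show ?thesis using Vp by (simp add: x_def l_def)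
      qed
      also have "\<dots> \<le> c * sqrt q" using lq c by (intro mult_left_mono real_sqrt_le_mono) auto
      also have "sqrt q = h\<^sup>2 / 20 / ((1 + h) * c)" unfolding q_def using h c by (simp add: real_sqrt_abs)
      finally have "(1 + h) * (x n / V n) \<le> (1 + h) * (c * (h\<^sup>2 / 20 / ((1 + h) * c)))" using h by (intro mult_left_mono) auto
      also have "\<dots> = h\<^sup>2 / 20"
      proof -
        have "(1 + h) * c \<noteq> 0" using h c by simp
        then show ?thesis by (metis mult.assoc nonzero_mult_div_cancel_left times_divide_eq_right)
      qed
      finally show ?thesis .
    qed
    have large: "x n ^ 2 / V n \<ge> 4 * ln 4 / h\<^sup>2" using elim(2) unfolding R l_def .
    have fin: "finite (I n)" by (simp add: I_def finite_block)
    have "1 / 2 * exp (- (x n ^ 2 / V n) * (1 / 2 + 2 * h)) \<le> prob {\<omega> \<in> space M. s * (Kpart (I n) j (a n) \<omega> - part_sum p (I n) j (a n)) \<ge> (1 - h) * x n}"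
      unfolding V_def
      by (rule part_tail_lower[OF a0 j fin h Vp[unfolded V_def] xp small[unfolded V_def] large[unfolded V_def] sgn])
    also have "- (x n ^ 2 / V n) * (1 / 2 + 2 * h) = - l"
    proof -
      have "(x n ^ 2 / V n) * (1 / 2 + 2 * h) = (c\<^sup>2 * (1 + 4 * h)) * l" unfolding R by (simp add: algebra_simps)
      then show ?thesis unfolding c(2) by simp
    qed
    also have "exp (- l) = 1 / real n" using n by (simp add: l_def exp_minus inverse_eq_divide)
    finally show ?case by (simp add: E_def W_def)
  qed
  have "\<not> summable (\<lambda>n. prob (E n))"
  proof
    assume sm: "summable (\<lambda>n. prob (E n))"
    obtain N where "\<And>n. n \<ge> N \<Longrightarrow> prob (E n) \<ge> 1 / 2 * (1 / real n)" using E_prob by (auto simp: eventually_sequentially)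
    then have "summable (\<lambda>n. 1 / 2 * (1 / real n))"
      by (intro summable_comparison_test'[OF sm, of N]) auto
    then have "summable (\<lambda>n. 1 / real n)" by (subst (asm) summable_cmult_iff) simp
    then show False using not_summable_harmonic[where 'a=real] by (simp add: inverse_eq_divide)
  qed
  moreover have "prob (E m \<inter> E n) = prob (E m) * prob (E n)" if mn: "m < n" for m n
  proof -
    have "a m < a n" using mn \<delta> by (simp add: a_def)
    from Kpart_indep[OF a0 this disj[OF mn], of "\<lambda>y. (1 - h) * x m \<le> s * (y - part_sum p (I m) j (a m))" "\<lambda>y. (1 - h) * x n \<le> s * (y - part_sum p (I n) j (a n))"]
    show ?thesis unfolding E_def W_def by simp
  qed
  ultimately have AE1: "AE \<omega> in M. frequently (\<lambda>n. \<omega> \<in> E n) sequentially"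
    by (intro pairwise_borel_cantelli) auto
  have "eventually (\<lambda>n. \<exists>Bad\<in>events. prob Bad \<le> 2 * (1 / real n ^ 2) \<and> (\<forall>\<omega>\<in>space M - Bad. \<bar>W' n \<omega>\<bar> \<le> x' n)) sequentially"
    using ev
  proof eventually_elim
    case (elim n)
    define l where "l = ln (real n)"
    have l: "l \<ge> 1" using elim by (simp add: l_def)
    then have n: "real n > 0" by (cases n) (auto simp: l_def)
    define m where "m = \<theta> * L (a n)"
    have m: "m > 0" using \<theta> elim by (simp add: m_def)
    define u where "u = x' n / (2 * m)"
    have x'2: "x' n ^ 2 = 8 * m * l" using \<theta> elim l by (simp add: x'_def m_def l_def)
    have x'0: "x' n > 0" unfolding x'_def using \<theta> elim by simp
    have u0: "u > 0" using x'0 m by (simp add: u_def)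
    have "\<zeta> * L (a n) \<le> \<theta> / 2 * L (a n)" using elim by (intro mult_right_mono) (auto simp: \<zeta>_def)
    moreover have "l \<le> \<zeta> * L (a n)" using elim by (simp add: l_def)
    ultimately have "2 * l \<le> m" unfolding m_def by linarith
    then have "x' n ^ 2 \<le> (2 * m)\<^sup>2" using m mult_left_mono[of "2 * l" m "4 * m"] unfolding x'2 by (simp add: power2_eq_square)
    then have "x' n \<le> 2 * m" using m by (intro power2_le_imp_le[of "x' n"]) auto
    then have u1: "u \<le> 1" using m by (simp add: u_def)
    have "prob {\<omega> \<in> space M. \<bar>W' n \<omega>\<bar> \<ge> x' n} \<le> 2 * exp (- u * x' n + u\<^sup>2 * m)"
      unfolding W'_def by (rule part_chernoff[OF a0 j u0 u1]) (use elim in \<open>simp add: m_def\<close>)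
    also have "- u * x' n + u\<^sup>2 * m = - (x' n ^ 2 / (4 * m))" using m by (simp add: u_def power2_eq_square field_simps)
    also have "\<dots> = - (2 * l)" unfolding x'2 using m by simp
    also have "exp (- (2 * l)) = 1 / real n ^ 2" using n exp_double[of l] by (simp add: l_def exp_minus inverse_eq_divide)
    finally show ?case
      by (intro bexI[of _ "{\<omega> \<in> space M. \<bar>W' n \<omega>\<bar> \<ge> x' n}"]) auto
  qed
  moreover have "summable (\<lambda>n. 2 * (1 / real n ^ 2))"
    using inverse_power_summable[of 2, where 'a=real] by (intro summable_mult) (simp add: inverse_eq_divide)
  ultimately have AE2: "AE \<omega> in M. eventually (\<lambda>n. \<bar>W' n \<omega>\<bar> \<le> x' n) sequentially"
    by (rule borel_cantelli_choice)
  show ?thesis using AE1 AE2 AE_good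
  proof eventually_elim
    case (elim \<omega>)
    have "frequently (\<lambda>n. (1 - \<eta>) * sqrt (2 * var_sum p j (a n) * ln (ln (a n))) \<le> s * (Kstar S X j (a n) \<omega> - psum p j (a n))) sequentially"
    proof (rule frequently_rev_mp[OF elim(1)])
      show "eventually (\<lambda>n. \<omega> \<in> E n \<longrightarrow> (1 - \<eta>) * sqrt (2 * var_sum p j (a n) * ln (ln (a n))) \<le> s * (Kstar S X j (a n) \<omega> - psum p j (a n))) sequentially"
        using ev ev8 elim(2)
      proof (eventually_elim, intro impI)
        fix n assume *: "ln (real n) \<ge> 1 \<and> v n > 0 \<and> L (a n) \<ge> 1 \<and> L (a n) \<le> B * v n \<and>
            ln (real n) \<le> \<zeta> * L (a n) \<and> part_sum p (- I n) j (a n) \<le> \<theta> * L (a n) \<and> V n \<ge> (1 - h) * v n \<and> \<theta> * L (a n) \<le> h * v n"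
          and l8: "ln (\<delta> * real n) \<le> \<rho> * ln (real n)" and w': "\<bar>W' n \<omega>\<bar> \<le> x' n" and inE: "\<omega> \<in> E n"
        define l where "l = ln (real n)"
        define r where "r = sqrt (2 * v n * l)"
        have r0: "r \<ge> 0" using * by (simp add: r_def l_def)
        have "Kstar S X j (a n) \<omega> - psum p j (a n) = W n \<omega> + W' n \<omega>"
          unfolding W_def W'_def using good_Kstar_split[OF elim(3) j, of "a n" "I n"] psum_split[OF a0[of n] j, of "I n"] by simp
        then have "s * (Kstar S X j (a n) \<omega> - psum p j (a n)) \<ge> s * W n \<omega> - \<bar>W' n \<omega>\<bar>"
          using sgn by auto
        moreover have "s * W n \<omega> \<ge> (1 - h) * x n" using inE by (simp add: E_def)
        moreover have "x n \<ge> c * (sqrt (1 - h) * r)"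
        proof -
          have "sqrt (1 - h) * r = sqrt (2 * ((1 - h) * v n) * l)" by (simp add: r_def real_sqrt_mult[symmetric] mult_ac)
          also have "\<dots> \<le> sqrt (2 * V n * l)" using * by (intro real_sqrt_le_mono mult_right_mono) (auto simp: l_def)
          finally show ?thesis unfolding x_def l_def[symmetric] using c by (intro mult_left_mono) auto
        qed
        then have "(1 - h) * x n \<ge> (1 - h) * (c * (sqrt (1 - h) * r))" using h by (intro mult_left_mono) auto
        moreover have "x' n \<le> sqrt (4 * h) * r"
        proof -
          have "x' n = sqrt (8 * (\<theta> * L (a n)) * l)" by (simp add: x'_def l_def mult_ac)
          also have "\<dots> \<le> sqrt (8 * (h * v n) * l)" using * by (intro real_sqrt_le_mono mult_right_mono mult_left_mono) (auto simp: l_def)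
          also have "\<dots> = sqrt (4 * h) * r" by (simp add: r_def real_sqrt_mult[symmetric] mult_ac)
          finally show ?thesis .
        qed
        ultimately have "s * (Kstar S X j (a n) \<omega> - psum p j (a n)) \<ge> (1 - h) * (c * (sqrt (1 - h) * r)) - sqrt (4 * h) * r"
          using w' by linarith
        also have "(1 - h) * (c * (sqrt (1 - h) * r)) - sqrt (4 * h) * r = ((1 - h) * c * sqrt (1 - h) - sqrt (4 * h)) * r"
          by (simp add: algebra_simps)
        also have "\<dots> \<ge> (1 - \<eta> / 2) * r"
          using bracket r0 unfolding c_def[symmetric] by (intro mult_right_mono) auto
        finally have main: "(1 - \<eta> / 2) * r \<le> s * (Kstar S X j (a n) \<omega> - psum p j (a n))" .
        have "ln (ln (a n)) \<le> \<rho> * l" using l8 by (simp add: a_def l_def)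
        then have "sqrt (2 * v n * ln (ln (a n))) \<le> sqrt (\<rho> * (2 * v n * l))"
          using * by (intro real_sqrt_le_mono) (simp add: mult.left_commute[of \<rho>] mult_left_mono)
        also have "\<dots> = (1 - \<eta> / 2) / (1 - \<eta>) * r" using \<eta> by (simp add: real_sqrt_mult r_def \<rho>_def)
        finally have "(1 - \<eta>) * sqrt (2 * v n * ln (ln (a n))) \<le> (1 - \<eta>) * ((1 - \<eta> / 2) / (1 - \<eta>) * r)"
          using \<eta> by (intro mult_left_mono) auto
        also have "\<dots> = (1 - \<eta> / 2) * r" using \<eta> by simp
        finally show "(1 - \<eta>) * sqrt (2 * var_sum p j (a n) * ln (ln (a n))) \<le> s * (Kstar S X j (a n) \<omega> - psum p j (a n))"
          using main by (simp add: v_def)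
      qed
    qed
    then have freq: "\<not> eventually (\<lambda>n. \<not> ((1 - \<eta>) * sqrt (2 * var_sum p j (a n) * ln (ln (a n))) \<le> s * (Kstar S X j (a n) \<omega> - psum p j (a n)))) sequentially"
      unfolding frequently_def .
    show ?case
      unfolding frequently_def
    proof
      assume "eventually (\<lambda>t. \<not> ((1 - \<eta>) * sqrt (2 * var_sum p j t * ln (ln t)) \<le> s * (Kstar S X j t \<omega> - psum p j t))) at_top"
      from eventually_compose_filterlim[OF this exp_seq_at_top[OF \<delta>]] freq show False unfolding a_def by (rule notE[rotated])
    qed
  qed
qed

end

section \<open>The law of the iterated logarithm\<close>

lemma Limsup_real_eqI:
  fixes q :: "real \<Rightarrow> real"
  assumes "\<And>e. e > 0 \<Longrightarrow> eventually (\<lambda>t. q t \<le> c + e) at_top"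
    and "\<And>e. e > 0 \<Longrightarrow> frequently (\<lambda>t. q t \<ge> c - e) at_top"
  shows "Limsup at_top (\<lambda>t. ereal (q t)) = ereal c"
proof (rule antisym)
  show "Limsup at_top (\<lambda>t. ereal (q t)) \<le> ereal c"
  proof (rule ereal_le_epsilon2)
    fix e :: real assume "e > 0"
    from assms(1)[OF this] show "Limsup at_top (\<lambda>t. ereal (q t)) \<le> ereal c + ereal e"
      by (intro Limsup_bounded) (auto elim!: eventually_mono)
  qed
  show "ereal c \<le> Limsup at_top (\<lambda>t. ereal (q t))"
  proof (rule ereal_le_epsilon2)
    fix e :: real assume e: "e > 0"
    have "\<not> Limsup at_top (\<lambda>t. ereal (q t)) < ereal (c - e)"
    proof
      assume "Limsup at_top (\<lambda>t. ereal (q t)) < ereal (c - e)"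
      then have "eventually (\<lambda>t. ereal (q t) < ereal (c - e)) at_top" by (rule Limsup_lessD)
      then have "eventually (\<lambda>t. \<not> q t \<ge> c - e) at_top" by eventually_elim auto
      then show False using assms(2)[OF e] by (simp add: frequently_def)
    qed
    then have "ereal (c - e) + ereal e \<le> Limsup at_top (\<lambda>t. ereal (q t)) + ereal e" by (intro add_right_mono) auto
    then show "ereal c \<le> Limsup at_top (\<lambda>t. ereal (q t)) + ereal e" by simp
  qed
qed

context karlin_lil
begin

text \<open>\<open>N\<close> is the logarithm or the iterated logarithm. Both regimes differ from
  the law with \<open>ln (ln t)\<close> only by the ratio \<open>g\<close> of the normalisations,
  which tends to \<open>sqrt (2 / \<beta>)\<close>.\<close>

lemma Kstar_normalized_limits:
  fixes N :: "real \<Rightarrow> real"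
  assumes j: "j \<ge> 1" and \<beta>: "\<beta> > 0" and N: "((\<lambda>t. N (var_sum p j t) / ln (ln t)) \<longlongrightarrow> \<beta>) at_top"
  defines "Q \<equiv> \<lambda>\<omega> t. (Kstar S X j t \<omega> - expectation (Kstar S X j t)) /
     sqrt (variance (Kstar S X j t) * N (variance (Kstar S X j t)))"
  shows "AE \<omega> in M. Limsup at_top (\<lambda>t. ereal (Q \<omega> t)) = ereal (sqrt (2 / \<beta>))"
    and "AE \<omega> in M. Liminf at_top (\<lambda>t. ereal (Q \<omega> t)) = ereal (- sqrt (2 / \<beta>))"
proof -
  define v where "v t = var_sum p j t" for t
  define g where "g t = sqrt (2 * ln (ln t) / N (v t))" for t
  let ?c = "sqrt (2 / \<beta>)"
  have lnln: "eventually (\<lambda>t::real. ln (ln t) > 0) at_top" by real_asymp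
  have "eventually (\<lambda>t. N (v t) / ln (ln t) > 0) at_top" using N \<beta> unfolding v_def by (intro order_tendstoD)
  then have Npos: "eventually (\<lambda>t. N (v t) > 0) at_top" using lnln by eventually_elim (simp add: zero_less_divide_iff)
  have "((\<lambda>t. sqrt (2 / (N (v t) / ln (ln t)))) \<longlongrightarrow> ?c) at_top"
    using N \<beta> unfolding v_def by (intro tendsto_intros) auto
  then have g: "(g \<longlongrightarrow> ?c) at_top" by (simp add: g_def[abs_def])
  have Qeq: "eventually (\<lambda>t. \<forall>\<omega> e. (Kstar S X j t \<omega> - psum p j t = e * sqrt (2 * var_sum p j t * ln (ln t)) \<longrightarrow> Q \<omega> t = e * g t) \<and>
      sqrt (2 * var_sum p j t * ln (ln t)) > 0) at_top"
    using lnln Npos var_sum_pos_eventually[OF j] eventually_gt_at_top[of 0]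
  proof eventually_elim
    case (elim t)
    have m: "expectation (Kstar S X j t) = psum p j t" "variance (Kstar S X j t) = v t"
      using Kstar_moments[OF elim(4) j] by (auto simp: v_def)
    have "sqrt (2 * v t * ln (ln t)) = g t * sqrt (v t * N (v t))"
      using elim by (simp add: g_def v_def real_sqrt_mult[symmetric] mult_ac)
    moreover have "sqrt (v t * N (v t)) > 0" "g t > 0" using elim by (simp_all add: v_def g_def)
    ultimately show ?case using elim unfolding Q_def unfolding m(2) unfolding m(1) by (simp add: v_def)
  qed
  \<comment> \<open>The errors run through a sequence, so that one null set serves all of
    them.\<close>
  have up: "AE \<omega> in M. \<forall>n. eventually (\<lambda>t. \<bar>Q \<omega> t\<bar> \<le> (1 + 1 / real (Suc n)) * g t) at_top"
  proof (subst AE_all_countable, intro allI)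
    fix n
    have n0: "1 / real (Suc n) > 0" by simp
    show "AE \<omega> in M. eventually (\<lambda>t. \<bar>Q \<omega> t\<bar> \<le> (1 + 1 / real (Suc n)) * g t) at_top"
      using Kstar_lil_upper[OF j n0]
    proof eventually_elim
      case (elim \<omega>)
      show ?case using elim Qeq Npos lnln
      proof eventually_elim
        case (elim t)
        define r where "r = sqrt (2 * var_sum p j t * ln (ln t))"
        have r: "r > 0" using elim(2) by (simp add: r_def)
        define e where "e = (Kstar S X j t \<omega> - psum p j t) / r"
        have "Kstar S X j t \<omega> - psum p j t = e * r" using r by (simp add: e_def)
        then have Qe: "Q \<omega> t = e * g t" using elim(2) by (auto simp: r_def)
        have "\<bar>e\<bar> \<le> 1 + 1 / real (Suc n)" using elim(1) r unfolding r_def[symmetric] by (simp add: e_def divide_le_eq)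
        moreover have "g t \<ge> 0" using elim by (simp add: g_def)
        ultimately show ?case unfolding Qe by (simp add: abs_mult mult_right_mono del: of_nat_Suc)
      qed
    qed
  qed
  \<comment> \<open>The errors start at 1/2, since \<open>Kstar_lil_lower\<close> needs an error
    strictly below 1.\<close>
  have low: "AE \<omega> in M. \<forall>n. frequently (\<lambda>t. (1 - 1 / real (Suc (Suc n))) * g t \<le> s * Q \<omega> t) at_top" if s: "s = 1 \<or> s = - 1" for s
  proof (subst AE_all_countable, intro allI)
    fix n
    have n0: "0 < 1 / real (Suc (Suc n))" "1 / real (Suc (Suc n)) < 1" by simp_all
    show "AE \<omega> in M. frequently (\<lambda>t. (1 - 1 / real (Suc (Suc n))) * g t \<le> s * Q \<omega> t) at_top"
      using Kstar_lil_lower[OF j n0 s]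
    proof eventually_elim
      case (elim \<omega>)
      show ?case
      proof (rule frequently_rev_mp[OF elim])
        show "eventually (\<lambda>t. (1 - 1 / real (Suc (Suc n))) * sqrt (2 * var_sum p j t * ln (ln t)) \<le> s * (Kstar S X j t \<omega> - psum p j t)
          \<longrightarrow> (1 - 1 / real (Suc (Suc n))) * g t \<le> s * Q \<omega> t) at_top"
          using Qeq Npos lnln
        proof eventually_elim
          case (elim t)
          show ?case
          proof
            assume lower: "(1 - 1 / real (Suc (Suc n))) * sqrt (2 * var_sum p j t * ln (ln t)) \<le> s * (Kstar S X j t \<omega> - psum p j t)"
            define r where "r = sqrt (2 * var_sum p j t * ln (ln t))"
            have r: "r > 0" using elim(1) by (simp add: r_def)
            define e where "e = (Kstar S X j t \<omega> - psum p j t) / r"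
            have Ke: "Kstar S X j t \<omega> - psum p j t = e * r" using r by (simp add: e_def)
            then have Qe: "Q \<omega> t = e * g t" using elim(1) by (auto simp: r_def)
            have "(1 - 1 / real (Suc (Suc n))) * r \<le> s * e * r" using lower unfolding r_def[symmetric] Ke by (simp only: mult.assoc)
            then have "1 - 1 / real (Suc (Suc n)) \<le> s * e" using r by (simp only: mult_le_cancel_right_pos)
            moreover have "g t \<ge> 0" using elim by (simp add: g_def)
            ultimately have "(1 - 1 / real (Suc (Suc n))) * g t \<le> s * e * g t" by (rule mult_right_mono)
            then show "(1 - 1 / real (Suc (Suc n))) * g t \<le> s * Q \<omega> t" unfolding Qe by (simp only: mult.assoc)
          qed
        qed
      qed
    qed
  qed
  have evup: "eventually (\<lambda>t. \<bar>Q \<omega> t\<bar> \<le> ?c + e) at_top"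
    if \<omega>: "\<forall>n. eventually (\<lambda>t. \<bar>Q \<omega> t\<bar> \<le> (1 + 1 / real (Suc n)) * g t) at_top" and e: "e > 0" for \<omega> e
  proof -
    have "(\<lambda>n. (1 + 1 / real (Suc n)) * ?c) \<longlonglongrightarrow> (1 + 0) * ?c"
      by (intro tendsto_intros LIMSEQ_Suc[OF lim_1_over_n])
    then have "eventually (\<lambda>n. (1 + 1 / real (Suc n)) * ?c < ?c + e) sequentially" using e by (intro order_tendstoD) auto
    then obtain n where n: "(1 + 1 / real (Suc n)) * ?c < ?c + e" using eventually_happens'[OF sequentially_bot] by blast
    have "((\<lambda>t. (1 + 1 / real (Suc n)) * g t) \<longlongrightarrow> (1 + 1 / real (Suc n)) * ?c) at_top" by (intro tendsto_intros g)
    then have "eventually (\<lambda>t. (1 + 1 / real (Suc n)) * g t < ?c + e) at_top" using n by (rule order_tendstoD)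
    with \<omega>[rule_format, of n] show ?thesis by eventually_elim linarith
  qed
  have frlow: "frequently (\<lambda>t. ?c - e \<le> s * Q \<omega> t) at_top"
    if \<omega>: "\<forall>n. frequently (\<lambda>t. (1 - 1 / real (Suc (Suc n))) * g t \<le> s * Q \<omega> t) at_top" and e: "e > 0" for \<omega> e s
  proof -
    have "(\<lambda>n. (1 - 1 / real (Suc (Suc n))) * ?c) \<longlonglongrightarrow> (1 - 0) * ?c"
      by (intro tendsto_intros LIMSEQ_Suc[OF LIMSEQ_Suc[OF lim_1_over_n]])
    then have "eventually (\<lambda>n. (1 - 1 / real (Suc (Suc n))) * ?c > ?c - e) sequentially" using e by (intro order_tendstoD) auto
    then obtain n where n: "(1 - 1 / real (Suc (Suc n))) * ?c > ?c - e" using eventually_happens'[OF sequentially_bot] by blast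
    have "((\<lambda>t. (1 - 1 / real (Suc (Suc n))) * g t) \<longlongrightarrow> (1 - 1 / real (Suc (Suc n))) * ?c) at_top" by (intro tendsto_intros g)
    then have "eventually (\<lambda>t. (1 - 1 / real (Suc (Suc n))) * g t > ?c - e) at_top" using n by (rule order_tendstoD)
    then show ?thesis by (intro frequently_rev_mp[OF \<omega>[rule_format, of n]]) (auto elim!: eventually_mono)
  qed
  show "AE \<omega> in M. Limsup at_top (\<lambda>t. ereal (Q \<omega> t)) = ereal ?c"
    using up low[OF disjI1[OF refl]]
  proof eventually_elim
    case (elim \<omega>)
    show ?case
    proof (rule Limsup_real_eqI)
      fix e :: real assume e: "e > 0"
      show "eventually (\<lambda>t. Q \<omega> t \<le> ?c + e) at_top" using evup[OF elim(1) e] by eventually_elim auto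
      show "frequently (\<lambda>t. ?c - e \<le> Q \<omega> t) at_top" using frlow[OF elim(2) e] by simp
    qed
  qed
  show "AE \<omega> in M. Liminf at_top (\<lambda>t. ereal (Q \<omega> t)) = ereal (- ?c)"
    using up low[OF disjI2[OF refl]]
  proof eventually_elim
    case (elim \<omega>)
    have "Limsup at_top (\<lambda>t. ereal (- Q \<omega> t)) = ereal ?c"
    proof (rule Limsup_real_eqI)
      fix e :: real assume e: "e > 0"
      show "eventually (\<lambda>t. - Q \<omega> t \<le> ?c + e) at_top" using evup[OF elim(1) e] by eventually_elim auto
      show "frequently (\<lambda>t. ?c - e \<le> - Q \<omega> t) at_top" using frlow[OF elim(2) e] by simp
    qed
    moreover have "Liminf at_top (\<lambda>t. - ereal (- Q \<omega> t)) = - Limsup at_top (\<lambda>t. ereal (- Q \<omega> t))"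
      by (rule ereal_Liminf_uminus)
    ultimately show ?case by simp
  qed
qed

lemma Kstar_moments_asymp:
  assumes j: "j \<ge> 1"
  shows "(\<lambda>t. expectation (Kstar S X j t)) \<sim>[at_top] (\<lambda>t. L t / real j)"
    and "(\<lambda>t. variance (Kstar S X j t)) \<sim>[at_top] (\<lambda>t. var_const j * L t)"
proof -
  have "((\<lambda>t. psum p j t / L t / (1 / real j)) \<longlongrightarrow> 1 / real j / (1 / real j)) at_top"
    using j by (intro tendsto_intros psum_lim) auto
  moreover have "eventually (\<lambda>t. psum p j t / L t / (1 / real j) = expectation (Kstar S X j t) / (L t / real j)) at_top"
    using eventually_gt_at_top[of 0] by eventually_elim (simp add: Kstar_moments(1)[OF _ j])
  ultimately have "((\<lambda>t. expectation (Kstar S X j t) / (L t / real j)) \<longlongrightarrow> 1) at_top"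
    using j Lim_transform_eventually by fastforce
  then show "(\<lambda>t. expectation (Kstar S X j t)) \<sim>[at_top] (\<lambda>t. L t / real j)"
    by (rule asymp_equivI')
  have c: "var_const j > 0" by (rule var_const_pos[OF j])
  have "((\<lambda>t. var_sum p j t / L t / var_const j) \<longlongrightarrow> var_const j / var_const j) at_top"
    using c by (intro tendsto_intros var_sum_lim[OF j]) auto
  moreover have "eventually (\<lambda>t. var_sum p j t / L t / var_const j = variance (Kstar S X j t) / (var_const j * L t)) at_top"
    using eventually_gt_at_top[of 0] by eventually_elim (simp add: Kstar_moments(2)[OF _ j])
  ultimately have "((\<lambda>t. variance (Kstar S X j t) / (var_const j * L t)) \<longlongrightarrow> 1) at_top"
    using c Lim_transform_eventually by fastforce
  then show "(\<lambda>t. variance (Kstar S X j t)) \<sim>[at_top] (\<lambda>t. var_const j * L t)"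
    by (rule asymp_equivI')
qed

end

lemma slowly_varying_pos: "slowly_varying L \<Longrightarrow> eventually (\<lambda>t. L t > 0) at_top"
  by (auto simp: slowly_varying_def eventually_at_top_linorder)

text \<open>The lower bound on \<open>L\<close> also yields its divergence, which
  \<open>karlin_regular\<close> assumes.\<close>

lemma karlin_lilI:
  assumes "poissonized_karlin_scheme M p S X" "slowly_varying L"
    and "\<And>c. c > 0 \<Longrightarrow> ((\<lambda>t. (rho p (c * t) - rho p t) / L t) \<longlongrightarrow> ln c) at_top"
    and "\<kappa> > 0" "eventually (\<lambda>t. L t \<ge> ln t powr \<kappa>) at_top"
  shows "karlin_lil M p S X L \<kappa>"
proof -
  interpret poissonized_karlin_scheme M p S X by fact
  have "filterlim (\<lambda>t. ln t powr \<kappa>) at_top at_top" using assms(4) by real_asymp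
  then have "filterlim L at_top at_top" by (rule filterlim_at_top_mono[OF _ assms(5)])
  then show ?thesis
    using assms p_nonneg p_sums
    by unfold_locales (auto simp: slowly_varying_def)
qed

theorem theorem1p1:
  fixes M :: "'a measure" and p :: "nat \<Rightarrow> real"
    and S :: "nat \<Rightarrow> 'a \<Rightarrow> real" and X :: "nat \<Rightarrow> 'a \<Rightarrow> nat"
    and L :: "real \<Rightarrow> real"
  assumes "poissonized_karlin_scheme M p S X"
    and "infinite {k. p k > 0}"
    and "slowly_varying L"
    and "\<And>c. c > 0 \<Longrightarrow> ((\<lambda>t. (rho p (c * t) - rho p t) / L t) \<longlongrightarrow> ln c) at_top"
  shows
    "(\<forall>\<beta> l. \<beta> > 0 \<and> slowly_varying l \<and> L \<sim>[at_top] (\<lambda>t. ln t powr \<beta> * l (ln t)) \<longrightarrow>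
       (\<forall>j\<ge>1.
         (AE \<omega> in M. Limsup at_top (\<lambda>t. ereal
            ((Kstar S X j t \<omega> - prob_space.expectation M (Kstar S X j t)) /
             sqrt (prob_space.variance M (Kstar S X j t) *
                   ln (prob_space.variance M (Kstar S X j t))))) = ereal (sqrt (2 / \<beta>))) \<and>
         (AE \<omega> in M. Liminf at_top (\<lambda>t. ereal
            ((Kstar S X j t \<omega> - prob_space.expectation M (Kstar S X j t)) /
             sqrt (prob_space.variance M (Kstar S X j t) *
                   ln (prob_space.variance M (Kstar S X j t))))) = ereal (- sqrt (2 / \<beta>))))) \<and>
     (\<forall>\<sigma> \<alpha>. \<sigma> > 0 \<and> 0 < \<alpha> \<and> \<alpha> < 1 \<and> L \<sim>[at_top] (\<lambda>t. exp (\<sigma> * ln t powr \<alpha>)) \<longrightarrow>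
       (\<forall>j\<ge>1.
         (AE \<omega> in M. Limsup at_top (\<lambda>t. ereal
            ((Kstar S X j t \<omega> - prob_space.expectation M (Kstar S X j t)) /
             sqrt (prob_space.variance M (Kstar S X j t) *
                   ln (ln (prob_space.variance M (Kstar S X j t)))))) = ereal (sqrt (2 / \<alpha>))) \<and>
         (AE \<omega> in M. Liminf at_top (\<lambda>t. ereal
            ((Kstar S X j t \<omega> - prob_space.expectation M (Kstar S X j t)) /
             sqrt (prob_space.variance M (Kstar S X j t) *
                   ln (ln (prob_space.variance M (Kstar S X j t)))))) = ereal (- sqrt (2 / \<alpha>))))) \<and>
     ((\<exists>\<beta> l. \<beta> > 0 \<and> slowly_varying l \<and> L \<sim>[at_top] (\<lambda>t. ln t powr \<beta> * l (ln t))) \<or>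
      (\<exists>\<sigma> \<alpha>. \<sigma> > 0 \<and> 0 < \<alpha> \<and> \<alpha> < 1 \<and> L \<sim>[at_top] (\<lambda>t. exp (\<sigma> * ln t powr \<alpha>))) \<longrightarrow>
       (\<forall>j\<ge>1.
         (\<lambda>t. prob_space.expectation M (Kstar S X j t)) \<sim>[at_top] (\<lambda>t. L t / real j) \<and>
         (\<lambda>t. prob_space.variance M (Kstar S X j t)) \<sim>[at_top]
           (\<lambda>t. (1 / real j - fact (2 * j - 1) / ((fact j)\<^sup>2 * 2 ^ (2 * j))) * L t)))"
proof -
  have Lpos: "eventually (\<lambda>t. L t > 0) at_top" by (rule slowly_varying_pos) fact
  have K1: "karlin_lil M p S X L (\<beta> / 2)"
    if "\<beta> > 0 \<and> slowly_varying l \<and> L \<sim>[at_top] (\<lambda>t. ln t powr \<beta> * l (ln t))" for \<beta> l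
    using that power_log_lower[OF _ _ _ Lpos, of \<beta> l] assms by (intro karlin_lilI) auto
  have K2: "karlin_lil M p S X L 1"
    if "\<sigma> > 0 \<and> 0 < \<alpha> \<and> \<alpha> < 1 \<and> L \<sim>[at_top] (\<lambda>t. exp (\<sigma> * ln t powr \<alpha>))" for \<sigma> \<alpha>
    using that exp_power_lower[OF _ _ _ Lpos, of \<sigma> \<alpha>] assms by (intro karlin_lilI) auto
  show ?thesis
  proof (intro conjI allI impI)
    fix \<beta> l and j :: nat
    assume *: "\<beta> > 0 \<and> slowly_varying l \<and> L \<sim>[at_top] (\<lambda>t. ln t powr \<beta> * l (ln t))" and j: "1 \<le> j"
    interpret karlin_lil M p S X L "\<beta> / 2" by (rule K1[OF *])
    have N: "((\<lambda>t. ln (var_sum p j t) / ln (ln t)) \<longlongrightarrow> \<beta>) at_top"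
      using * by (intro ln_ratio_power_log[OF _ _ _ var_sum_lim[OF j] var_const_pos[OF j]]) auto
    note conclusion = Kstar_normalized_limits[OF j conjunct1[OF *] N]
    show "AE \<omega> in M. Limsup at_top (\<lambda>t. ereal ((Kstar S X j t \<omega> - expectation (Kstar S X j t)) /
        sqrt (variance (Kstar S X j t) * ln (variance (Kstar S X j t))))) = ereal (sqrt (2 / \<beta>))"
      by (rule conclusion(1))
    show "AE \<omega> in M. Liminf at_top (\<lambda>t. ereal ((Kstar S X j t \<omega> - expectation (Kstar S X j t)) /
        sqrt (variance (Kstar S X j t) * ln (variance (Kstar S X j t))))) = ereal (- sqrt (2 / \<beta>))"
      by (rule conclusion(2))
  next
    fix \<sigma> \<alpha> :: real and j :: nat
    assume *: "\<sigma> > 0 \<and> 0 < \<alpha> \<and> \<alpha> < 1 \<and> L \<sim>[at_top] (\<lambda>t. exp (\<sigma> * ln t powr \<alpha>))" and j: "1 \<le> j"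
    interpret karlin_lil M p S X L 1 by (rule K2[OF *])
    have N: "((\<lambda>t. ln (ln (var_sum p j t)) / ln (ln t)) \<longlongrightarrow> \<alpha>) at_top"
      using * by (intro ln_ratio_exp_power(2)[OF _ _ _ var_sum_lim[OF j] var_const_pos[OF j]]) auto
    have \<alpha>: "\<alpha> > 0" using * by simp
    note conclusion = Kstar_normalized_limits[OF j \<alpha>, where N = "\<lambda>x. ln (ln x)", OF N]
    show "AE \<omega> in M. Limsup at_top (\<lambda>t. ereal ((Kstar S X j t \<omega> - expectation (Kstar S X j t)) /
        sqrt (variance (Kstar S X j t) * ln (ln (variance (Kstar S X j t)))))) = ereal (sqrt (2 / \<alpha>))"
      by (rule conclusion(1))
    show "AE \<omega> in M. Liminf at_top (\<lambda>t. ereal ((Kstar S X j t \<omega> - expectation (Kstar S X j t)) /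
        sqrt (variance (Kstar S X j t) * ln (ln (variance (Kstar S X j t)))))) = ereal (- sqrt (2 / \<alpha>))"
      by (rule conclusion(2))
  next
    fix j :: nat
    assume *: "(\<exists>\<beta> l. \<beta> > 0 \<and> slowly_varying l \<and> L \<sim>[at_top] (\<lambda>t. ln t powr \<beta> * l (ln t))) \<or>
      (\<exists>\<sigma> \<alpha>. \<sigma> > 0 \<and> 0 < \<alpha> \<and> \<alpha> < 1 \<and> L \<sim>[at_top] (\<lambda>t. exp (\<sigma> * ln t powr \<alpha>)))" and j: "1 \<le> j"
    then obtain \<kappa> where "karlin_lil M p S X L \<kappa>" using K1 K2 by blast
    then interpret karlin_lil M p S X L \<kappa> .
    show "(\<lambda>t. expectation (Kstar S X j t)) \<sim>[at_top] (\<lambda>t. L t / real j)"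
      by (rule Kstar_moments_asymp(1)[OF j])
    show "(\<lambda>t. variance (Kstar S X j t)) \<sim>[at_top]
           (\<lambda>t. (1 / real j - fact (2 * j - 1) / ((fact j)\<^sup>2 * 2 ^ (2 * j))) * L t)"
      using Kstar_moments_asymp(2)[OF j] unfolding var_const_def .
  qed
qed

end
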